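(* Let $\mathbb{P}$ be a nonempty finite set of primes, and let $\bar{\mathbb{P}}=\prod_{p\in\mathbb{P}}p$. Let $\tau\in\mathbb{C}$ with $\mathrm{Re}(\tau)>0$ and let $s\in\mathbb{C}$ with $\mathrm{Re}(s)>0$ and $s\neq 1$. Then $$ \begin{aligned} \zeta^2(s)&\prod_{p\in\mathbb{P}}\left(1-\frac{1}{p^s}\right)^2 =1+\frac{\pi^{s}\tau^{s/2}}{\Gamma^2\left(\frac{s}{2}\right)}\Bigg[\frac{1}{(s-1)\sqrt{\tau}}\prod_{p\in\mathbb{P}}\left(1-\frac1p\right)\Bigg(-2\sum_{n\mid\bar{\mathbb{P}}}\frac{\mu(n)}{n}\log n\\ &\qquad+\left(\frac{1}{s-1}+\gamma-\log(4\pi\sqrt{\tau})\right)\prod_{p\in\mathbb{P}}\left(1-\frac1p\right)\Bigg)\\ &+2\int_{1}^{\infty}t^{s/2-1}\Bigg(\sum_{\substack{n\ge 2\\(n,\bar{\mathbb{P}})=1}}d(n)K_{0}\left(2n\pi\sqrt{\tau t}\right)+t^{-s}\Bigg(\sum_{\substack{n\ge 2\\(n,\bar{\mathbb{P}})=1}}d(n)K_{0}\left(2n\pi\sqrt{\frac{\tau}{t}}\right)\\ &\qquad-\frac14\sqrt{\frac{t}{\tau}}\prod_{p\in\mathbb{P}}\left(1-\frac1p\right)\Bigg(-2\sum_{n\mid\bar{\mathbb{P}}}\frac{\mu(n)}{n}\log n+\left(\gamma-\log\left(4\pi\sqrt{\frac{\tau}{t}}\right)\right)\prod_{p\in\mathbb{P}}\left(1-\frac1p\right)\Bigg)\Bigg)\Bigg)dt\Bigg].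 \end{aligned} $$
   Context: $\zeta$ is the (analytically continued) Riemann zeta function, $\Gamma$ the gamma function, $\gamma$ Euler's constant, $\mu$ the Möbius function, $d(n)$ the number of positive divisors of $n$, and $K_\nu(z)$ the modified Bessel function of the second kind of order $\nu$. $(n,m)$ denotes the greatest common divisor. Complex powers, square roots and logarithms of $\tau$ (with $\mathrm{Re}(\tau)>0$) are principal branches. *)

theory Defs
  imports
    "HOL-Complex_Analysis.Complex_Analysis"
    "HOL-Computational_Algebra.Squarefree"
begin

section \<open>Arithmetic functions\<close>

definition moebius_mu :: "nat \<Rightarrow> int" where
  "moebius_mu n = (if squarefree n then (-1) ^ card (prime_factors n) else 0)"

definition divisor_count :: "nat \<Rightarrow> nat" where
  "divisor_count n = card {k. k dvd n}"


section \<open>The modified Bessel function of the second kind\<close>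

text \<open>
  This is DLMF 10.32.9, valid for all complex orders. The integral defines the Bessel function
  only for arguments in the open right half-plane; elsewhere the value is meaningless.
\<close>
definition Bessel_K :: "complex \<Rightarrow> complex \<Rightarrow> complex" where
  "Bessel_K \<nu> z =
     (LINT u:{0..}|lborel. exp (- z * cosh (of_real u)) * cosh (\<nu> * of_real u))"


section \<open>The Riemann zeta function\<close>

text \<open>
  \<^term>\<open>f\<close> is the analytic continuation of the Dirichlet series to the plane punctured at 1.
  The clause on the value at the pole only serves to make \<^term>\<open>f\<close> unique as a total function.
\<close>
definition is_zeta :: "(complex \<Rightarrow> complex) \<Rightarrow> bool" where
  "is_zeta f \<longleftrightarrow> f holomorphic_on - {1} \<and>
     (\<forall>s. Re s > 1 \<longrightarrow> (\<lambda>n. 1 / of_nat (Suc n) powr s) sums f s) \<and> f 1 = 0"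

definition zeta :: "complex \<Rightarrow> complex" where
  "zeta = (THE f. is_zeta f)"

text \<open>
  The rest of this section shows that this description is met by exactly one function.
  Expanding $(n+1)^{1-s}$ in powers of $1/n$ up to order $m+1$ and summing over $n$ expresses
  $(s-1)\zeta(s)$ through its values at $s+1, \ldots, s+m$ and a series that converges for
  $\mathrm{Re}(s) > -m$.
\<close>

definition falling :: "nat \<Rightarrow> complex \<Rightarrow> complex" where
  "falling j s = (\<Prod>i<j. 1 - s - of_nat i)"

definition zeta_rem :: "nat \<Rightarrow> complex \<Rightarrow> nat \<Rightarrow> complex" where
  "zeta_rem K s n = of_nat (n + 2) powr (1 - s)
     - (\<Sum>j\<le>K. falling j s / fact j * of_nat (n + 1) powr (1 - s - of_nat j))"

definition zeta_series :: "complex \<Rightarrow> complex" where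
  "zeta_series s = (\<Sum>n. of_nat (n + 1) powr - s)"

lemma falling_Suc: "falling (Suc j) s = falling j s * (1 - s - of_nat j)"
  by (simp add: falling_def)

lemma zeta_rem_bound:
  assumes "Re s + real K \<ge> 0"
  shows "norm (zeta_rem K s n) \<le> norm (falling (Suc K) s) * real (n + 1) powr (- Re s - real K)"
proof -
  define S where "S = (of_real ` {real (n+1)..real (n+2)} :: complex set)"
  define f where "f = (\<lambda>j x. falling j s * x powr (1 - s - of_nat j))"
  define B where "B = norm (falling (Suc K) s) * real (n + 1) powr (- Re s - real K)"
  have "norm (f 0 (of_nat (n+2)) -
      (\<Sum>i\<le>K. f i (of_nat (n+1)) * (of_nat (n+2) - of_nat (n+1)) ^ i / fact i))
     \<le> B * norm (of_nat (n+2) - of_nat (n+1) :: complex) ^ (Suc K) / fact K"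
  proof (rule complex_Taylor[of S])
    show "convex S"
      unfolding S_def by (intro convex_linear_image bounded_linear.linear[OF bounded_linear_of_real]) auto
  next
    fix i x assume x: "x \<in> S" and "i \<le> K"
    from x have nz: "x \<notin> \<real>\<^sub>\<le>\<^sub>0" by (auto simp: S_def complex_nonpos_Reals_iff)
    have "(f i has_field_derivative falling i s * ((1 - s - of_nat i) * x powr (1 - s - of_nat i - 1)))
            (at x within S)"
      unfolding f_def
      by (rule DERIV_cmult[OF has_field_derivative_at_within[OF has_field_derivative_powr[OF nz]]])
    thus "(f i has_field_derivative f (Suc i) x) (at x within S)"
      by (simp add: f_def falling_Suc algebra_simps)
  next
    fix x assume "x \<in> S"
    then obtain y where y: "x = of_real y" "y \<ge> real (n+1)" by (auto simp: S_def)
    have "norm (x powr (1 - s - of_nat (Suc K))) = y powr (- Re s - real K)"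
      using y by (subst norm_powr_real_powr) auto
    also have "\<dots> \<le> real (n+1) powr (- Re s - real K)"
      using y assms by (intro powr_mono2') auto
    finally show "norm (f (Suc K) x) \<le> B"
      unfolding f_def B_def norm_mult by (intro mult_left_mono) auto
  next
    show "of_nat (n+1) \<in> S" unfolding S_def
      by (rule image_eqI[of _ _ "real (n+1)"]) auto
    show "of_nat (n+2) \<in> S" unfolding S_def
      by (rule image_eqI[of _ _ "real (n+2)"]) auto
  qed
  also have "B * norm (of_nat (n+2) - of_nat (n+1) :: complex) ^ (Suc K) / fact K = B / fact K"
    by simp
  also have "\<dots> \<le> B / 1"
    by (intro divide_left_mono) (auto simp: B_def fact_ge_1)
  also have "f 0 (of_nat (n+2)) -
      (\<Sum>i\<le>K. f i (of_nat (n+1)) * (of_nat (n+2) - of_nat (n+1)) ^ i / fact i) = zeta_rem K s n"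
    by (simp add: f_def zeta_rem_def falling_def del: of_nat_Suc of_nat_add) simp
  finally show ?thesis by (simp add: B_def)
qed

lemma summable_real_Suc_powr:
  assumes "a > 1"
  shows "summable (\<lambda>n. real (n + 1) powr - a)"
  using assms summable_real_powr_iff[of "-a"] summable_Suc_iff[of "\<lambda>n. real n powr - a"] by simp

lemma zeta_rem_majorant:
  fixes s0 :: complex
  assumes "Re s0 + real K > 1"
  obtains d M where "d > 0" "summable M"
    "\<And>n s. s \<in> cball s0 d \<Longrightarrow> Re s + real K > 1 \<and> norm (zeta_rem K s n) \<le> M n"
proof -
  define d where "d = (Re s0 + real K - 1) / 2"
  define C where "C = (\<Prod>i<Suc K. 1 + norm s0 + d + real i)"
  define M where "M = (\<lambda>n. C * real (n + 1) powr - (1 + d))"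
  have d: "d > 0" using assms by (simp add: d_def)
  show ?thesis
  proof (rule that[of d M])
    show "summable M"
      unfolding M_def by (intro summable_mult summable_real_Suc_powr) (use d in auto)
    fix n s assume s: "s \<in> cball s0 d"
    hence ns: "norm (s0 - s) \<le> d" by (simp add: dist_norm)
    hence "Re s0 - Re s \<le> d" using complex_Re_le_cmod[of "s0 - s"] by simp
    hence re: "Re s + real K \<ge> 1 + d" by (simp add: d_def field_simps)
    have nf: "norm (falling (Suc K) s) \<le> C"
      unfolding falling_def C_def prod_norm[symmetric]
    proof (intro prod_mono conjI norm_ge_zero)
      fix i
      have "norm (1 - s - of_nat i) \<le> norm (1 :: complex) + norm s + norm (of_nat i :: complex)"
        using norm_triangle_ineq4[of "1 - s" "of_nat i"] norm_triangle_ineq4[of 1 s] by linarith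
      moreover have "norm s \<le> norm s0 + d"
        using ns norm_triangle_ineq2[of s s0] by (simp add: norm_minus_commute)
      ultimately show "norm (1 - s - of_nat i) \<le> 1 + norm s0 + d + real i" by simp
    qed
    have "norm (zeta_rem K s n) \<le> norm (falling (Suc K) s) * real (n + 1) powr (- Re s - real K)"
      by (rule zeta_rem_bound) (use re d in linarith)
    also have "\<dots> \<le> C * real (n + 1) powr - (1 + d)"
      by (intro mult_mono nf powr_mono order.trans[OF norm_ge_zero nf]) (use re in auto)
    finally show "Re s + real K > 1 \<and> norm (zeta_rem K s n) \<le> M n"
      using re d by (simp add: M_def)
  qed (use d in auto)
qed

lemma holomorphic_falling [holomorphic_intros]: "falling j holomorphic_on A"
  unfolding falling_def by (intro holomorphic_intros)

lemma holomorphic_zeta_rem: "(\<lambda>s. zeta_rem K s n) holomorphic_on A"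
  unfolding zeta_rem_def by (intro holomorphic_intros) (auto simp del: of_nat_Suc)

lemma holomorphic_suminf_zeta_rem:
  "(\<lambda>s. \<Sum>n. zeta_rem K s n) holomorphic_on {s. Re s + real K > 1}" (is "_ holomorphic_on ?S")
proof (rule holomorphic_uniform_sequence)
  show "open ?S" using open_halfspace_Re_gt[of "1 - real K"] by (simp add: algebra_simps)
  show "(\<lambda>s. \<Sum>i<n. zeta_rem K s i) holomorphic_on ?S" for n
    by (intro holomorphic_intros holomorphic_zeta_rem)
  fix s0 assume "s0 \<in> ?S"
  then obtain d M where dM: "d > 0" "summable M"
    "\<And>n s. s \<in> cball s0 d \<Longrightarrow> Re s + real K > 1 \<and> norm (zeta_rem K s n) \<le> M n"
    using zeta_rem_majorant[of s0 K] by auto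
  have "uniform_limit (cball s0 d) (\<lambda>n s. \<Sum>i<n. zeta_rem K s i) (\<lambda>s. \<Sum>n. zeta_rem K s n) sequentially"
    by (rule Weierstrass_m_test[of _ _ M]) (use dM in auto)
  with dM show "\<exists>d>0. cball s0 d \<subseteq> ?S \<and>
     uniform_limit (cball s0 d) (\<lambda>n s. \<Sum>i<n. zeta_rem K s i) (\<lambda>s. \<Sum>n. zeta_rem K s n) sequentially"
    by (intro exI[of _ d]) auto
qed

lemma summable_zeta_rem:
  assumes "Re s + real K > 1"
  shows "summable (\<lambda>n. zeta_rem K s n)"
proof -
  obtain d M where dM: "d > 0" "summable M"
    "\<And>n s'. s' \<in> cball s d \<Longrightarrow> Re s' + real K > 1 \<and> norm (zeta_rem K s' n) \<le> M n"
    using zeta_rem_majorant[OF assms] by metis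
  show ?thesis
    by (rule summable_comparison_test'[OF dM(2), of 0]) (use dM in auto)
qed

lemma summable_zeta_series:
  assumes "Re s > 1"
  shows "summable (\<lambda>n. of_nat (n + 1) powr - s)"
proof (rule summable_norm_cancel, rule summable_cong[THEN iffD1])
  show "summable (\<lambda>n. real (n + 1) powr - Re s)"
    by (rule summable_real_Suc_powr) fact
  show "\<forall>\<^sub>F n in sequentially. real (n + 1) powr - Re s = norm (of_nat (n + 1) powr - s :: complex)"
    by (intro always_eventually allI, subst norm_powr_real_powr) auto
qed

lemma zeta_series_recurrence:
  assumes s: "Re s > 1"
  shows "(1 - s) * zeta_series s =
           - 1 - (\<Sum>j=2..K+1. falling j s / fact j * zeta_series (s + of_nat j - 1))
             - (\<Sum>n. zeta_rem (K+1) s n)"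
proof -
  have "(\<lambda>n. of_nat (n + 1) powr (1 - s)) \<longlonglongrightarrow> (0 :: complex)"
  proof (rule tendsto_norm_zero_cancel)
    have "(\<lambda>n. real (n + 1) powr (1 - Re s)) \<longlonglongrightarrow> 0"
      using s by (intro tendsto_neg_powr) (auto intro: filterlim_tendsto_add_at_top[OF tendsto_const filterlim_real_sequentially])
    thus "(\<lambda>n. norm (of_nat (n + 1) powr (1 - s) :: complex)) \<longlonglongrightarrow> 0"
      by (subst norm_powr_real_powr) auto
  qed
  hence tele: "(\<lambda>n. of_nat (Suc n + 1) powr (1 - s) - of_nat (n + 1) powr (1 - s)) sums (0 - of_nat (0 + 1) powr (1 - s) :: complex)"
    by (rule telescope_sums)
  have t: "(\<lambda>n. falling j s / fact j * of_nat (n + 1) powr (1 - s - of_nat j)) sums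
             (falling j s / fact j * zeta_series (s + of_nat j - 1))" if "j \<in> {1..K+1}" for j
  proof -
    have "(\<lambda>n. of_nat (n + 1) powr - (s + of_nat j - 1)) sums zeta_series (s + of_nat j - 1)"
      unfolding zeta_series_def
      by (intro summable_sums summable_zeta_series) (use that s in auto)
    moreover have "- (s + of_nat j - 1) = 1 - s - of_nat j" by simp
    ultimately show ?thesis by (intro sums_mult) metis
  qed
  have "(\<lambda>n. (\<Sum>j=1..K+1. falling j s / fact j * of_nat (n + 1) powr (1 - s - of_nat j))
            + zeta_rem (K+1) s n) sums
         ((\<Sum>j=1..K+1. falling j s / fact j * zeta_series (s + of_nat j - 1)) + (\<Sum>n. zeta_rem (K+1) s n))"
    by (intro sums_add sums_sum t summable_sums summable_zeta_rem) (use s in auto)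
  also have "(\<lambda>n. (\<Sum>j=1..K+1. falling j s / fact j * of_nat (n + 1) powr (1 - s - of_nat j))
            + zeta_rem (K+1) s n) = (\<lambda>n. of_nat (Suc n + 1) powr (1 - s) - of_nat (n + 1) powr (1 - s))"
  proof
    fix n
    have "{..K+1} = insert 0 {1..K+1}" by auto
    thus "(\<Sum>j=1..K+1. falling j s / fact j * of_nat (n + 1) powr (1 - s - of_nat j))
            + zeta_rem (K+1) s n = of_nat (Suc n + 1) powr (1 - s) - of_nat (n + 1) powr (1 - s)"
      unfolding zeta_rem_def by (simp add: falling_def)
  qed
  finally have "(\<Sum>j=1..K+1. falling j s / fact j * zeta_series (s + of_nat j - 1)) + (\<Sum>n. zeta_rem (K+1) s n) = -1"
    using sums_unique2[OF _ tele] by simp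
  moreover have "{1..K+1} = insert 1 {2..K+1}" by auto
  hence "(\<Sum>j=1..K+1. falling j s / fact j * zeta_series (s + of_nat j - 1)) =
         (1 - s) * zeta_series s + (\<Sum>j=2..K+1. falling j s / fact j * zeta_series (s + of_nat j - 1))"
    by (simp add: falling_def)
  ultimately show ?thesis by (smt (verit) add.commute add_diff_eq diff_add_cancel diff_diff_eq)
qed

lemma zeta_half_plane:
  "\<exists>G. G holomorphic_on {s. Re s + real m > 1} \<and> (\<forall>s. Re s > 1 \<longrightarrow> G s = (s - 1) * zeta_series s)"
proof (induction m)
  case 0
  define G where "G = (\<lambda>s. 1 + (\<Sum>n. zeta_rem 0 s n))"
  have Z: "(\<lambda>s. (s - 1) * zeta_series s) holomorphic_on {s. Re s > 1}"
  proof -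
    have eq: "1 + (\<Sum>n. zeta_rem 1 s n) = (s - 1) * zeta_series s" if "Re s > 1" for s
      using zeta_series_recurrence[OF that, of 0] by (simp add: algebra_simps)
    have "(\<lambda>s. 1 + (\<Sum>n. zeta_rem 1 s n)) holomorphic_on {s. Re s > 1}"
      by (intro holomorphic_intros holomorphic_on_subset[OF holomorphic_suminf_zeta_rem]) auto
    thus ?thesis using eq by (subst holomorphic_cong[OF refl, of _ _ "\<lambda>s. 1 + (\<Sum>n. zeta_rem 1 s n)"]) auto
  qed
  thus ?case by auto
next
  case (Suc m)
  then obtain G where G: "G holomorphic_on {s. Re s + real m > 1}"
    "\<And>s. Re s > 1 \<Longrightarrow> G s = (s - 1) * zeta_series s" by blast
  define H where "H = (\<lambda>s. 1 - (\<Sum>j=2..Suc m. falling (j-1) s / fact j * G (s + of_nat j - 1))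
                         + (\<Sum>n. zeta_rem (Suc m) s n))"
  have "H holomorphic_on {s. Re s + real (Suc m) > 1}"
    unfolding H_def
  proof (intro holomorphic_intros holomorphic_suminf_zeta_rem)
    fix j assume j: "j \<in> {2..Suc m}"
    show "(\<lambda>s. G (s + of_nat j - 1)) holomorphic_on {s. Re s + real (Suc m) > 1}"
      by (rule holomorphic_on_compose_gen[OF _ G(1), of "\<lambda>s. s + of_nat j - 1", unfolded o_def])
         (use j in \<open>auto intro!: holomorphic_intros\<close>)
  qed auto
  moreover have "H s = (s - 1) * zeta_series s" if s: "Re s > 1" for s
  proof -
    have "falling j s / fact j * zeta_series (s + of_nat j - 1) =
          - (falling (j-1) s / fact j * G (s + of_nat j - 1))" if j: "j \<in> {2..Suc m}" for j
    proof -
      define c where "c = s + of_nat j - 1 - 1"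
      have "G (s + of_nat j - 1) = c * zeta_series (s + of_nat j - 1)"
        unfolding c_def by (rule G(2)) (use j s in auto)
      moreover have "falling j s = falling (j-1) s * (- c)"
        unfolding c_def using falling_Suc[of "j-1" s] j by (simp add: of_nat_diff algebra_simps)
      ultimately show ?thesis by simp
    qed
    hence "(\<Sum>j=2..Suc m. falling j s / fact j * zeta_series (s + of_nat j - 1)) =
          - (\<Sum>j=2..Suc m. falling (j-1) s / fact j * G (s + of_nat j - 1))"
      by (simp add: sum_negf)
    with zeta_series_recurrence[OF s, of m] have
      "(1 - s) * zeta_series s = - H s" unfolding H_def by simp
    thus ?thesis by (simp add: algebra_simps)
  qed
  ultimately show ?case by blast
qed

lemma zeta_half_plane_unique:
  assumes "F holomorphic_on {s. Re s > a}" "G holomorphic_on {s. Re s > a}" "a \<le> 1"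
    and "\<And>s. Re s > 1 \<Longrightarrow> F s = G s" and "Re s > a"
  shows "F s = G s"
proof (rule analytic_continuation_open[of "{s. Re s > 1}" "{s. Re s > a}" F G])
  show "{s. Re s > 1} \<noteq> {}" by (auto intro!: exI[of _ 2])
  show "connected {s. Re s > a}" by (intro convex_connected convex_halfspace_Re_gt)
  show "{s. Re s > 1} \<subseteq> {s. Re s > a}" using \<open>a \<le> 1\<close> by auto
  show "F z = G z" if "z \<in> {s. Re s > 1}" for z using assms(4) that by simp
  show "s \<in> {s. Re s > a}" using \<open>Re s > a\<close> by simp
qed (fact open_halfspace_Re_gt assms)+

lemma is_zeta_exists: "\<exists>f. is_zeta f"
proof -
  obtain G where G: "\<And>m. G m holomorphic_on {s. Re s > 1 - real m}"
    "\<And>m s. Re s > 1 \<Longrightarrow> G m s = (s - 1) * zeta_series s"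
  proof -
    have "{s. Re s + real m > 1} = {s. Re s > 1 - real m}" for m by auto
    hence "\<forall>m. \<exists>G. G holomorphic_on {s. Re s > 1 - real m} \<and>
             (\<forall>s. Re s > 1 \<longrightarrow> G s = (s - 1) * zeta_series s)"
      using zeta_half_plane by simp
    from choice[OF this] show ?thesis using that by blast
  qed
  have agree: "G m s = G n s" if "Re s > 1 - real m" "m \<le> n" for m n s
    by (rule zeta_half_plane_unique[of "G m" "1 - real m" "G n"])
       (use that in \<open>auto intro: G(1) holomorphic_on_subset[OF G(1)] simp: G(2)\<close>)
  define F where "F = (\<lambda>s. G (nat \<lceil>2 - Re s\<rceil>) s)"
  have F: "F s = G m s" if "Re s > 1 - real m" for m s
  proof -
    have "Re s > 1 - real (nat \<lceil>2 - Re s\<rceil>)" by linarith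
    with that show ?thesis unfolding F_def by (metis agree nle_le)
  qed
  have "F holomorphic_on UNIV"
  proof -
    have "F holomorphic_on {s. Re s > 1 - real m}" for m
      using G(1)[of m] by (rule holomorphic_transform) (simp add: F)
    hence "F holomorphic_on (\<Union>m. {s. Re s > 1 - real m})"
      by (intro holomorphic_on_UN_open) (auto intro: open_halfspace_Re_gt)
    moreover have "(\<Union>m. {s. Re s > 1 - real m}) = UNIV"
    proof (intro set_eqI iffI UNIV_I)
      fix s
      have "Re s > 1 - real (nat \<lceil>2 - Re s\<rceil>)" by linarith
      thus "s \<in> (\<Union>m. {s. Re s > 1 - real m})" by blast
    qed
    ultimately show ?thesis by simp
  qed
  hence "(\<lambda>s. F s / (s - 1)) holomorphic_on - {1}"
    by (intro holomorphic_intros) (auto intro: holomorphic_on_subset)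
  moreover have "(\<lambda>n. 1 / of_nat (Suc n) powr s) sums (F s / (s - 1))" if s: "Re s > 1" for s
  proof -
    have "F s / (s - 1) = zeta_series s" using s F[of 0 s] G(2)[of s 0] by auto
    thus ?thesis using summable_sums[OF summable_zeta_series[OF s]]
      by (simp add: zeta_series_def powr_minus divide_inverse)
  qed
  ultimately have "is_zeta (\<lambda>s. F s / (s - 1))" by (simp add: is_zeta_def)
  thus ?thesis by blast
qed

lemma is_zeta_unique:
  assumes "is_zeta f" "is_zeta g"
  shows "f = g"
proof
  fix s :: complex
  show "f s = g s"
  proof (cases "s = 1")
    case False
    show ?thesis
    proof (rule analytic_continuation_open[of "{s. Re s > 1}" "- {1}" f g])
      show "{s. Re s > 1} \<noteq> {}" by (auto intro!: exI[of _ 2])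
      show "connected (- {1 :: complex})"
        by (rule connected_punctured_universe) simp
      show "f z = g z" if "z \<in> {s. Re s > 1}" for z
        using assms that unfolding is_zeta_def by (auto intro: sums_unique2)
    qed (use assms False in \<open>auto simp: is_zeta_def intro: open_halfspace_Re_gt\<close>)
  qed (use assms in \<open>auto simp: is_zeta_def\<close>)
qed

theorem is_zeta_zeta: "is_zeta zeta"
  unfolding zeta_def using is_zeta_exists is_zeta_unique by (metis theI)

end

theory Submission
  imports Defs
begin

text \<open>
  Write \<open>c = \<pi> \<surd>\<tau>\<close>, and for a set \<open>X\<close> of positive integers let
  \<open>\<theta>(y) = (\<Sum>a\<in>X. exp (-c a\<^sup>2 y))\<close>. The Bessel function
  \<open>K\<^sub>0(2z)\<close> is half the integral of \<open>exp (-z (exp u + exp (-u)))\<close> over the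
  line, and shifting \<open>u\<close> by \<open>ln (b/a)\<close> turns the kernel of \<open>z a b\<close> into
  \<open>exp (-z (a\<^sup>2 exp u + b\<^sup>2 exp (-u)))\<close>, a product of a term of
  \<open>\<theta>\<close> at \<open>exp (x+u)\<close> and one at \<open>exp (x-u)\<close> when
  \<open>z = c exp x\<close>. Since \<open>d(n)\<close> counts the factorisations \<open>n = a b\<close>,
  the Bessel sum weighted by \<open>d(n)\<close> is half the integral of
  \<open>\<theta>(exp (x+u)) \<theta>(exp (x-u))\<close> over \<open>u\<close>. With
  \<open>w(v) = exp (v/2) \<theta>(exp v)\<close>, the sum times \<open>exp x\<close> is the autocorrelation
  \<open>W(x)\<close>, half the integral of \<open>w(x+u) w(x-u)\<close>
  (\<open>theta_autocorrelation_eq_Bessel_sum\<close>). The variable \<open>y\<close> of \<open>\<theta>\<close>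
  stays real throughout, so the argument is the same for complex \<open>\<tau>\<close> as for positive
  \<open>\<tau>\<close>.

  Two facts about \<open>W\<close> carry the proof. First, in the coordinates \<open>x + u\<close> and
  \<open>x - u\<close> the double integral for the two-sided Laplace transform of \<open>W\<close> splits, so
  that this transform is a quarter of the square of
  \<open>\<Gamma>(s/2) c^(-s/2) (\<Sum>a\<in>X. a^(-s))\<close>
  (\<open>autocorr_weighted_theta_mellin\<close>). For the integers coprime to the primes the Dirichlet series is
  \<open>\<zeta>(s)\<close> times the Euler factor; for \<open>X = {1}\<close> it is 1, and subtracting this
  case removes the term \<open>n = 1\<close> and produces the isolated 1 of the formula. Second, for the coprime
  integers \<open>w(v)\<close> differs from a constant by \<open>O(exp v)\<close>
  (\<open>weighted_theta_coprime_limit\<close>): this is the trapezoidal rule for the Gaussian, whose endpoint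
  contribution \<open>-1/2\<close> is cancelled by \<open>\<Sum> \<mu>(n) = 0\<close>, the sum running over the
  divisors of the nonempty product of primes. Convolving, \<open>W(x)\<close> is \<open>B0 + B1 x\<close> up to
  \<open>O(exp ((1-\<epsilon>)x))\<close> at \<open>-\<infinity>\<close> (\<open>autocorr_asymptotic\<close>).

  Folding the transform at the origin and subtracting \<open>B0 + B1 x\<close> on the negative half-line
  therefore leaves a function of \<open>s\<close> that is holomorphic for \<open>Re s > 0\<close>, while for
  real \<open>s > 2\<close> the subtracted part contributes \<open>B0/(s-1) - B1/(s-1)\<^sup>2\<close>. After
  multiplication by \<open>(s-1)\<^sup>2\<close> the identity theorem extends the equation to the half-plane
  (\<open>regularised_identity\<close>). The constants \<open>B0\<close> and \<open>B1\<close> are determined here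
  and not from the asymptotic analysis: the extended equation and its first derivative at \<open>s = 1\<close>
  give them in terms of \<open>\<gamma>\<close>, \<open>\<psi>(1/2)\<close> and the Euler factor
  (\<open>log_pole_constants\<close>). The substitution \<open>t = exp (2x)\<close> turns the folded transform
  into the integral over \<open>t \<ge> 1\<close>.
\<close>


section \<open>Functions with exponential bounds and their Laplace transforms\<close>

lemma integrable_exp_decay:
  fixes a :: real assumes "a > 0"
  shows "set_integrable lborel {0..} (\<lambda>x. exp (- a * x))"
    and "(LINT x:{0..}|lborel. exp (- a * x)) = 1 / a"
proof -
  have "(\<lambda>x. exp (- a * x)) absolutely_integrable_on {0..}"
    using has_integral_exp_minus_to_infinity[OF assms, of 0]
    by (intro nonnegative_absolutely_integrable_1) (auto simp: has_integral_iff)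
  thus I: "set_integrable lborel {0..} (\<lambda>x. exp (- a * x))"
    unfolding set_integrable_def by (subst (asm) integrable_completion) auto
  show "(LINT x:{0..}|lborel. exp (- a * x)) = 1 / a"
    using set_borel_integral_eq_integral(2)[OF I] has_integral_exp_minus_to_infinity[OF assms, of 0]
    by (simp add: has_integral_iff)
qed

lemma set_integrable_exp_bound:
  fixes f :: "real \<Rightarrow> complex"
  assumes [measurable]: "f \<in> borel_measurable borel" and "a > 0"
    and b: "\<And>x. x \<ge> 0 \<Longrightarrow> norm (f x) \<le> K * exp (- a * x)"
  shows "set_integrable lborel {0..} f"
proof (rule set_integrable_bound[OF set_integrable_mult_right[OF integrable_exp_decay(1)[OF \<open>a > 0\<close>], of K]])
  show "AE x in lborel. x \<in> {0..} \<longrightarrow> norm (f x) \<le> norm (K * exp (- a * x))"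
  proof (intro AE_I2 impI)
    fix x :: real assume "x \<in> {0..}"
    hence "norm (f x) \<le> K * exp (- a * x)" by (intro b) auto
    thus "norm (f x) \<le> norm (K * exp (- a * x))" by (rule order.trans) (simp only: real_norm_def abs_ge_self)
  qed
qed (auto simp: set_borel_measurable_def)

lemma integrable_exp_abs_bound:
  fixes f :: "real \<Rightarrow> complex"
  assumes [measurable]: "f \<in> borel_measurable borel" and "a > 0"
    and b: "\<And>x. norm (f x) \<le> K * exp (- a * \<bar>x\<bar>)"
  shows "integrable lborel f"
proof -
  have 1: "set_integrable lborel {0..} f"
  proof (rule set_integrable_exp_bound[OF _ \<open>a > 0\<close>, of _ K])
    show "norm (f x) \<le> K * exp (- a * x)" if "x \<ge> 0" for x using b[of x] that by simp
  qed auto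
  have "set_integrable lborel {0..} (\<lambda>x. f (-x))"
  proof (rule set_integrable_exp_bound[OF _ \<open>a > 0\<close>, of _ K])
    show "norm (f (-x)) \<le> K * exp (- a * x)" if "x \<ge> 0" for x using b[of "-x"] that by simp
  qed auto
  hence "integrable lborel (\<lambda>x. indicator {0..} x *\<^sub>R f (-x))" by (simp add: set_integrable_def)
  hence "integrable lborel (\<lambda>x. indicator {0..} (0 + (-1) * x) *\<^sub>R f (- (0 + (-1) * x)))"
    by (rule lborel_integrable_real_affine) auto
  hence 2: "set_integrable lborel {..0} f"
    unfolding set_integrable_def by (rule back_subst[of "integrable lborel"]) (auto simp: indicator_def)
  have "set_integrable lborel ({0..} \<union> {..0}) f"
    by (rule set_integrable_Un[OF 1 2]) auto
  moreover have "{0..} \<union> {..0} = (UNIV :: real set)" by auto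
  ultimately show ?thesis by (simp add: set_integrable_def)
qed

lemma integral_split_at_0:
  fixes f :: "real \<Rightarrow> complex"
  assumes I: "integrable lborel f"
  shows "integral\<^sup>L lborel f = (LINT u:{0..}|lborel. f u) + (LINT u:{0..}|lborel. f (- u))"
proof -
  have S: "set_integrable lborel A f" if "A \<in> sets borel" for A
    using I that by (simp add: set_integrable_def integrable_mult_indicator)
  have "integral\<^sup>L lborel f = (LINT u:({0..} \<union> {..<0})|lborel. f u)"
  proof -
    have "{0..} \<union> {..<0} = (UNIV :: real set)" by auto
    thus ?thesis by (simp add: set_lebesgue_integral_def)
  qed
  also have "\<dots> = (LINT u:{0..}|lborel. f u) + (LINT u:{..<0}|lborel. f u)"
    by (rule set_integral_Un) (use S in auto)
  also have "(LINT u:{..<0}|lborel. f u) = (LINT u:{..0}|lborel. f u)"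
    unfolding set_lebesgue_integral_def
    by (rule integral_cong_AE)
       (use I AE_lborel_singleton[of 0] in \<open>auto simp: indicator_def elim!: eventually_mono intro!: borel_measurable_integrable\<close>)
  also have "\<dots> = (LINT u:{0..}|lborel. f (- u))"
    unfolding set_lebesgue_integral_def
    using lborel_integral_real_affine[of "-1" "\<lambda>u. indicator {..0} u *\<^sub>R f u" 0]
    by (simp add: indicator_def)
  finally show ?thesis .
qed

lemma integral_even:
  fixes f :: "real \<Rightarrow> complex"
  assumes "integrable lborel f" and "\<And>u. f (-u) = f u"
  shows "integral\<^sup>L lborel f = 2 * (LINT u:{0..}|lborel. f u)"
  using integral_split_at_0[OF assms(1)] assms(2) by simp

lemma norm_set_integral_exp_bound:
  fixes f :: "real \<Rightarrow> complex"
  assumes [measurable]: "f \<in> borel_measurable borel" and a: "a > 0"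
    and b: "\<And>x. x \<ge> 0 \<Longrightarrow> norm (f x) \<le> K * exp (- a * x)"
  shows "norm (LINT x:{0..}|lborel. f x) \<le> K / a"
proof -
  have "norm (LINT x:{0..}|lborel. f x) \<le> (LINT x:{0..}|lborel. norm (f x))"
    by (rule set_integral_norm_bound[OF set_integrable_exp_bound[OF _ a b]]) auto
  also have "\<dots> \<le> (LINT x:{0..}|lborel. K * exp (- a * x))"
    using set_integrable_norm[OF set_integrable_exp_bound[OF _ a b]] set_integrable_mult_right[OF integrable_exp_decay(1)[OF a], of K] b
    by (intro set_integral_mono) auto
  also have "\<dots> = K / a" using integrable_exp_decay(2)[OF a] by simp
  finally show ?thesis .
qed

text \<open>
  Differentiation under the integral sign: on a half-plane that reaches from the point half of the way to the line
  \<open>Re s = b\<close>, the difference quotients of the kernel are bounded by its derivative there, and the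
  factor \<open>x\<close> that this derivative carries is absorbed by giving up half of the remaining exponential
  decay.
\<close>
lemma laplace_holomorphic:
  fixes f :: "real \<Rightarrow> complex"
  assumes [measurable]: "f \<in> borel_measurable borel"
    and b: "\<And>x. x \<ge> 0 \<Longrightarrow> norm (f x) \<le> K * exp (b * x)"
  shows "(\<lambda>s. LINT x:{0..}|lborel. exp (- s * of_real x) * f x) holomorphic_on {s. Re s > b}"
proof -
  define L where "L = (\<lambda>s. LINT x:{0..}|lborel. exp (- s * of_real x) * f x)"
  have K: "K \<ge> 0" using order.trans[OF norm_ge_zero b[of 0]] by simp
  have I: "set_integrable lborel {0..} (\<lambda>x. exp (- s * of_real x) * f x)" if "Re s > b" for s
  proof (rule set_integrable_exp_bound[of _ "Re s - b" K])
    fix x :: real assume "x \<ge> 0"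
    have "norm (exp (- s * of_real x) * f x) = exp (- Re s * x) * norm (f x)" by (simp add: norm_mult)
    also have "\<dots> \<le> exp (- Re s * x) * (K * exp (b * x))" using b[OF \<open>x \<ge> 0\<close>] by (intro mult_left_mono) auto
    also have "\<dots> = K * exp (- (Re s - b) * x)" by (simp add: algebra_simps exp_add[symmetric])
    finally show "norm (exp (- s * of_real x) * f x) \<le> K * exp (- (Re s - b) * x)" .
  qed (use that in auto)
  have "\<exists>D. (L has_field_derivative D) (at z)" if z: "Re z > b" for z
  proof -
    define \<eta> where "\<eta> = (Re z - b) / 2"
    define \<sigma> where "\<sigma> = b + \<eta>"
    have \<eta>: "\<eta> > 0" and \<sigma>: "\<sigma> > b" "Re z > \<sigma>" using z by (auto simp: \<eta>_def \<sigma>_def field_simps)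
    define D where "D = (LINT x:{0..}|lborel. - of_real x * exp (- z * of_real x) * f x)"
    have lip: "norm (exp (- w * of_real x) - exp (- z * of_real x)) \<le> x * exp (- \<sigma> * x) * norm (w - z)"
      if "Re w \<ge> \<sigma>" "x \<ge> 0" for w x
    proof (rule field_differentiable_bound[of "{w. Re w \<ge> \<sigma>}"])
      fix u assume "u \<in> {w. Re w \<ge> \<sigma>}"
      show "((\<lambda>w. exp (- w * of_real x)) has_field_derivative (- of_real x * exp (- u * of_real x)))
              (at u within {w. \<sigma> \<le> Re w})"
        by (auto intro!: derivative_eq_intros)
      show "norm (- of_real x * exp (- u * of_real x)) \<le> x * exp (- \<sigma> * x)"
        using \<open>u \<in> _\<close> that by (auto simp: norm_mult mult.commute[of x] intro!: mult_right_mono)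
    qed (use that \<sigma> in \<open>auto simp: convex_halfspace_Re_ge\<close>)
    have "(L has_field_derivative D) (at z)"
      unfolding has_field_derivative_iff tendsto_at_iff_sequentially o_def
    proof (intro allI impI)
      fix W :: "nat \<Rightarrow> complex" assume WU: "\<forall>i. W i \<in> UNIV - {z}" and Wlim: "W \<longlonglongrightarrow> z"
      from WU have W: "W i \<noteq> z" for i by auto
      have ev: "eventually (\<lambda>i. Re (W i) > \<sigma>) sequentially"
        using tendsto_Re[OF Wlim] \<sigma>(2) by (rule order_tendstoD)
      then obtain M where M: "\<And>i. i \<ge> M \<Longrightarrow> Re (W i) > \<sigma>" by (auto simp: eventually_sequentially)
      \<comment> \<open>The shift by \<open>M\<close> makes the domination hold for all indices.\<close>
      define g where "g = (\<lambda>i x. indicator {0..} x *\<^sub>R ((exp (- W (i+M) * of_real x) - exp (- z * of_real x)) / (W (i+M) - z) * f x))"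
      have lim: "(\<lambda>i. integral\<^sup>L lborel (g i)) \<longlonglongrightarrow> D"
        unfolding D_def set_lebesgue_integral_def
      proof (rule integral_dominated_convergence[where w = "\<lambda>x. indicator {0..} x *\<^sub>R (2 / \<eta> * K * exp (- (\<eta>/2) * x))"])
        show "integrable lborel (\<lambda>x. indicator {0..} x *\<^sub>R (2 / \<eta> * K * exp (- (\<eta>/2) * x)))"
          using set_integrable_mult_right[OF integrable_exp_decay(1)[of "\<eta>/2"], of "2/\<eta>*K"] \<eta>
          by (simp add: set_integrable_def)
        show "AE x in lborel. norm (g i x) \<le> indicator {0..} x *\<^sub>R (2 / \<eta> * K * exp (- (\<eta>/2) * x))" for i
        proof (intro AE_I2)
          fix x :: real
          show "norm (g i x) \<le> indicator {0..} x *\<^sub>R (2 / \<eta> * K * exp (- (\<eta>/2) * x))"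
          proof (cases "x \<ge> 0")
            case True
            have "norm (g i x) = norm (exp (- W (i+M) * of_real x) - exp (- z * of_real x)) / norm (W (i+M) - z) * norm (f x)"
              using True by (simp add: g_def norm_mult norm_divide)
            also have "\<dots> \<le> (x * exp (- \<sigma> * x)) * (K * exp (b * x))"
              using lip[of "W (i+M)" x] M[of "i+M"] True W[of "i+M"] b[OF True]
              by (intro mult_mono) (auto simp: field_simps)
            also have "\<dots> = K * exp (- \<eta> * x) * x"
              by (simp add: \<sigma>_def algebra_simps exp_add[symmetric])
            also have "\<dots> \<le> K * exp (- \<eta> * x) * (2 / \<eta> * exp (\<eta>/2 * x))"
            proof (rule mult_left_mono)
              have "\<eta>/2 * x \<le> exp (\<eta>/2 * x)" using exp_ge_add_one_self[of "\<eta>/2*x"] by linarith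
              thus "x \<le> 2 / \<eta> * exp (\<eta>/2 * x)" using \<eta> by (simp add: field_simps)
            qed (use K in auto)
            also have "\<dots> = 2 / \<eta> * K * exp (- (\<eta>/2) * x)"
              by (simp add: algebra_simps exp_add[symmetric])
            finally show ?thesis using True by simp
          qed (auto simp: g_def)
        qed
        show "AE x in lborel. (\<lambda>i. g i x) \<longlonglongrightarrow> indicator {0..} x *\<^sub>R (- of_real x * exp (- z * of_real x) * f x)"
        proof (intro AE_I2)
          fix x :: real
          have "((\<lambda>w. exp (- w * of_real x)) has_field_derivative (- of_real x * exp (- z * of_real x))) (at z)"
            by (auto intro!: derivative_eq_intros)
          hence "((\<lambda>w. (exp (- w * of_real x) - exp (- z * of_real x)) / (w - z)) \<longlongrightarrow> (- of_real x * exp (- z * of_real x))) (at z)"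
            by (simp add: has_field_derivative_iff)
          hence "(\<lambda>i. (exp (- W (i+M) * of_real x) - exp (- z * of_real x)) / (W (i+M) - z)) \<longlonglongrightarrow> (- of_real x * exp (- z * of_real x))"
            by (rule filterlim_compose)
               (use LIMSEQ_ignore_initial_segment[OF Wlim, of M] W in \<open>auto simp: filterlim_at\<close>)
          thus "(\<lambda>i. g i x) \<longlonglongrightarrow> indicator {0..} x *\<^sub>R (- of_real x * exp (- z * of_real x) * f x)"
            unfolding g_def by (intro tendsto_intros)
        qed
      qed (auto simp: g_def)
      have "integral\<^sup>L lborel (g i) = (L (W (i+M)) - L z) / (W (i+M) - z)" for i
      proof -
        have "L (W (i+M)) - L z = (LINT x:{0..}|lborel. exp (- W (i+M) * of_real x) * f x - exp (- z * of_real x) * f x)"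
          unfolding L_def using I M[of "i+M"] \<sigma> by (subst set_integral_diff) auto
        hence "(L (W (i+M)) - L z) / (W (i+M) - z) = (LINT x:{0..}|lborel. (exp (- W (i+M) * of_real x) * f x - exp (- z * of_real x) * f x) / (W (i+M) - z))"
          by simp
        also have "\<dots> = integral\<^sup>L lborel (g i)"
          unfolding g_def set_lebesgue_integral_def by (simp add: algebra_simps diff_divide_distrib)
        finally show ?thesis by simp
      qed
      with lim have "(\<lambda>i. (L (W (i+M)) - L z) / (W (i+M) - z)) \<longlonglongrightarrow> D" by simp
      thus "(\<lambda>i. (L (W i) - L z) / (W i - z)) \<longlonglongrightarrow> D" by (rule LIMSEQ_offset)
    qed
    thus ?thesis by blast
  qed
  hence "L holomorphic_on {s. Re s > b}"
    by (subst holomorphic_on_open) (auto simp: open_halfspace_Re_gt)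
  thus ?thesis by (simp add: L_def)
qed


section \<open>Substituting an exponential; the Gamma integral\<close>

text \<open>
  Both directions of the integrability statement are needed: for the Gamma integral one starts from the image
  side, for the final formula from the side of the logarithmic variable.
\<close>
lemma set_integral_exp_substitution:
  fixes f :: "real \<Rightarrow> complex" and a :: real
  assumes [measurable]: "f \<in> borel_measurable borel" "S \<in> sets borel" "T \<in> sets borel" and "a > 0"
    and T: "T = (\<lambda>x. exp (a * x)) ` S"
  shows "set_integrable lborel T f \<longleftrightarrow> set_integrable lborel S (\<lambda>x. (a * exp (a * x)) *\<^sub>R f (exp (a * x)))"
    and "(LINT t:T|lborel. f t) = (LINT x:S|lborel. (a * exp (a * x)) *\<^sub>R f (exp (a * x)))"
proof -
  define G where "G = (\<lambda>x. (a * exp (a * x)) *\<^sub>R f (exp (a * x)))"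
  have [measurable]: "G \<in> borel_measurable borel" unfolding G_def by measurable
  have ai: "set_integrable lborel A h \<longleftrightarrow> h absolutely_integrable_on A"
    if [measurable]: "h \<in> borel_measurable borel" "A \<in> sets borel" for h :: "real \<Rightarrow> complex" and A
    unfolding set_integrable_def by (subst integrable_completion) auto
  have S: "S \<in> sets lebesgue" using assms(2) by auto
  have iff: "G absolutely_integrable_on S \<and> integral S G = b \<longleftrightarrow> f absolutely_integrable_on T \<and> integral T f = b" for b
  proof -
    have der: "((\<lambda>x. exp (a * x)) has_field_derivative a * exp (a * x)) (at x within S)" for x
      by (auto intro!: derivative_eq_intros)
    have "inj_on (\<lambda>x. exp (a * x)) S" using \<open>a > 0\<close> by (simp add: inj_on_def)
    from has_absolute_integral_change_of_variables_real[OF S der this, of f b] \<open>a > 0\<close>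
    show ?thesis unfolding T G_def by (simp add: abs_mult)
  qed
  show int: "set_integrable lborel T f \<longleftrightarrow> set_integrable lborel S (\<lambda>x. (a * exp (a * x)) *\<^sub>R f (exp (a * x)))"
    using iff ai[of f T] ai[of G S] by (auto simp: G_def)
  show "(LINT t:T|lborel. f t) = (LINT x:S|lborel. (a * exp (a * x)) *\<^sub>R f (exp (a * x)))"
  proof (cases "set_integrable lborel T f")
    case True
    hence "set_integrable lborel S G" using int by (simp add: G_def)
    with True show ?thesis
      using iff[of "integral T f"] ai[of f T] set_borel_integral_eq_integral(2)[of T f] set_borel_integral_eq_integral(2)[of S G]
      by (simp add: G_def)
  next
    case False
    with int show ?thesis
      by (simp add: set_integrable_def set_lebesgue_integral_def not_integrable_integral_eq)
  qed
qed

lemma islimpt_real_interval_complex: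
  assumes "a < b" shows "complex_of_real a islimpt (complex_of_real ` {a<..<b})"
  unfolding islimpt_sequential
proof (intro exI[of _ "\<lambda>n. complex_of_real (a + (b - a) / real (n + 2))"] conjI allI)
  fix n
  define e where "e = (b - a) / real (n + 2)"
  have "0 < e" "e < b - a"
    using assms mult_right_mono[of a b "real n"] by (auto simp: e_def field_simps)
  hence "a + e \<in> {a<..<b}" "complex_of_real (a + e) \<noteq> complex_of_real a" by (auto simp only: of_real_eq_iff greaterThanLessThan_iff)
  thus "complex_of_real (a + (b - a) / real (n + 2)) \<in> complex_of_real ` {a<..<b} - {complex_of_real a}"
    unfolding e_def by blast
next
  have "(\<lambda>n. a + (b - a) / real (n + 2)) \<longlonglongrightarrow> a + 0"
    by (intro tendsto_add tendsto_const LIMSEQ_ignore_initial_segment[of "\<lambda>n. (b-a) / real n"] lim_const_over_n)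
  thus "(\<lambda>n. complex_of_real (a + (b - a) / real (n + 2))) \<longlonglongrightarrow> complex_of_real a"
    by (intro tendsto_of_real) simp
qed

text \<open>
  A real half-line has limit points inside the half-plane, so the identity theorem applies to equations that are
  known only for large real arguments.
\<close>
lemma holomorphic_eq_halfplane:
  fixes f g :: "complex \<Rightarrow> complex"
  assumes f: "f holomorphic_on {s. Re s > b}" and g: "g holomorphic_on {s. Re s > b}"
    and eq: "\<And>x. x > M \<Longrightarrow> f (complex_of_real x) = g (complex_of_real x)" and s: "Re s > b"
  shows "f s = g s"
proof -
  \<comment> \<open>To the right of \<open>M'\<close> the equation is known and the half-plane has been entered.\<close>
  define M' where "M' = max M b + 1"
  have "f s - g s = 0"
  proof (rule analytic_continuation[of "\<lambda>s. f s - g s" "{s. Re s > b}" "complex_of_real ` {M'<..<M'+1}" "complex_of_real M'"])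
    show "(\<lambda>s. f s - g s) holomorphic_on {s. Re s > b}" by (intro holomorphic_intros f g)
    show "connected {s. Re s > b}" by (intro convex_connected convex_halfspace_Re_gt)
    show "complex_of_real M' islimpt complex_of_real ` {M'<..<M'+1}" by (rule islimpt_real_interval_complex) simp
  qed (use s eq in \<open>auto simp: M'_def open_halfspace_Re_gt\<close>)
  thus ?thesis by simp
qed

text \<open>
  In the variable \<open>t = exp v\<close> the integral is the Laplace transform of \<open>t^(p-1)\<close> at
  \<open>c\<close>, hence holomorphic in \<open>c\<close>. For real \<open>c\<close> a translation of
  \<open>v\<close> by \<open>ln c\<close> reduces it to Euler's integral, and the identity theorem gives complex
  \<open>c\<close>. The bound \<open>p > 1\<close> keeps \<open>t^(p-1)\<close> bounded near 0.
\<close>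
lemma Gamma_integral_exp:
  fixes p :: real and c :: complex
  assumes p: "p > 1" and c: "Re c > 0"
  shows "integrable lborel (\<lambda>v. of_real (exp (p * v)) * exp (- c * of_real (exp v)))"
    and "(LINT v|lborel. of_real (exp (p * v)) * exp (- c * of_real (exp v))) = Gamma (of_real p) * c powr (- of_real p)"
proof -
  define f where "f = (\<lambda>t. if t > 0 then complex_of_real (t powr (p - 1)) else 0)"
  have [measurable]: "f \<in> borel_measurable borel" unfolding f_def by measurable
  define L where "L = (\<lambda>s. LINT x:{0..}|lborel. exp (- s * of_real x) * f x)"
  define J where "J = (\<lambda>c v. complex_of_real (exp (p * v)) * exp (- c * complex_of_real (exp v)))"
  have [measurable]: "J c \<in> borel_measurable borel" for c unfolding J_def by measurable
  have bound: "\<exists>K. \<forall>t\<ge>0. norm (f t) \<le> K * exp (b * t)" if "b > 0" for b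
  proof -
    \<comment> \<open>With this scale, \<open>t / k \<le> exp (t / k)\<close> becomes the claim after raising it to the power \<open>p - 1\<close>.\<close>
    define k where "k = (p - 1) / b"
    have k: "k > 0" using p that by (simp add: k_def)
    have "norm (f t) \<le> k powr (p - 1) * exp (b * t)" if t: "t \<ge> 0" for t
    proof (cases "t = 0")
      case False
      hence t: "t > 0" using t by simp
      have "t / k \<le> exp (t / k)" using exp_ge_add_one_self[of "t/k"] by linarith
      hence "(t / k) powr (p - 1) \<le> exp (t / k) powr (p - 1)" using t k p by (intro powr_mono2) auto
      also have "\<dots> = exp (b * t)" using p \<open>b > 0\<close> by (simp add: powr_def k_def field_simps)
      finally show ?thesis using t k by (simp add: f_def powr_divide field_simps)
    qed (auto simp: f_def)
    thus ?thesis by blast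
  qed
  have hol: "L holomorphic_on {s. Re s > 0}"
  proof -
    have "L holomorphic_on {s. Re s > b}" if "b > 0" for b
      using laplace_holomorphic[of f _ b] bound[OF that] unfolding L_def by auto
    hence "L holomorphic_on (\<Union>b\<in>{0<..}. {s. Re s > b})"
      by (intro holomorphic_on_UN_open) (auto simp: open_halfspace_Re_gt)
    also have "(\<Union>b\<in>{0<..}. {s. Re s > b}) = {s. Re s > 0}" using dense by force
    finally show ?thesis .
  qed
  have I: "set_integrable lborel {0..} (\<lambda>x. exp (- s * of_real x) * f x)" if "Re s > 0" for s
  proof -
    from that have "Re s / 2 > 0" by simp
    from bound[OF this] obtain K where K: "\<And>t. t \<ge> 0 \<Longrightarrow> norm (f t) \<le> K * exp (Re s / 2 * t)" by blast
    show ?thesis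
    proof (rule set_integrable_exp_bound[of _ "Re s / 2" K])
      fix x :: real assume "x \<ge> 0"
      have "norm (exp (- s * of_real x) * f x) = exp (- Re s * x) * norm (f x)" by (simp add: norm_mult)
      also have "\<dots> \<le> exp (- Re s * x) * (K * exp (Re s / 2 * x))" using K[OF \<open>x \<ge> 0\<close>] by (intro mult_left_mono) auto
      also have "\<dots> = K * exp (- (Re s / 2) * x)" by (simp add: algebra_simps exp_add[symmetric])
      finally show "norm (exp (- s * of_real x) * f x) \<le> K * exp (- (Re s / 2) * x)" .
    qed (use that in auto)
  qed
  have img: "{0<..} = (\<lambda>x. exp (1 * x)) ` (UNIV :: real set)"
    by (auto simp: image_iff) (metis exp_ln)
  have pos: "set_integrable lborel {0<..} (\<lambda>x. exp (- s * of_real x) * f x) \<longleftrightarrow> set_integrable lborel {0..} (\<lambda>x. exp (- s * of_real x) * f x)"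
    "(LINT x:{0<..}|lborel. exp (- s * of_real x) * f x) = L s" for s
    unfolding L_def set_lebesgue_integral_def set_integrable_def
    by (auto simp: f_def indicator_def intro!: Bochner_Integration.integral_cong Bochner_Integration.integrable_cong)
  have Jeq: "(1 * exp (1 * x)) *\<^sub>R (exp (- s * of_real (exp (1 * x))) * f (exp (1 * x))) = J s x" for s x
    by (simp add: f_def J_def powr_def scaleR_conv_of_real exp_diff algebra_simps flip: exp_of_real)
  have IJ: "integrable lborel (J s)" if "Re s > 0" for s
    using I[OF that] set_integral_exp_substitution(1)[OF _ _ _ _ img, of "\<lambda>x. exp (- s * of_real x) * f x"]
    unfolding Jeq pos by (simp add: set_integrable_def)
  have LJ: "L s = integral\<^sup>L lborel (J s)" for s
    using set_integral_exp_substitution(2)[OF _ _ _ _ img, of "\<lambda>x. exp (- s * of_real x) * f x"]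
    unfolding Jeq pos by (simp add: set_lebesgue_integral_def)
  have L1: "L 1 = Gamma (of_real p)"
  proof -
    have "L 1 = integral {0..} (\<lambda>x. exp (- 1 * of_real x) * f x)"
      using I[of 1] unfolding L_def by (simp add: set_borel_integral_eq_integral)
    also have "\<dots> = Gamma (of_real p)"
    proof (rule integral_unique, rule has_integral_eq[OF _ Gamma_integral_complex])
      fix x :: real assume "x \<in> {0..}"
      thus "of_real x powr (of_real p - 1) / of_real (exp x) = exp (- 1 * of_real x) * f x"
        by (auto simp: f_def exp_minus field_simps powr_of_real[symmetric] simp flip: exp_of_real)
    qed (use p in auto)
    finally show ?thesis .
  qed
  have real: "L (of_real x) = Gamma (of_real p) * of_real x powr (- of_real p)" if x: "x > 0" for x
  proof -
    have "J (of_real x) v = of_real (x powr (-p)) * J 1 (ln x + 1 * v)" for v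
    proof -
      have 1: "exp (ln x + 1 * v) = x * exp v" using x by (simp add: exp_add)
      have 2: "exp (p * (ln x + 1 * v)) = x powr p * exp (p * v)" using x by (simp add: powr_def exp_add distrib_left)
      have 3: "complex_of_real (x powr (-p)) * complex_of_real (x powr p) = 1"
        using x by (simp flip: of_real_mult add: powr_minus)
      show ?thesis unfolding J_def 1 2 using 3 by simp
    qed
    hence "J (of_real x) = (\<lambda>v. of_real (x powr (-p)) * J 1 (ln x + 1 * v))" by (rule ext)
    hence "L (of_real x) = of_real (x powr (-p)) * (LINT v|lborel. J 1 (ln x + 1 * v))"
      unfolding LJ by (simp only: integral_mult_right_zero)
    also have "(LINT v|lborel. J 1 (ln x + 1 * v)) = L 1"
      unfolding LJ using lborel_integral_real_affine[of 1 "J 1" "ln x"] by simp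
    finally show ?thesis using x L1 by (simp add: powr_of_real[symmetric] mult.commute)
  qed
  have "L c = Gamma (of_real p) * c powr (- of_real p)"
    by (rule holomorphic_eq_halfplane[of L 0 "\<lambda>c. Gamma (of_real p) * c powr (- of_real p)" 0])
       (use c real hol in \<open>auto intro!: holomorphic_intros simp: complex_nonpos_Reals_iff\<close>)
  thus "(LINT v|lborel. of_real (exp (p * v)) * exp (- c * of_real (exp v))) = Gamma (of_real p) * c powr (- of_real p)"
    by (simp add: LJ J_def)
  show "integrable lborel (\<lambda>v. of_real (exp (p * v)) * exp (- c * of_real (exp v)))"
    using IJ[OF c] by (simp add: J_def)
qed

text \<open>
  This is the case \<open>p = 2\<close> of the Gamma integral, read in the variable \<open>x = exp v\<close>.
\<close>
lemma integral_x_exp_decay: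
  fixes a :: real assumes a: "a > 0"
  shows "set_integrable lborel {0..} (\<lambda>x. complex_of_real x * of_real (exp (- a * x)))"
    and "(LINT x:{0..}|lborel. complex_of_real x * of_real (exp (- a * x))) = 1 / of_real a ^ 2"
proof -
  define f where "f = (\<lambda>x. complex_of_real x * of_real (exp (- a * x)))"
  have [measurable]: "f \<in> borel_measurable borel" unfolding f_def by measurable
  show I: "set_integrable lborel {0..} (\<lambda>x. complex_of_real x * of_real (exp (- a * x)))"
  proof (rule set_integrable_exp_bound[of _ "a / 2" "2 / a"])
    fix x :: real assume x: "x \<ge> 0"
    have "a / 2 * x \<le> exp (a / 2 * x)" using exp_ge_add_one_self[of "a/2*x"] by linarith
    hence "x * exp (- a * x) \<le> (2 / a * exp (a / 2 * x)) * exp (- a * x)"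
      using a by (intro mult_right_mono) (auto simp: field_simps)
    also have "\<dots> = 2 / a * exp (- (a / 2) * x)" by (simp add: exp_add[symmetric] mult.assoc)
    finally show "norm (complex_of_real x * of_real (exp (- a * x))) \<le> 2 / a * exp (- (a / 2) * x)"
      using x by (simp add: norm_mult)
  qed (use a in auto)
  have img: "{0<..} = (\<lambda>x. exp (1 * x)) ` (UNIV :: real set)"
    by (auto simp: image_iff) (metis exp_ln)
  have "(LINT x:{0..}|lborel. f x) = (LINT x:{0<..}|lborel. f x)"
    unfolding set_lebesgue_integral_def
    by (intro Bochner_Integration.integral_cong refl) (auto simp: indicator_def f_def)
  also have "\<dots> = (LINT x|lborel. (1 * exp (1 * x)) *\<^sub>R f (exp (1 * x)))"
    using set_integral_exp_substitution(2)[OF _ _ _ _ img, of f] by (simp add: set_lebesgue_integral_def)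
  also have "(\<lambda>x. (1 * exp (1 * x)) *\<^sub>R f (exp (1 * x))) = (\<lambda>v. of_real (exp (2 * v)) * exp (- of_real a * of_real (exp v)))"
  proof
    fix v :: real
    have "exp (2 * v) = exp v * exp v" by (simp add: exp_add[symmetric])
    thus "(1 * exp (1 * v)) *\<^sub>R f (exp (1 * v)) = of_real (exp (2 * v)) * exp (- of_real a * of_real (exp v))"
      unfolding f_def by (simp only: scaleR_conv_of_real of_real_mult[symmetric] of_real_minus[symmetric] exp_of_real) simp
  qed
  also have "(LINT v|lborel. of_real (exp (2 * v)) * exp (- complex_of_real a * of_real (exp v))) = Gamma (of_real 2) * of_real a powr (- of_real 2)"
    by (rule Gamma_integral_exp(2)) (use a in auto)
  also have "\<dots> = 1 / of_real a ^ 2"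
  proof -
    have "Gamma (of_real 2) = (1 :: complex)" using Gamma_fact[of 1, where 'a = complex] by (simp add: numeral_2_eq_2)
    moreover have "complex_of_real a powr (- of_real 2) = 1 / of_real a ^ 2"
      using a by (simp add: powr_minus divide_inverse)
    ultimately show ?thesis by simp
  qed
  finally show "(LINT x:{0..}|lborel. complex_of_real x * of_real (exp (- a * x))) = 1 / of_real a ^ 2"
    by (simp add: f_def)
qed


section \<open>The Bessel function of order zero\<close>

text \<open>
  Apply \<open>y \<le> exp y\<close> to \<open>y = x / k\<close> and raise it to the power
  \<open>k\<close>. Choosing \<open>k\<close> freely makes this one inequality serve both for decay at infinity
  (large \<open>k\<close>) and for mild growth at the origin (small \<open>k\<close>).
\<close>
lemma exp_minus_le_powr:
  fixes x k :: real assumes "x > 0" "k > 0"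
  shows "exp (- x) \<le> k powr k * x powr (- k)"
proof -
  have "x / k \<le> exp (x / k)" using exp_ge_add_one_self[of "x/k"] by linarith
  hence "(x / k) powr k \<le> exp (x / k) powr k" using assms by (intro powr_mono2) auto
  also have "\<dots> = exp x" using assms by (simp add: powr_def)
  finally show ?thesis using assms by (simp add: powr_divide powr_minus exp_minus field_simps)
qed

text \<open>
  The two-sided form of the integral for \<open>2 K\<^sub>0(2z)\<close>. Integrating over the whole line makes
  the shift of \<open>u\<close> that decouples the two summation variables available.
\<close>
definition cosh_integral :: "complex \<Rightarrow> complex" where
  "cosh_integral z = (LINT u|lborel. exp (- z * of_real (exp u + exp (- u))))"

lemma cosh_kernel_bound:
  fixes \<rho> k u :: real
  assumes "\<rho> > 0" "k > 0"
  shows "exp (- \<rho> * (exp u + exp (- u))) \<le> (k powr k * \<rho> powr (- k)) * exp (- k * \<bar>u\<bar>)"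
proof -
  have "exp (- \<rho> * (exp u + exp (- u))) \<le> exp (- (\<rho> * exp \<bar>u\<bar>))"
  proof -
    have "exp \<bar>u\<bar> \<le> exp u + exp (- u)" using exp_ge_zero[of u] exp_ge_zero[of "- u"] by (cases "u \<ge> 0") simp_all
    hence "\<rho> * exp \<bar>u\<bar> \<le> \<rho> * (exp u + exp (- u))" using assms by (intro mult_left_mono) auto
    thus ?thesis by simp
  qed
  also have "\<dots> \<le> k powr k * (\<rho> * exp \<bar>u\<bar>) powr (- k)"
    by (rule exp_minus_le_powr) (use assms in auto)
  also have "\<dots> = (k powr k * \<rho> powr (- k)) * exp (- k * \<bar>u\<bar>)"
    using assms by (simp add: powr_mult) (simp add: powr_def)
  finally show ?thesis .
qed

lemma integrable_cosh_kernel: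
  assumes "Re z > 0"
  shows "integrable lborel (\<lambda>u. exp (- z * complex_of_real (exp u + exp (- u))))"
proof (rule integrable_exp_abs_bound[of _ 1])
  show "norm (exp (- z * complex_of_real (exp u + exp (- u)))) \<le> (1 powr 1 * Re z powr (- 1)) * exp (- 1 * \<bar>u\<bar>)" for u
    using cosh_kernel_bound[of "Re z" 1 u] assms by simp
qed auto

lemma cosh_kernel_integral_bound:
  fixes k :: real assumes "k > 0"
  obtains C where "C \<ge> 0" "\<And>\<rho>. \<rho> > 0 \<Longrightarrow> (LINT u|lborel. exp (- \<rho> * (exp u + exp (- u)))) \<le> C * \<rho> powr (- k)"
proof
  define C where "C = k powr k * (LINT u|lborel. exp (- k * \<bar>u :: real\<bar>))"
  have I: "integrable lborel (\<lambda>u. exp (- k * \<bar>u\<bar>))"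
    using integrable_norm[OF integrable_exp_abs_bound[of "\<lambda>u. complex_of_real (exp (- k * \<bar>u\<bar>))" k 1]] assms by simp
  show "C \<ge> 0" by (simp add: C_def)
  fix \<rho> :: real assume \<rho>: "\<rho> > 0"
  have "(LINT u|lborel. exp (- \<rho> * (exp u + exp (- u)))) \<le> (LINT u|lborel. (k powr k * \<rho> powr (- k)) * exp (- k * \<bar>u\<bar>))"
  proof (rule integral_mono)
    show "integrable lborel (\<lambda>u. exp (- \<rho> * (exp u + exp (- u))))"
      using integrable_norm[OF integrable_cosh_kernel[of "of_real \<rho>"]] \<rho> by simp
  qed (use I cosh_kernel_bound[OF \<rho> assms] in auto)
  thus "(LINT u|lborel. exp (- \<rho> * (exp u + exp (- u)))) \<le> C * \<rho> powr (- k)"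
    by (simp add: C_def mult_ac)
qed

lemma cosh_integral_Bessel:
  assumes "Re z > 0"
  shows "cosh_integral z = 2 * Bessel_K 0 (2 * z)"
proof -
  have "cosh_integral z = 2 * (LINT u:{0..}|lborel. exp (- z * complex_of_real (exp u + exp (- u))))"
    unfolding cosh_integral_def by (rule integral_even[OF integrable_cosh_kernel[OF assms]]) (simp add: add.commute)
  also have "(LINT u:{0..}|lborel. exp (- z * complex_of_real (exp u + exp (- u)))) = Bessel_K 0 (2 * z)"
    unfolding Bessel_K_def by (simp add: cosh_def scaleR_conv_of_real algebra_simps flip: exp_of_real)
  finally show ?thesis .
qed

lemma Bessel_K_0_bound:
  assumes "k > 0"
  obtains C where "C \<ge> 0" "\<And>z. Re z > 0 \<Longrightarrow> norm (Bessel_K 0 (2 * z)) \<le> C * Re z powr (- k)"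
proof -
  obtain C where C: "C \<ge> 0" "\<And>\<rho>. \<rho> > 0 \<Longrightarrow> (LINT u|lborel. exp (- \<rho> * (exp u + exp (- u)))) \<le> C * \<rho> powr (- k)"
    using cosh_kernel_integral_bound[OF assms] by blast
  show ?thesis
  proof (rule that[of "C / 2"])
    fix z :: complex assume z: "Re z > 0"
    have "norm (cosh_integral z) \<le> (LINT u|lborel. norm (exp (- z * complex_of_real (exp u + exp (- u)))))"
      unfolding cosh_integral_def by (rule integral_norm_bound)
    also have "\<dots> = (LINT u|lborel. exp (- Re z * (exp u + exp (- u))))" by simp
    also have "\<dots> \<le> C * Re z powr (- k)" by (rule C(2)[OF z])
    finally show "norm (Bessel_K 0 (2 * z)) \<le> C / 2 * Re z powr (- k)"
      using cosh_integral_Bessel[OF z] by (simp add: norm_mult)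
  qed (use C in auto)
qed


section \<open>Theta sums and divisor sums of Bessel functions\<close>

text \<open>
  The sum runs over a shifted index with a condition rather than over \<open>X\<close> itself, so that the
  measurability and interchange results for ordinary series apply.
\<close>
definition theta_over :: "nat set \<Rightarrow> complex \<Rightarrow> real \<Rightarrow> complex" where
  "theta_over X c y = (\<Sum>n. if Suc n \<in> X then exp (- c * of_nat (Suc n) ^ 2 * of_real y) else 0)"

lemma theta_over_measurable [measurable]: "theta_over X c \<in> borel_measurable borel"
  unfolding theta_over_def by measurable

lemma theta_over_bound:
  assumes "Re c > 0" "k > 1/2"
  obtains C where "C \<ge> 0"
    "\<And>X y. y > 0 \<Longrightarrow> norm (theta_over X c y) \<le> C * y powr (- k)"
    "\<And>X y. y > 0 \<Longrightarrow> summable (\<lambda>n. norm (if Suc n \<in> X then exp (- c * of_nat (Suc n) ^ 2 * of_real y) else 0))"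
proof -
  define D where "D = k powr k * Re c powr (- k)"
  define S where "S = (\<Sum>n. real (n + 1) powr (- (2 * k)))"
  have sm: "summable (\<lambda>n. real (n + 1) powr (- (2 * k)))" by (rule summable_real_Suc_powr) (use assms in auto)
  have t: "norm (if Suc n \<in> X then exp (- c * of_nat (Suc n) ^ 2 * of_real y) else 0)
            \<le> D * y powr (- k) * real (n + 1) powr (- (2 * k))" if "y > 0" for X y n
  proof (cases "Suc n \<in> X")
    case True
    have "Re (c * of_nat (Suc n) ^ 2 * of_real y) = Re c * real (Suc n) ^ 2 * y"
    proof -
      have "c * of_nat (Suc n) ^ 2 * of_real y = c * of_real (real (Suc n) ^ 2 * y)" by simp
      thus ?thesis by (simp only: Re_complex_of_real Im_complex_of_real times_complex.sel)
    qed
    hence "norm (if Suc n \<in> X then exp (- c * of_nat (Suc n) ^ 2 * of_real y) else 0) = exp (- (Re c * real (Suc n) ^ 2 * y))"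
      using True by simp
    also have "\<dots> \<le> k powr k * (Re c * real (Suc n) ^ 2 * y) powr (- k)"
      by (rule exp_minus_le_powr) (use assms that in auto)
    also have "\<dots> = D * y powr (- k) * real (n + 1) powr (- (2 * k))"
      using assms that by (simp add: D_def powr_mult powr_powr flip: powr_numeral)
    finally show ?thesis .
  qed (auto simp: D_def)
  have s: "summable (\<lambda>n. norm (if Suc n \<in> X then exp (- c * of_nat (Suc n) ^ 2 * of_real y) else 0))" if "y > 0" for X y
    by (rule summable_comparison_test'[OF summable_mult[OF sm, of "D * y powr (-k)"], of 0]) (use t[OF that] in auto)
  show ?thesis
  proof (rule that[of "D * S"])
    show "D * S \<ge> 0" unfolding D_def S_def by (intro mult_nonneg_nonneg suminf_nonneg sm) auto
    fix X :: "nat set" and y :: real assume y: "y > 0"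
    show "norm (theta_over X c y) \<le> D * S * y powr (- k)"
    proof -
      have "norm (theta_over X c y) \<le> (\<Sum>n. D * y powr (- k) * real (n + 1) powr (- (2 * k)))"
        unfolding theta_over_def by (rule norm_suminf_le[OF t[OF y] summable_mult[OF sm]])
      also have "\<dots> = D * S * y powr (- k)" unfolding S_def by (subst suminf_mult[OF sm]) (simp add: mult_ac)
      finally show ?thesis .
    qed
  qed (use s in auto)
qed

lemma theta_over_summable:
  assumes "Re c > 0" "y > 0"
  shows "summable (\<lambda>n. norm (if Suc n \<in> X then exp (- c * of_nat (Suc n) ^ 2 * of_real y) else 0))"
  by (rule theta_over_bound[OF assms(1), of 1]) (use assms(2) in auto)

text \<open>
  Termwise, each term of the theta sum contributes a Gamma integral with parameter \<open>c a\<^sup>2\<close>;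
  the power \<open>(c a\<^sup>2)^(-p)\<close> splits because \<open>a\<^sup>2\<close> is positive.
\<close>
lemma theta_over_mellin:
  assumes c: "Re c > 0" and p: "p > 1"
  shows "integrable lborel (\<lambda>v. of_real (exp (p * v)) * theta_over X c (exp v))"
    and "(LINT v|lborel. of_real (exp (p * v)) * theta_over X c (exp v)) =
           Gamma (of_real p) * c powr (- of_real p) * (\<Sum>n. if Suc n \<in> X then of_nat (Suc n) powr (- (2 * of_real p)) else 0)"
proof -
  define f where "f = (\<lambda>n v. if Suc n \<in> X then of_real (exp (p * v)) * exp (- (c * of_nat (Suc n) ^ 2) * of_real (exp v)) else (0::complex))"
  have Rec: "Re (c * of_nat (Suc n) ^ 2) = Re c * real (Suc n) ^ 2" for n
  proof -
    have "c * of_nat (Suc n) ^ 2 = c * of_real (real (Suc n) ^ 2)" by simp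
    thus ?thesis by (simp only: Re_complex_of_real Im_complex_of_real times_complex.sel)
  qed
  have Rec': "Re (c * of_nat (Suc n) ^ 2) > 0" for n unfolding Rec using c by simp
  have I: "integrable lborel (f n)" for n
    unfolding f_def using Gamma_integral_exp(1)[OF p Rec'[of n]] by (cases "Suc n \<in> X") (simp_all del: of_nat_Suc)
  have pw: "(c * of_nat (Suc n) ^ 2) powr (- of_real p) = c powr (- of_real p) * of_nat (Suc n) powr (- (2 * of_real p))" for n
  proof -
    define r where "r = real (Suc n)"
    have r: "r > 0" and rc: "of_nat (Suc n) = complex_of_real r" by (simp_all add: r_def)
    have "Ln (c * of_real r ^ 2) = Ln (of_real (r ^ 2) * c)" by (simp add: mult.commute)
    also have "\<dots> = of_real (2 * ln r) + Ln c"
    proof -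
      have "Ln (of_real (r ^ 2)) = complex_of_real (2 * ln r)" using Ln_of_real[of "r ^ 2"] r by (simp add: ln_realpow)
      moreover have "c \<noteq> 0" using c by auto
      ultimately show ?thesis using Ln_times_of_real[of "r ^ 2" c] r by simp
    qed
    finally have "Ln (c * of_real r ^ 2) = of_real (2 * ln r) + Ln c" .
    moreover have "Ln (of_real r) = of_real (ln r)" using r by (rule Ln_of_real)
    moreover have "c \<noteq> 0" using c by auto
    ultimately show ?thesis unfolding rc using r
      by (simp add: powr_def exp_add[symmetric] algebra_simps)
  qed
  have L: "integral\<^sup>L lborel (f n) = Gamma (of_real p) * c powr (- of_real p) * (if Suc n \<in> X then of_nat (Suc n) powr (- (2 * of_real p)) else 0)" for n
    unfolding f_def using Gamma_integral_exp(2)[OF p Rec'[of n]] pw[of n] by (auto simp: mult_ac)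
  have nL: "(LINT v|lborel. norm (f n v)) \<le> norm (Gamma (of_real p :: complex)) * Re c powr (-p) * real (n + 1) powr (- (2 * p))" for n
  proof (cases "Suc n \<in> X")
    case True
    define d where "d = Re c * real (Suc n) ^ 2"
    have d: "d > 0" using c by (simp add: d_def)
    have "complex_of_real (LINT v|lborel. norm (f n v)) = (LINT v|lborel. of_real (exp (p * v)) * exp (- of_real d * of_real (exp v)))"
    proof (subst integral_complex_of_real[symmetric], intro Bochner_Integration.integral_cong refl)
      fix v :: real
      have "c * of_nat (Suc n) ^ 2 * of_real (exp v) = c * of_real (real (Suc n) ^ 2 * exp v)" by simp
      hence "Re (c * of_nat (Suc n) ^ 2 * of_real (exp v)) = d * exp v"
        by (simp only: Re_complex_of_real Im_complex_of_real times_complex.sel) (simp add: d_def)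
      thus "complex_of_real (norm (f n v)) = of_real (exp (p * v)) * exp (- of_real d * of_real (exp v))"
        using True unfolding f_def by (simp add: norm_mult del: of_nat_Suc flip: exp_of_real)
    qed
    also have "\<dots> = Gamma (of_real p) * of_real d powr (- of_real p)"
      by (rule Gamma_integral_exp(2)) (use p d in auto)
    finally have "norm (complex_of_real (LINT v|lborel. norm (f n v))) = norm (Gamma (of_real p :: complex)) * d powr (- p)"
      using d by (simp add: norm_mult norm_powr_real_powr)
    hence "(LINT v|lborel. norm (f n v)) = norm (Gamma (of_real p :: complex)) * d powr (- p)" by simp
    also have "d powr (- p) = Re c powr (-p) * real (n + 1) powr (- (2 * p))"
      using c by (simp add: d_def powr_mult powr_powr flip: powr_numeral)
    finally show ?thesis by simp
  qed (auto simp: f_def)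
  have sm: "summable (\<lambda>n. real (n + 1) powr (- (2 * p)))" by (rule summable_real_Suc_powr) (use p in auto)
  have s1: "AE v in lborel. summable (\<lambda>n. norm (f n v))"
  proof (intro AE_I2)
    fix v :: real
    from summable_mult[OF theta_over_summable[OF c, of "exp v" X, OF exp_gt_zero], of "exp (p * v)"]
    show "summable (\<lambda>n. norm (f n v))"
      by (rule back_subst[of summable]) (auto simp: f_def norm_mult fun_eq_iff)
  qed
  have s2: "summable (\<lambda>n. LINT v|lborel. norm (f n v))"
    by (rule summable_comparison_test'[OF summable_mult[OF sm, of "norm (Gamma (of_real p :: complex)) * Re c powr (-p)"], of 0])
       (use nL in auto)
  have fs: "(\<Sum>n. f n v) = of_real (exp (p * v)) * theta_over X c (exp v)" for v
  proof -
    from summable_norm_cancel[OF theta_over_summable[OF c, of "exp v" X, OF exp_gt_zero]] show ?thesis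
      unfolding theta_over_def by (subst suminf_mult[symmetric]) (auto simp: f_def intro!: suminf_cong)
  qed
  show "integrable lborel (\<lambda>v. of_real (exp (p * v)) * theta_over X c (exp v))"
    using integrable_suminf[OF I s1 s2] by (simp add: fs)
  have sc: "summable (\<lambda>n. if Suc n \<in> X then of_nat (Suc n) powr (- (2 * of_real p)) else (0::complex))"
    by (rule summable_norm_cancel, rule summable_comparison_test'[OF sm, of 0]) (auto simp: norm_powr_real_powr simp del: of_nat_Suc)
  show "(LINT v|lborel. of_real (exp (p * v)) * theta_over X c (exp v)) =
           Gamma (of_real p) * c powr (- of_real p) * (\<Sum>n. if Suc n \<in> X then of_nat (Suc n) powr (- (2 * of_real p)) else 0)"
    using integral_suminf[OF I s1 s2] unfolding L fs suminf_mult[OF sc] .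
qed

text \<open>
  The factorisations \<open>n = a b\<close> with both factors in \<open>X\<close>, each represented by its
  first factor.
\<close>
definition divisor_pairs :: "nat set \<Rightarrow> nat \<Rightarrow> nat set" where
  "divisor_pairs X n = {a \<in> X. a dvd n \<and> n div a \<in> X}"

lemma finite_divisor_pairs: "0 \<notin> X \<Longrightarrow> finite (divisor_pairs X n)"
  by (cases "n = 0") (auto simp: divisor_pairs_def)

lemma card_divisor_pairs_le: "0 \<notin> X \<Longrightarrow> card (divisor_pairs X n) \<le> n"
proof -
  assume X: "0 \<notin> X"
  show ?thesis
  proof (cases "n = 0")
    case False
    have "card (divisor_pairs X n) \<le> card {1..n}"
      by (rule card_mono) (use X False in \<open>auto simp: divisor_pairs_def dvd_imp_le intro: Suc_leI[OF gr0I]\<close>)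
    thus ?thesis by simp
  qed (use X in \<open>simp add: divisor_pairs_def\<close>)
qed

text \<open>
  The double sum over \<open>X \<times> X\<close> is regrouped according to the product of the two indices;
  \<open>0 \<notin> X\<close> makes \<open>(a, b) \<mapsto> (a b, a)\<close> invertible.
\<close>
lemma dirichlet_product_has_sum:
  fixes f g :: "nat \<Rightarrow> 'a :: {real_normed_field, banach}"
  assumes f: "(\<lambda>x. norm (f x)) summable_on X" and g: "(\<lambda>x. norm (g x)) summable_on X" and X: "0 \<notin> X"
  shows "((\<lambda>n. \<Sum>a\<in>divisor_pairs X n. f a * g (n div a)) has_sum (infsum f X * infsum g X)) UNIV"
proof -
  have "infsum (\<lambda>b. norm (f a * g b)) X = norm (f a) * infsum (\<lambda>b. norm (g b)) X" for a
    by (simp only: norm_mult infsum_cmult_right')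
  hence "(\<lambda>a. norm (infsum (\<lambda>b. norm (f a * g b)) X)) = (\<lambda>a. norm (f a) * \<bar>infsum (\<lambda>b. norm (g b)) X\<bar>)"
    by (simp only: real_norm_def abs_mult abs_norm_cancel)
  hence "(\<lambda>a. norm (infsum (\<lambda>b. norm (f a * g b)) X)) summable_on X"
    using summable_on_cmult_left[OF f] by simp
  moreover have "(\<lambda>b. norm (f a * g b)) summable_on X" for a
    unfolding norm_mult by (rule summable_on_cmult_right[OF g])
  ultimately have "(\<lambda>p. norm (case p of (a, b) \<Rightarrow> f a * g b)) summable_on X \<times> X"
    unfolding Infinite_Sum.abs_summable_on_Sigma_iff by simp
  hence S: "(\<lambda>(a, b). f a * g b) summable_on X \<times> X"
    by (rule Infinite_Sum.abs_summable_summable)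
  have 1: "((\<lambda>(a, b). f a * g b) has_sum (infsum f X * infsum g X)) (X \<times> X)"
  proof (rule has_sum_SigmaI[OF _ _ S])
    show "((\<lambda>b. case (a, b) of (a, b) \<Rightarrow> f a * g b) has_sum f a * infsum g X) X" for a
      using Infinite_Sum.abs_summable_summable[OF g] by (auto intro!: has_sum_cmult_right)
    show "((\<lambda>a. f a * infsum g X) has_sum infsum f X * infsum g X) X"
      using Infinite_Sum.abs_summable_summable[OF f] by (auto intro!: has_sum_cmult_left)
  qed
  have bij: "bij_betw (\<lambda>(n, a). (a, n div a)) (Sigma UNIV (divisor_pairs X)) (X \<times> X)"
  proof (rule bij_betwI[where g = "\<lambda>(a, b). (a * b, a)"])
    show "(\<lambda>(n, a). (a, n div a)) \<in> Sigma UNIV (divisor_pairs X) \<rightarrow> X \<times> X"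
      by (auto simp: divisor_pairs_def)
    show "(\<lambda>(a, b). (a * b, a)) \<in> X \<times> X \<rightarrow> Sigma UNIV (divisor_pairs X)"
    proof (intro funcsetI)
      fix x assume "x \<in> X \<times> X"
      then obtain a b where x: "x = (a, b)" "a \<in> X" "b \<in> X" by blast
      moreover from x X have "a \<noteq> 0" by metis
      ultimately show "(\<lambda>(a, b). (a * b, a)) x \<in> Sigma UNIV (divisor_pairs X)" by (simp add: divisor_pairs_def)
    qed
    show "(\<lambda>(a, b). (a * b, a)) ((\<lambda>(n, a). (a, n div a)) x) = x" if "x \<in> Sigma UNIV (divisor_pairs X)" for x
      using that by (auto simp: divisor_pairs_def)
    show "(\<lambda>(n, a). (a, n div a)) ((\<lambda>(a, b). (a * b, a)) y) = y" if y: "y \<in> X \<times> X" for y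
    proof -
      from y obtain a b where ab: "y = (a, b)" "a \<in> X" "b \<in> X" by blast
      moreover from ab X have "a \<noteq> 0" by metis
      ultimately show ?thesis by simp
    qed
  qed
  have 2: "((\<lambda>(n, a). f a * g (n div a)) has_sum (infsum f X * infsum g X)) (Sigma UNIV (divisor_pairs X))"
    using has_sum_reindex_bij_betw[OF bij, of "\<lambda>(a, b). f a * g b"] 1 by (simp add: case_prod_unfold)
  show ?thesis
    by (rule has_sum_SigmaD[OF 2]) (use finite_divisor_pairs[OF X] in \<open>auto intro!: has_sum_finite\<close>)
qed

lemma infsum_positive_nat:
  fixes f :: "nat \<Rightarrow> 'a :: banach"
  assumes X: "0 \<notin> X" and S: "summable (\<lambda>n. norm (if Suc n \<in> X then f (Suc n) else 0))"
  shows "(\<lambda>a. norm (f a)) summable_on X"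
    and "infsum f X = (\<Sum>n. if Suc n \<in> X then f (Suc n) else 0)"
proof -
  define g where "g = (\<lambda>a. if a \<in> X then f a else 0)"
  have S: "summable (\<lambda>n. norm (g (Suc n)))" using S by (simp add: g_def)
  have R: "X \<subseteq> range Suc"
  proof
    fix a assume "a \<in> X"
    with X have "a \<noteq> 0" by metis
    thus "a \<in> range Suc" using not0_implies_Suc by blast
  qed
  have "(\<lambda>n. norm (g (Suc n))) summable_on UNIV"
    using S by (intro norm_summable_imp_summable_on) auto
  hence "(\<lambda>a. norm (g a)) summable_on range Suc"
    by (subst summable_on_reindex) (auto simp: o_def)
  hence "(\<lambda>a. norm (g a)) summable_on X" by (rule summable_on_subset_banach[OF _ R])
  also have "?this \<longleftrightarrow> (\<lambda>a. norm (f a)) summable_on X"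
    by (intro summable_on_cong) (simp add: g_def)
  finally show "(\<lambda>a. norm (f a)) summable_on X" .
  have "((\<lambda>n. g (Suc n)) has_sum (\<Sum>n. g (Suc n))) UNIV"
    using S by (intro norm_summable_imp_has_sum summable_sums summable_norm_cancel[OF S])
  hence "(g has_sum (\<Sum>n. g (Suc n))) (range Suc)"
    by (subst has_sum_reindex) (auto simp: o_def)
  also have "?this \<longleftrightarrow> (f has_sum (\<Sum>n. g (Suc n))) X"
    using R by (intro has_sum_cong_neutral) (auto simp: g_def)
  finally show "infsum f X = (\<Sum>n. if Suc n \<in> X then f (Suc n) else 0)" unfolding g_def by (rule infsumI)
qed

lemma theta_over_infsum:
  assumes c: "Re c > 0" and y: "y > 0" and X: "0 \<notin> X"
  shows "(\<lambda>a. norm (exp (- c * of_nat a ^ 2 * of_real y))) summable_on X"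
    and "infsum (\<lambda>a. exp (- c * of_nat a ^ 2 * of_real y)) X = theta_over X c y"
  using infsum_positive_nat[OF X, of "\<lambda>a. exp (- c * of_nat a ^ 2 * of_real y)"] theta_over_summable[OF c y]
  by (simp_all add: theta_over_def)

text \<open>
  The translation by \<open>ln (b/a)\<close> balances the two exponentials, after which only the product
  \<open>a b\<close> is left.
\<close>
lemma two_exp_kernel:
  assumes z: "Re z > 0" and ab: "a > 0" "b > 0"
  shows "integrable lborel (\<lambda>u. exp (- z * complex_of_real (a ^ 2 * exp u + b ^ 2 * exp (- u))))"
    and "(LINT u|lborel. exp (- z * complex_of_real (a ^ 2 * exp u + b ^ 2 * exp (- u)))) = cosh_integral (z * of_real (a * b))"
proof -
  define F where "F = (\<lambda>u. exp (- z * complex_of_real (a ^ 2 * exp u + b ^ 2 * exp (- u))))"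
  define t where "t = ln (b / a)"
  have shift: "F (t + 1 * u) = exp (- (z * of_real (a * b)) * complex_of_real (exp u + exp (- u)))" for u
  proof -
    have "a ^ 2 * exp (t + 1 * u) + b ^ 2 * exp (- (t + 1 * u)) = a * b * (exp u + exp (- u))"
      using ab by (simp add: t_def exp_add exp_diff exp_minus power2_eq_square field_simps)
    thus ?thesis unfolding F_def by (simp only: of_real_mult mult_minus_left mult.assoc)
  qed
  have "Re (z * of_real (a * b)) > 0" using z ab by simp
  from integrable_cosh_kernel[OF this] have "integrable lborel (\<lambda>u. F (t + 1 * u))" by (simp only: shift)
  thus "integrable lborel (\<lambda>u. exp (- z * complex_of_real (a ^ 2 * exp u + b ^ 2 * exp (- u))))"
    unfolding F_def[symmetric] by (subst (asm) lborel_integrable_real_affine_iff) auto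
  have "integral\<^sup>L lborel F = (LINT u|lborel. F (t + 1 * u))" using lborel_integral_real_affine[of 1 F t] by simp
  thus "(LINT u|lborel. exp (- z * complex_of_real (a ^ 2 * exp u + b ^ 2 * exp (- u)))) = cosh_integral (z * of_real (a * b))"
    unfolding F_def[symmetric] shift cosh_integral_def .
qed

lemma norm_exp_Re_of_real:
  "complex_of_real (norm (exp (- z * complex_of_real r))) = exp (- complex_of_real (Re z) * complex_of_real r)"
proof -
  have "norm (exp (- z * complex_of_real r)) = exp (- Re z * r)" by simp
  thus ?thesis by (simp only: exp_of_real[symmetric] of_real_mult of_real_minus)
qed

text \<open>
  Multiplying out the two theta sums and grouping by \<open>n = a b\<close>, every factorisation of
  \<open>n\<close> has the same integral, namely that of the Bessel kernel for \<open>n\<close>. The interchange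
  of sum and integral is justified by the bound \<open>n^(-3)\<close> for one kernel against at most
  \<open>n\<close> factorisations.
\<close>
lemma theta_autocorrelation_eq_Bessel_sum:
  assumes c: "Re c > 0" and h: "h > 0" and X: "0 \<notin> X"
  defines "d \<equiv> (\<lambda>n. of_nat (card (divisor_pairs X n)) :: complex)"
  shows "summable (\<lambda>n. norm (d n * Bessel_K 0 (2 * (c * of_real h * of_nat n))))"
    and "(\<lambda>n. d n * (2 * Bessel_K 0 (2 * (c * of_real h * of_nat n)))) sums
           (LINT u|lborel. theta_over X c (h * exp u) * theta_over X c (h * exp (- u)))"
proof -
  define z where "z = c * of_real h"
  have z: "Re z > 0" using c h by (simp add: z_def)
  define E where "E = (\<lambda>w n a u. exp (- w * complex_of_real (real a ^ 2 * exp u + real (n div a) ^ 2 * exp (- u))))"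
  define T where "T = (\<lambda>n u. \<Sum>a\<in>divisor_pairs X n. E z n a u)"
  have pos: "a > 0" "n div a > 0" "a * (n div a) = n" if "a \<in> divisor_pairs X n" for a n
    using that X unfolding divisor_pairs_def by (auto intro!: gr0I)
  have EI: "integrable lborel (E w n a)" "integral\<^sup>L lborel (E w n a) = cosh_integral (w * of_nat n)"
    if "a \<in> divisor_pairs X n" "Re w > 0" for w a n
  proof -
    have eq: "real a * real (n div a) = real n" using pos(3)[OF that(1)] by (metis of_nat_mult)
    show "integrable lborel (E w n a)"
      unfolding E_def by (rule two_exp_kernel) (use that pos[OF that(1)] in auto)
    show "integral\<^sup>L lborel (E w n a) = cosh_integral (w * of_nat n)"
      unfolding E_def using two_exp_kernel(2)[of w "real a" "real (n div a)"] that pos[OF that(1)] eq by simp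
  qed
  have TI: "integrable lborel (T n)" for n unfolding T_def by (intro Bochner_Integration.integrable_sum EI(1) z)
  have TL: "integral\<^sup>L lborel (T n) = d n * cosh_integral (z * of_nat n)" for n
    unfolding T_def d_def by (subst Bochner_Integration.integral_sum) (auto simp: EI z)
  obtain C where C: "C \<ge> 0" "\<And>\<rho>. \<rho> > 0 \<Longrightarrow> (LINT u|lborel. exp (- \<rho> * (exp u + exp (- u :: real)))) \<le> C * \<rho> powr (- 3)"
    by (rule cosh_kernel_integral_bound[of 3]) auto
  have TN: "(LINT u|lborel. norm (T n u)) \<le> C * Re z powr (-3) * real n powr (- 2)" for n
  proof (cases "n = 0")
    case False
    have "(LINT u|lborel. norm (T n u)) \<le> (LINT u|lborel. (\<Sum>a\<in>divisor_pairs X n. norm (E z n a u)))"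
      by (rule integral_mono) (auto simp: T_def intro!: norm_sum integrable_norm EI z Bochner_Integration.integrable_sum)
    also have "\<dots> = (\<Sum>a\<in>divisor_pairs X n. (LINT u|lborel. norm (E z n a u)))"
      by (intro Bochner_Integration.integral_sum integrable_norm EI z)
    also have "\<dots> \<le> (\<Sum>a\<in>divisor_pairs X n. C * (Re z * real n) powr (- 3))"
    proof (rule sum_mono)
      fix a assume a: "a \<in> divisor_pairs X n"
      have "complex_of_real (LINT u|lborel. norm (E z n a u)) = integral\<^sup>L lborel (E (of_real (Re z)) n a)"
        by (subst integral_complex_of_real[symmetric], intro Bochner_Integration.integral_cong refl)
           (simp only: E_def norm_exp_Re_of_real)
      also have "\<dots> = cosh_integral (of_real (Re z * real n))" using EI(2)[OF a, of "of_real (Re z)"] z by simp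
      also have "\<dots> = complex_of_real (LINT u|lborel. exp (- (Re z * real n) * (exp u + exp (- u))))"
        unfolding cosh_integral_def
        by (subst integral_complex_of_real[symmetric], intro Bochner_Integration.integral_cong refl)
           (simp add: exp_of_real[symmetric])
      finally show "(LINT u|lborel. norm (E z n a u)) \<le> C * (Re z * real n) powr (- 3)"
        using C(2)[of "Re z * real n"] z False by (simp only: of_real_eq_iff) simp
    qed
    also have "\<dots> = real (card (divisor_pairs X n)) * (C * (Re z * real n) powr (- 3))" by simp
    also have "\<dots> \<le> real n * (C * (Re z * real n) powr (- 3))"
      using card_divisor_pairs_le[OF X] C by (intro mult_right_mono) auto
    also have "\<dots> = C * Re z powr (-3) * real n powr (- 2)"
    proof -
      have "real n * real n powr (-3) = real n powr (1 + (-3))" using False by (subst powr_add) simp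
      thus ?thesis using z False by (simp add: powr_mult mult_ac)
    qed
    finally show ?thesis .
  qed (use X in \<open>simp add: T_def divisor_pairs_def\<close>)
  have sm2: "summable (\<lambda>n. C * Re z powr (-3) * real n powr (- 2))"
    by (intro summable_mult) (simp add: summable_real_powr_iff)
  have s2: "summable (\<lambda>n. LINT u|lborel. norm (T n u))"
    by (rule summable_comparison_test'[OF sm2, of 0]) (use TN in auto)
  have "norm (d n * (2 * Bessel_K 0 (2 * (c * of_real h * of_nat n)))) \<le> (LINT u|lborel. norm (T n u))" for n
  proof (cases "n = 0")
    case False
    hence "d n * (2 * Bessel_K 0 (2 * (c * of_real h * of_nat n))) = integral\<^sup>L lborel (T n)"
      unfolding TL using cosh_integral_Bessel[of "z * of_nat n"] z by (simp add: z_def)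
    thus ?thesis using integral_norm_bound[of lborel "T n"] by simp
  qed (use X in \<open>simp add: d_def divisor_pairs_def\<close>)
  hence "summable (\<lambda>n. norm (d n * (2 * Bessel_K 0 (2 * (c * of_real h * of_nat n)))))"
    by (intro summable_comparison_test'[OF s2, of 0]) auto
  from summable_mult[OF this, of "1/2"] show "summable (\<lambda>n. norm (d n * Bessel_K 0 (2 * (c * of_real h * of_nat n))))"
    by (simp add: norm_mult mult_ac)
  \<comment> \<open>Stated for a variable \<open>w\<close>: the case \<open>w = z\<close> is the identity wanted, the case \<open>w = Re z\<close> gives
    absolute convergence.\<close>
  have pt: "((\<lambda>n. \<Sum>a\<in>divisor_pairs X n. E w n a u) has_sum
        (theta_over X (w / of_real h) (h * exp u) * theta_over X (w / of_real h) (h * exp (- u)))) UNIV" if "Re w > 0" for w u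
  proof -
    have R: "Re (w / of_real h) > 0" using that h by simp
    have p: "h * exp u > 0" "h * exp (- u) > 0" using h by auto
    have "(\<lambda>n. \<Sum>a\<in>divisor_pairs X n. E w n a u) =
      (\<lambda>n. \<Sum>a\<in>divisor_pairs X n. exp (- (w / of_real h) * of_nat a ^ 2 * of_real (h * exp u)) *
         exp (- (w / of_real h) * of_nat (n div a) ^ 2 * of_real (h * exp (- u))))"
      using h by (intro ext sum.cong refl) (simp add: E_def exp_add[symmetric] algebra_simps)
    thus ?thesis
      using dirichlet_product_has_sum[OF theta_over_infsum(1)[OF R p(1) X] theta_over_infsum(1)[OF R p(2) X] X]
      by (simp only: theta_over_infsum(2)[OF R _ X] p)
  qed
  have s1: "AE u in lborel. summable (\<lambda>n. norm (T n u))"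
  proof (intro AE_I2)
    fix u :: real
    have "summable (\<lambda>n. \<Sum>a\<in>divisor_pairs X n. E (of_real (Re z)) n a u)"
      using has_sum_imp_sums[OF pt[of "of_real (Re z)" u]] z by (auto simp: sums_iff)
    from summable_Re[OF this] have S: "summable (\<lambda>n. \<Sum>a\<in>divisor_pairs X n. Re (E (of_real (Re z)) n a u))" by simp
    have "norm (E z n a u) = Re (E (of_real (Re z)) n a u)" for n a
      by (simp add: E_def Re_exp)
    thus "summable (\<lambda>n. norm (T n u))"
      by (intro summable_comparison_test'[OF S, of 0]) (auto simp: T_def intro: order.trans[OF norm_sum])
  qed
  have fs: "(\<Sum>n. T n u) = theta_over X c (h * exp u) * theta_over X c (h * exp (- u))" for u
    using has_sum_imp_sums[OF pt[OF z, of u]] h by (simp add: T_def sums_iff z_def)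
  have "(\<lambda>n. integral\<^sup>L lborel (T n)) = (\<lambda>n. d n * (2 * Bessel_K 0 (2 * (c * of_real h * of_nat n))))"
  proof
    fix n show "integral\<^sup>L lborel (T n) = d n * (2 * Bessel_K 0 (2 * (c * of_real h * of_nat n)))"
    proof (cases "n = 0")
      case False
      thus ?thesis unfolding TL using cosh_integral_Bessel[of "z * of_nat n"] z by (simp add: z_def)
    qed (use X in \<open>simp add: TL d_def divisor_pairs_def\<close>)
  qed
  with sums_integral[OF TI s1 s2] show "(\<lambda>n. d n * (2 * Bessel_K 0 (2 * (c * of_real h * of_nat n)))) sums
           (LINT u|lborel. theta_over X c (h * exp u) * theta_over X c (h * exp (- u)))"
    by (simp add: fs)
qed


section \<open>Moebius sums over the divisors of a product of primes\<close>

definition moebius_sum :: "nat \<Rightarrow> (nat \<Rightarrow> complex) \<Rightarrow> complex" where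
  "moebius_sum N F = (\<Sum>n | n dvd N. of_int (moebius_mu n) * F n)"

lemma moebius_sum_cong: "(\<And>n. n dvd N \<Longrightarrow> F n = G n) \<Longrightarrow> moebius_sum N F = moebius_sum N G"
  unfolding moebius_sum_def by (intro sum.cong) auto

lemma moebius_mu_prime_mult:
  assumes p: "prime p" and "\<not> p dvd n" "n > 0"
  shows "moebius_mu (p * n) = - moebius_mu n"
proof -
  have cop: "coprime p n" using p assms(2) by (simp add: prime_imp_coprime)
  have "squarefree (p * n) \<longleftrightarrow> squarefree n"
    using squarefree_mult_coprime[OF cop squarefree_prime[OF p]] squarefree_multD(2)[of p n] by blast
  moreover have "prime_factors (p * n) = insert p (prime_factors n)"
    using p \<open>n > 0\<close> by (subst prime_factors_product) (auto simp: prime_prime_factors)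
  moreover have "p \<notin> prime_factors n" using assms(2) by auto
  ultimately show ?thesis by (simp add: moebius_mu_def)
qed

text \<open>
  The divisors of \<open>p N\<close> are those of \<open>N\<close> and their multiples by \<open>p\<close>, and
  \<open>\<mu>\<close> changes sign from the former to the latter. The two evaluations of Moebius sums below
  follow from this recursion by adding one prime at a time.
\<close>
lemma moebius_sum_prime_mult:
  assumes p: "prime p" and N: "\<not> p dvd N" "N > 0"
  shows "moebius_sum (p * N) F = moebius_sum N F - moebius_sum N (\<lambda>n. F (p * n))"
proof -
  have fin: "finite {n. n dvd N}" using N by simp
  have D: "{n. n dvd p * N} = {n. n dvd N} \<union> (*) p ` {n. n dvd N}"
  proof (intro set_eqI iffI)
    fix n assume "n \<in> {n. n dvd p * N}"
    hence n: "n dvd p * N" by simp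
    show "n \<in> {n. n dvd N} \<union> (*) p ` {n. n dvd N}"
    proof (cases "p dvd n")
      case True
      then obtain m where "n = p * m" by blast
      with n p show ?thesis by (auto simp: prime_gt_0_nat)
    next
      case False
      hence "coprime p n" using p by (simp add: prime_imp_coprime)
      hence "n dvd N" using n by (simp add: coprime_dvd_mult_right_iff coprime_commute)
      thus ?thesis by simp
    qed
  qed auto
  have disj: "{n. n dvd N} \<inter> (*) p ` {n. n dvd N} = {}"
    using N by (auto dest: dvd_mult_left)
  have inj: "inj_on ((*) p) {n. n dvd N}" using p by (auto simp: inj_on_def prime_gt_0_nat)
  have "moebius_sum (p * N) F = moebius_sum N F + (\<Sum>n | n dvd N. of_int (moebius_mu (p * n)) * F (p * n))"
    unfolding moebius_sum_def D using fin disj inj by (subst sum.union_disjoint) (auto simp: sum.reindex)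
  also have "(\<Sum>n | n dvd N. of_int (moebius_mu (p * n)) * F (p * n)) = - moebius_sum N (\<lambda>n. F (p * n))"
    unfolding moebius_sum_def sum_negf[symmetric]
  proof (intro sum.cong refl)
    fix n assume "n \<in> {n. n dvd N}"
    hence "\<not> p dvd n" "n > 0" using N by (auto intro: dvd_trans dest: dvd_pos_nat)
    thus "of_int (moebius_mu (p * n)) * F (p * n) = - (of_int (moebius_mu n) * F (p * n))"
      by (simp add: moebius_mu_prime_mult[OF p])
  qed
  finally show ?thesis by simp
qed

lemma prime_not_dvd_prod_primes:
  assumes "finite P" "\<And>q. q \<in> P \<Longrightarrow> prime q" "prime p" "p \<notin> P"
  shows "\<not> p dvd \<Prod>P" and "\<Prod>P > (0::nat)"
proof -
  show "\<not> p dvd \<Prod>P"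
    using assms(1,3,4) primes_dvd_imp_eq[OF assms(3) assms(2)] by (auto simp: prime_dvd_prod_iff)
  show "\<Prod>P > 0" using assms by (intro prod_pos) (auto simp: prime_gt_0_nat)
qed

lemma moebius_sum_multiplicative:
  assumes "finite P" "\<And>p. p \<in> P \<Longrightarrow> prime p"
    and F: "F 1 = 1" "\<And>m n. m > 0 \<Longrightarrow> n > 0 \<Longrightarrow> F (m * n) = F m * F n"
  shows "moebius_sum (\<Prod>P) F = (\<Prod>p\<in>P. 1 - F p)"
  using assms(1,2)
proof (induction P rule: finite_induct)
  case (insert p P)
  note np = prime_not_dvd_prod_primes[of P p]
  have p: "prime p" "p > 0" using insert.prems by (auto simp: prime_gt_0_nat)
  have "moebius_sum (\<Prod>P) (\<lambda>n. F (p * n)) = moebius_sum (\<Prod>P) (\<lambda>n. F p * F n)"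
    by (rule moebius_sum_cong) (use F(2)[OF p(2)] np insert in \<open>auto dest: dvd_pos_nat simp del: prod_pos_nat_iff\<close>)
  also have "\<dots> = F p * moebius_sum (\<Prod>P) F"
    by (simp add: moebius_sum_def sum_distrib_left mult_ac)
  finally show ?case
    using insert np p by (simp add: moebius_sum_prime_mult algebra_simps)
qed (use F in \<open>simp add: moebius_sum_def moebius_mu_def\<close>)

text \<open>
  Moebius inversion in the form of a sieve: if \<open>p\<close> divides \<open>a\<close>, the terms with and
  without \<open>p\<close> cancel.
\<close>
lemma moebius_sum_indicator:
  assumes "finite P" "\<And>p. p \<in> P \<Longrightarrow> prime p" "a > 0"
  shows "moebius_sum (\<Prod>P) (\<lambda>n. of_bool (n dvd a)) = of_bool (coprime a (\<Prod>P))"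
  using assms
proof (induction P arbitrary: a rule: finite_induct)
  case (insert p P)
  note np = prime_not_dvd_prod_primes[of P p]
  have p: "prime p" "p > 0" using insert.prems by (auto simp: prime_gt_0_nat)
  have IH: "moebius_sum (\<Prod>P) (\<lambda>n. of_bool (n dvd b)) = of_bool (coprime b (\<Prod>P))" if "b > 0" for b
    using insert that by auto
  have eq: "moebius_sum (\<Prod>(insert p P)) (\<lambda>n. of_bool (n dvd a)) =
        of_bool (coprime a (\<Prod>P)) - moebius_sum (\<Prod>P) (\<lambda>n. of_bool (p * n dvd a))"
    using insert np p IH[of a] by (simp add: moebius_sum_prime_mult)
  show ?case
  proof (cases "p dvd a")
    case True
    then obtain b where b: "a = p * b" by blast
    have "coprime p (\<Prod>P)" using np p insert by (auto intro: prime_imp_coprime)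
    hence "moebius_sum (\<Prod>P) (\<lambda>n. of_bool (p * n dvd a)) = of_bool (coprime a (\<Prod>P))"
      using IH[of b] b insert.prems p by (simp add: coprime_mult_left_iff)
    moreover have "\<not> coprime a (\<Prod>(insert p P))"
    proof
      assume "coprime a (\<Prod>(insert p P))"
      hence "is_unit p" by (rule coprime_common_divisor) (use True insert in auto)
      thus False using p by simp
    qed
    ultimately show ?thesis using eq by simp
  next
    case False
    hence "moebius_sum (\<Prod>P) (\<lambda>n. of_bool (p * n dvd a)) = 0"
      unfolding moebius_sum_def by (auto intro!: sum.neutral dest: dvd_mult_left)
    moreover have "coprime a p" using prime_imp_coprime[OF p(1) False] by (simp add: coprime_commute)
    ultimately show ?thesis using eq insert by (simp add: coprime_mult_right_iff)
  qed
qed (simp add: moebius_sum_def moebius_mu_def)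

lemma has_sum_finite_sum:
  fixes f :: "'a \<Rightarrow> 'b \<Rightarrow> 'c :: {topological_comm_monoid_add}"
  assumes "finite I" "\<And>i. i \<in> I \<Longrightarrow> (f i has_sum S i) A"
  shows "((\<lambda>x. \<Sum>i\<in>I. f i x) has_sum (\<Sum>i\<in>I. S i)) A"
  using assms by (induction I rule: finite_induct) (auto intro!: has_sum_add)

text \<open>
  The sieve identity for the indicator function of coprimality, summed against \<open>e\<close>; the multiples of
  a divisor \<open>n\<close> are parametrised by \<open>n k\<close>.
\<close>
lemma infsum_coprime:
  fixes e :: "nat \<Rightarrow> complex"
  assumes P: "finite P" "\<And>p. p \<in> P \<Longrightarrow> prime p"
    and e: "(\<lambda>a. norm (e a)) summable_on {1..}"
  shows "infsum e {a. a \<ge> 1 \<and> coprime a (\<Prod>P)} = moebius_sum (\<Prod>P) (\<lambda>n. infsum (\<lambda>k. e (n * k)) {1..})"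
proof -
  have pos: "\<Prod>P > 0" using P by (intro prod_pos) (auto simp: prime_gt_0_nat)
  have S: "e summable_on A" if "A \<subseteq> {1..}" for A
    by (rule summable_on_subset_banach[OF Infinite_Sum.abs_summable_summable[OF e] that])
  have mult: "infsum (\<lambda>a. of_bool (n dvd a) * e a) {1..} = infsum (\<lambda>k. e (n * k)) {1..}"
     and sm: "(\<lambda>a. of_bool (n dvd a) * e a) summable_on {1..}" if n: "n > 0" for n
  proof -
    have "infsum (\<lambda>a. of_bool (n dvd a) * e a) {1..} = infsum e ((*) n ` {1..})"
    proof (rule infsum_cong_neutral)
      fix a assume "a \<in> {1..} - (*) n ` {1..}"
      thus "of_bool (n dvd a) * e a = 0" by (auto elim!: dvdE intro: gr0I Suc_leI)
    next
      fix a assume "a \<in> (*) n ` {1..} - {1..}"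
      thus "e a = 0" using n by auto
    qed auto
    also have "\<dots> = infsum (\<lambda>k. e (n * k)) {1..}"
      using n by (subst infsum_reindex) (auto simp: inj_on_def o_def)
    finally show "infsum (\<lambda>a. of_bool (n dvd a) * e a) {1..} = infsum (\<lambda>k. e (n * k)) {1..}" .
    have "(\<lambda>a. of_bool (n dvd a) * e a) summable_on {1..} \<longleftrightarrow> e summable_on {a\<in>{1..}. n dvd a}"
      by (rule summable_on_cong_neutral) auto
    moreover have "e summable_on {a\<in>{1..}. n dvd a}" by (rule S) auto
    ultimately show "(\<lambda>a. of_bool (n dvd a) * e a) summable_on {1..}" by blast
  qed
  have "infsum e {a. a \<ge> 1 \<and> coprime a (\<Prod>P)} = infsum (\<lambda>a. of_bool (coprime a (\<Prod>P)) * e a) {1..}"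
    by (rule infsum_cong_neutral) auto
  also have "\<dots> = infsum (\<lambda>a. \<Sum>n | n dvd \<Prod>P. of_int (moebius_mu n) * (of_bool (n dvd a) * e a)) {1..}"
  proof (rule infsum_cong)
    fix a :: nat assume "a \<in> {1..}"
    hence "of_bool (coprime a (\<Prod>P)) = moebius_sum (\<Prod>P) (\<lambda>n. of_bool (n dvd a))"
      using moebius_sum_indicator[OF P, of a] by simp
    thus "of_bool (coprime a (\<Prod>P)) * e a = (\<Sum>n | n dvd \<Prod>P. of_int (moebius_mu n) * (of_bool (n dvd a) * e a))"
      by (simp add: moebius_sum_def sum_distrib_right mult.assoc)
  qed
  also have "\<dots> = (\<Sum>n | n dvd \<Prod>P. infsum (\<lambda>a. of_int (moebius_mu n) * (of_bool (n dvd a) * e a)) {1..})"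
    by (intro infsumI has_sum_finite_sum has_sum_infsum) (use pos sm in \<open>auto intro!: summable_on_cmult_right dest: dvd_pos_nat\<close>)
  also have "\<dots> = moebius_sum (\<Prod>P) (\<lambda>n. infsum (\<lambda>k. e (n * k)) {1..})"
    unfolding moebius_sum_def
  proof (intro sum.cong refl)
    fix n assume "n \<in> {n. n dvd \<Prod>P}"
    hence "n > 0" using pos by (auto dest: dvd_pos_nat)
    thus "infsum (\<lambda>a. of_int (moebius_mu n) * (of_bool (n dvd a) * e a)) {1..} = of_int (moebius_mu n) * infsum (\<lambda>k. e (n * k)) {1..}"
      by (simp only: infsum_cmult_right' mult)
  qed
  finally show ?thesis .
qed

lemma of_nat_powr_mult:
  assumes "m > 0" "n > 0"
  shows "complex_of_nat (m * n) powr z = of_nat m powr z * of_nat n powr z"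
proof -
  have "complex_of_nat (m * n) = of_real (real m) * of_real (real n)" by simp
  thus ?thesis using assms by (simp only: powr_times_real_left) (simp add: powr_times_real)
qed


section \<open>The theta sum near the origin\<close>

text \<open>
  Compare the Taylor polynomials of \<open>F\<close> (degree 2) and \<open>f\<close> (degree 1) at the left
  endpoint: they cancel in this combination, and the two remainders contribute \<open>B/2\<close> each.
\<close>
lemma trapezoid_step:
  fixes F f f1 f2 :: "complex \<Rightarrow> complex"
  assumes d: "\<And>z. (F has_field_derivative f z) (at z)" "\<And>z. (f has_field_derivative f1 z) (at z)"
      "\<And>z. (f1 has_field_derivative f2 z) (at z)"
    and B: "\<And>x. a \<le> x \<Longrightarrow> x \<le> a + 1 \<Longrightarrow> norm (f2 (of_real x)) \<le> B"
  shows "norm ((f (of_real a) + f (of_real (a + 1))) / 2 - (F (of_real (a + 1)) - F (of_real a))) \<le> B"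
proof -
  define S where "S = complex_of_real ` {a..a+1}"
  have cS: "convex S"
    unfolding S_def by (intro convex_linear_image bounded_linear.linear[OF bounded_linear_of_real]) auto
  have mem: "of_real a \<in> S" "of_real (a + 1) \<in> S" unfolding S_def by (intro imageI; simp)+
  have BS: "norm (f2 x) \<le> B" if "x \<in> S" for x using that B by (auto simp: S_def)
  define G where "G = (\<lambda>i::nat. if i = 0 then f else if i = 1 then f1 else f2)"
  define H where "H = (\<lambda>i::nat. if i = 0 then F else if i = 1 then f else if i = 2 then f1 else f2)"
  have one: "complex_of_real (a + 1) - of_real a = 1" by simp
  have "norm (G 0 (of_real (a + 1)) - (\<Sum>i\<le>1. G i (of_real a) * (of_real (a + 1) - of_real a) ^ i / fact i))
          \<le> B * norm (complex_of_real (a + 1) - of_real a) ^ Suc 1 / fact 1"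
    by (rule complex_Taylor[OF cS _ _ mem(1) mem(2)])
       (use d BS in \<open>auto simp: G_def le_Suc_eq intro: has_field_derivative_at_within\<close>)
  hence e1: "norm (f (of_real (a + 1)) - (f (of_real a) + f1 (of_real a))) \<le> B"
    unfolding one by (simp add: G_def)
  have "norm (H 0 (of_real (a + 1)) - (\<Sum>i\<le>2. H i (of_real a) * (of_real (a + 1) - of_real a) ^ i / fact i))
          \<le> B * norm (complex_of_real (a + 1) - of_real a) ^ Suc 2 / fact 2"
    by (rule complex_Taylor[OF cS _ _ mem(1) mem(2)])
       (use d BS in \<open>auto simp: H_def le_Suc_eq numeral_2_eq_2 intro: has_field_derivative_at_within\<close>)
  hence e2: "norm (F (of_real (a + 1)) - (F (of_real a) + f (of_real a) + f1 (of_real a) / 2)) \<le> B / 2"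
    unfolding one by (simp add: H_def numeral_2_eq_2)
  have "(f (of_real a) + f (of_real (a + 1))) / 2 - (F (of_real (a + 1)) - F (of_real a)) =
     (f (of_real (a + 1)) - (f (of_real a) + f1 (of_real a))) / 2
     - (F (of_real (a + 1)) - (F (of_real a) + f (of_real a) + f1 (of_real a) / 2))"
    by (simp add: field_simps)
  also have "norm \<dots> \<le> norm ((f (of_real (a + 1)) - (f (of_real a) + f1 (of_real a))) / 2)
        + norm (F (of_real (a + 1)) - (F (of_real a) + f (of_real a) + f1 (of_real a) / 2))"
    by (rule norm_triangle_ineq4)
  also have "\<dots> \<le> B / 2 + B / 2" using e1 e2 by (intro add_mono) (auto simp: norm_divide)
  finally show ?thesis by simp
qed

text \<open>
  The summand is the derivative of \<open>\<surd>y arctan (\<surd>y x)\<close> at \<open>x = a\<close>. As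
  this derivative decreases, it is at most the increment over the preceding unit interval, and these increments
  telescope. The bound is of order \<open>\<surd>y\<close> for small \<open>y\<close>, which is what makes the
  trapezoidal error small.
\<close>
lemma sum_lorentzian_bound:
  assumes y: "y > (0::real)"
  shows "(\<Sum>a<M. y / (1 + y * real a ^ 2)) \<le> y + sqrt y * (pi / 2)"
proof -
  have step: "y / (1 + y * real (Suc a) ^ 2) \<le> sqrt y * (arctan (sqrt y * real (Suc a)) - arctan (sqrt y * real a))" for a
  proof -
    have "\<exists>z. sqrt y * real a < z \<and> z < sqrt y * real (Suc a) \<and>
        arctan (sqrt y * real (Suc a)) - arctan (sqrt y * real a) = (sqrt y * real (Suc a) - sqrt y * real a) * inverse (1 + z ^ 2)"
      by (rule MVT2) (use y in \<open>auto intro!: derivative_eq_intros\<close>)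
    then obtain z where z: "sqrt y * real a < z" "z < sqrt y * real (Suc a)"
      "arctan (sqrt y * real (Suc a)) - arctan (sqrt y * real a) = (sqrt y * real (Suc a) - sqrt y * real a) * inverse (1 + z ^ 2)"
      by blast
    have "0 \<le> z" using z(1) y by (smt (verit) mult_nonneg_nonneg of_nat_0_le_iff real_sqrt_ge_zero)
    hence "z ^ 2 \<le> (sqrt y * real (Suc a)) ^ 2" using z(2) by (intro power_mono) auto
    also have "\<dots> = y * real (Suc a) ^ 2" using y by (simp add: power_mult_distrib)
    finally have "inverse (1 + y * real (Suc a) ^ 2) \<le> inverse (1 + z ^ 2)"
      by (intro le_imp_inverse_le) (auto intro: add_pos_nonneg)
    hence "y * inverse (1 + y * real (Suc a) ^ 2) \<le> y * inverse (1 + z ^ 2)" using y by (intro mult_left_mono) auto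
    also have "\<dots> = sqrt y * (arctan (sqrt y * real (Suc a)) - arctan (sqrt y * real a))"
      unfolding z(3) using y by (simp add: algebra_simps)
    finally show ?thesis by (simp only: divide_inverse)
  qed
  have "(\<Sum>a<M. y / (1 + y * real a ^ 2)) \<le> (\<Sum>a<Suc M. y / (1 + y * real a ^ 2))"
    using y by (intro sum_mono2) (auto intro!: divide_nonneg_pos add_pos_nonneg)
  also have "\<dots> \<le> y + sqrt y * arctan (sqrt y * real M)"
  proof (induction M)
    case (Suc M)
    have "(\<Sum>a<Suc (Suc M). y / (1 + y * real a ^ 2)) =
            (\<Sum>a<Suc M. y / (1 + y * real a ^ 2)) + y / (1 + y * real (Suc M) ^ 2)" by (rule sum.lessThan_Suc)
    also have "\<dots> \<le> (y + sqrt y * arctan (sqrt y * real M)) + sqrt y * (arctan (sqrt y * real (Suc M)) - arctan (sqrt y * real M))"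
      by (intro add_mono Suc.IH step)
    also have "\<dots> = y + sqrt y * arctan (sqrt y * real (Suc M))" by (simp only: algebra_simps)
    finally show ?case .
  qed (use y in auto)
  also have "\<dots> \<le> y + sqrt y * (pi / 2)"
    using y arctan_ubound[of "sqrt y * real M"] by (intro add_left_mono mult_left_mono) auto
  finally show ?thesis .
qed

text \<open>
  The left-hand side dominates the second derivative of the Gaussian. The constant \<open>m\<close> is chosen so
  that \<open>m (1 + q)\<close> lies below the tangent line of \<open>exp (Re c q / 2)\<close>; its square
  absorbs two factors \<open>1 + q\<close>.
\<close>
lemma gaussian_quadratic_decay:
  fixes c :: complex
  assumes "Re c > 0"
  obtains K where "K \<ge> 0" "\<And>q. q \<ge> 0 \<Longrightarrow> (4 * norm c ^ 2 * q + 2 * norm c) * exp (- Re c * q) \<le> K / (1 + q)"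
proof -
  define m where "m = min 1 (Re c / 2)"
  define K where "K = (4 * norm c ^ 2 + 2 * norm c) / m ^ 2"
  have m: "m > 0" "m \<le> 1" "m \<le> Re c / 2" using assms by (auto simp: m_def)
  show ?thesis
  proof (rule that[of K])
    fix q :: real assume q: "q \<ge> 0"
    have "m * (1 + q) \<le> 1 + Re c / 2 * q" using m q mult_right_mono[OF m(3) q] by (simp add: algebra_simps)
    also have "\<dots> \<le> exp (Re c / 2 * q)" by (rule exp_ge_add_one_self)
    finally have "(m * (1 + q)) ^ 2 \<le> exp (Re c / 2 * q) ^ 2" using m q by (intro power_mono) auto
    also have "\<dots> = exp (Re c * q)" by (simp add: exp_of_nat_mult[symmetric] flip: exp_double)
    finally have 1: "m ^ 2 * (1 + q) ^ 2 \<le> exp (Re c * q)" by (simp add: power_mult_distrib)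
    have 2: "4 * norm c ^ 2 * q + 2 * norm c \<le> (4 * norm c ^ 2 + 2 * norm c) * (1 + q)"
      using q by (simp add: algebra_simps)
    have "(4 * norm c ^ 2 * q + 2 * norm c) * exp (- Re c * q) * (1 + q)
       \<le> ((4 * norm c ^ 2 + 2 * norm c) * (1 + q)) * exp (- Re c * q) * (1 + q)"
      using q 2 by (intro mult_right_mono) auto
    also have "\<dots> = (4 * norm c ^ 2 + 2 * norm c) * (exp (- Re c * q) * (1 + q) ^ 2)" by (simp add: power2_eq_square)
    also have "\<dots> \<le> (4 * norm c ^ 2 + 2 * norm c) * (1 / m ^ 2)"
      using 1 m by (intro mult_left_mono) (auto simp: exp_minus field_simps)
    also have "\<dots> = K" by (simp add: K_def)
    finally show "(4 * norm c ^ 2 * q + 2 * norm c) * exp (- Re c * q) \<le> K / (1 + q)" using q by (simp add: field_simps)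
  qed (use m in \<open>auto simp: K_def\<close>)
qed

text \<open>
  The limit \<open>g0\<close> is the Gaussian integral over the half-line. It enters the expansion at
  \<open>-\<infinity>\<close> only through constants that are evaluated later, from the behaviour at
  \<open>s = 1\<close>.
\<close>
lemma gaussian_primitive:
  fixes c :: complex
  assumes c: "Re c > 0"
  obtains E g0 where "\<And>z. (E has_field_derivative exp (- c * z ^ 2)) (at z)" "E 0 = 0"
    "((\<lambda>x. E (complex_of_real x)) \<longlongrightarrow> g0) at_top"
proof -
  obtain E0 where E0: "\<And>z. (E0 has_field_derivative exp (- c * z ^ 2)) (at z)"
  proof -
    have "(\<lambda>z. exp (- c * z ^ 2)) holomorphic_on UNIV" by (intro holomorphic_intros)
    from holomorphic_convex_primitive'[OF convex_UNIV open_UNIV this] show ?thesis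
      using that by (metis UNIV_I)
  qed
  define E where "E = (\<lambda>z. E0 z - E0 0)"
  have E: "(E has_field_derivative exp (- c * z ^ 2)) (at z)" for z
    unfolding E_def by (auto intro!: derivative_eq_intros E0)
  define f where "f = (\<lambda>t. exp (- c * complex_of_real t ^ 2))"
  have [measurable]: "f \<in> borel_measurable borel" unfolding f_def by measurable
  have int: "set_integrable lborel {0..} f"
  proof (rule set_integrable_exp_bound[of _ "2 * Re c" "exp (Re c)"])
    fix x :: real
    have "norm (f x) = exp (- Re c * x ^ 2)"
      unfolding f_def by (simp flip: of_real_power)
    also have "\<dots> \<le> exp (Re c + - (2 * Re c) * x)"
    proof -
      have "Re c * (x - 1) ^ 2 \<ge> 0" using c by simp
      thus ?thesis by (simp add: power2_eq_square algebra_simps)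
    qed
    finally show "norm (f x) \<le> exp (Re c) * exp (- (2 * Re c) * x)" by (simp only: exp_add)
  qed (use c in auto)
  have "((\<lambda>x. LINT t:{0..x}|lborel. f t) \<longlongrightarrow> (LINT t:{0..}|lborel. f t)) at_top"
    by (rule tendsto_set_lebesgue_integral_at_top) (use int in auto)
  also have "?this \<longleftrightarrow> ((\<lambda>x. E (complex_of_real x)) \<longlongrightarrow> (LINT t:{0..}|lborel. f t)) at_top"
  proof (rule tendsto_cong, use eventually_ge_at_top[of 0] in eventually_elim)
    fix x :: real assume x: "x \<ge> 0"
    have "((\<lambda>t. E (complex_of_real t)) has_vector_derivative f t) (at t within {0..x})" for t
      unfolding f_def
    proof -
      have "(complex_of_real has_vector_derivative 1) (at t within {0..x})"
        using has_vector_derivative_of_real[OF DERIV_ident, of "at t within {0..x}"] by simp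
      from field_vector_diff_chain_within[OF this has_field_derivative_at_within[OF E]]
      show "((\<lambda>t. E (complex_of_real t)) has_vector_derivative exp (- c * complex_of_real t ^ 2)) (at t within {0..x})"
        by (simp add: o_def)
    qed
    hence "(f has_integral (E (of_real x) - E (of_real 0))) {0..x}"
      using x by (intro fundamental_theorem_of_calculus) auto
    moreover have "set_integrable lborel {0..x} f" by (rule set_integrable_subset[OF int]) auto
    ultimately show "(LINT t:{0..x}|lborel. f t) = E (complex_of_real x)"
      by (simp add: set_borel_integral_eq_integral(2) integral_unique E_def)
  qed
  finally show ?thesis using that[of E] E by (simp add: E_def)
qed

text \<open>
  The trapezoidal rule with unit steps for the Gaussian \<open>x \<mapsto> exp (-c y x\<^sup>2)\<close> on
  the half-line. Its second derivative is at most a constant times \<open>y / (1 + y x\<^sup>2)\<close>, so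
  the errors of all steps add up to \<open>O(\<surd>y)\<close> for \<open>y \<le> 1\<close>; the term
  \<open>-1/2\<close> is the endpoint weight at 0. For \<open>y > 1\<close> all three quantities are trivially
  that small.
\<close>
lemma theta_trapezoid:
  fixes c :: complex
  assumes c: "Re c > 0"
  obtains g0 K where "K \<ge> 0"
    "\<And>y. y > 0 \<Longrightarrow> norm (theta_over {1..} c y - (g0 / of_real (sqrt y) - 1 / 2)) \<le> K * sqrt y"
proof -
  obtain E g0 where E: "\<And>z. (E has_field_derivative exp (- c * z ^ 2)) (at z)" "E 0 = 0"
    "((\<lambda>x. E (complex_of_real x)) \<longlongrightarrow> g0) at_top"
    using gaussian_primitive[OF c] by blast
  obtain K where K: "K \<ge> 0" "\<And>q. q \<ge> 0 \<Longrightarrow> (4 * norm c ^ 2 * q + 2 * norm c) * exp (- Re c * q) \<le> K / (1 + q)"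
    using gaussian_quadratic_decay[OF c] by blast
  obtain C where C: "C \<ge> 0" "\<And>X y. y > 0 \<Longrightarrow> norm (theta_over X c y) \<le> C * y powr (- 1)"
  proof -
    have "1 > (1 / 2 :: real)" by simp
    thus ?thesis
    proof (rule theta_over_bound[OF c])
      fix C assume "C \<ge> 0" "\<And>X y. y > 0 \<Longrightarrow> norm (theta_over X c y) \<le> C * y powr (- 1)"
      thus ?thesis by (rule that)
    qed
  qed
  define psi where "psi = theta_over {1..} c"
  have small: "norm (psi y - (g0 / of_real (sqrt y) - 1 / 2)) \<le> (3 * K) * sqrt y" if y: "0 < y" "y \<le> 1" for y
  proof -
    define r where "r = sqrt y"
    have r: "r > 0" "r ^ 2 = y" "r \<le> 1" using y by (simp_all add: r_def)
    define F where "F = (\<lambda>z. E (of_real r * z) / of_real r)"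
    define f where "f = (\<lambda>z. exp (- c * of_real y * z ^ 2))"
    define f1 where "f1 = (\<lambda>z. (- 2 * c * of_real y * z) * f z)"
    define f2 where "f2 = (\<lambda>z. (4 * c ^ 2 * of_real y ^ 2 * z ^ 2 - 2 * c * of_real y) * f z)"
    have rc: "complex_of_real r ^ 2 = of_real y" unfolding r(2)[symmetric] by (rule of_real_power[symmetric])
    have dF: "(F has_field_derivative f z) (at z)" for z
    proof -
      have "((\<lambda>z. E (of_real r * z)) has_field_derivative exp (- c * (of_real r * z) ^ 2) * of_real r) (at z)"
        by (rule DERIV_chain2[OF E(1)]) (auto intro!: derivative_eq_intros)
      hence "(F has_field_derivative (exp (- c * (of_real r * z) ^ 2) * of_real r) / of_real r) (at z)"
        unfolding F_def by (rule DERIV_cdivide)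
      moreover have "(exp (- c * (of_real r * z) ^ 2) * of_real r) / of_real r = f z"
        using r rc by (simp add: f_def power_mult_distrib mult.assoc)
      ultimately show ?thesis by simp
    qed
    have df: "(f has_field_derivative f1 z) (at z)" for z
      unfolding f1_def f_def by (auto intro!: derivative_eq_intros simp: algebra_simps)
    have df1: "(f1 has_field_derivative f2 z) (at z)" for z
    proof -
      have "(f1 has_field_derivative ((- 2 * c * of_real y) * f z + f1 z * (- 2 * c * of_real y * z))) (at z)"
        unfolding f1_def[abs_def] by (rule derivative_eq_intros df refl)+ (simp add: f1_def)
      moreover have "(- 2 * c * of_real y) * f z + f1 z * (- 2 * c * of_real y * z) = f2 z"
        by (simp add: f1_def f2_def power2_eq_square algebra_simps)
      ultimately show ?thesis by simp
    qed
    have bf2: "norm (f2 (of_real x)) \<le> K * (y / (1 + y * real a ^ 2))" if x: "real a \<le> x" for x a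
    proof -
      define q where "q = y * x ^ 2"
      have q: "q \<ge> y * real a ^ 2" "q \<ge> 0"
        using x y unfolding q_def by (auto intro!: mult_left_mono power_mono)
      have nf: "norm (f (of_real x)) = exp (- Re c * q)"
      proof -
        have eq: "- c * of_real y * complex_of_real x ^ 2 = - c * of_real q"
          by (simp only: q_def of_real_mult of_real_power mult.assoc mult_minus_left)
        show ?thesis unfolding f_def eq by simp
      qed
      have "norm (4 * c ^ 2 * of_real y ^ 2 * complex_of_real x ^ 2 - 2 * c * of_real y)
              \<le> norm (4 * c ^ 2 * of_real y ^ 2 * complex_of_real x ^ 2) + norm (2 * c * complex_of_real y)"
        by (rule norm_triangle_ineq4)
      also have "\<dots> = y * (4 * norm c ^ 2 * q + 2 * norm c)"
        using y by (simp add: norm_mult norm_power q_def power2_eq_square algebra_simps)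
      finally have "norm (f2 (of_real x)) \<le> y * (4 * norm c ^ 2 * q + 2 * norm c) * exp (- Re c * q)"
        unfolding f2_def norm_mult nf by (intro mult_right_mono) auto
      also have "\<dots> \<le> y * (K / (1 + q))" using K(2)[OF q(2)] y by (simp only: mult.assoc) (intro mult_left_mono, auto)
      also have "\<dots> \<le> y * (K / (1 + y * real a ^ 2))"
        using q y K(1) by (intro mult_left_mono divide_left_mono) (auto intro!: mult_pos_pos add_pos_nonneg)
      finally show ?thesis by (simp add: mult_ac)
    qed
    define D where "D = (\<lambda>a::nat. (f (of_nat a) + f (of_nat (Suc a))) / 2 - (F (of_nat (Suc a)) - F (of_nat a)))"
    have D: "norm (D a) \<le> K * (y / (1 + y * real a ^ 2))" for a
      using trapezoid_step[OF dF df df1, of "real a" "K * (y / (1 + y * real a ^ 2))"] bf2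
      by (simp add: D_def add.commute)
    have tel: "(\<Sum>a<M. D a) = (\<Sum>a<M. f (of_nat (Suc a))) + f 0 / 2 - f (of_nat M) / 2 - F (of_nat M)" for M
    proof (induction M)
      case 0
      show ?case by (simp add: F_def E(2))
    next
      case (Suc M)
      show ?case unfolding sum.lessThan_Suc Suc.IH unfolding D_def by (simp add: field_simps)
    qed
    have bound: "norm (\<Sum>a<M. D a) \<le> (3 * K) * sqrt y" for M
    proof -
      have "norm (\<Sum>a<M. D a) \<le> (\<Sum>a<M. K * (y / (1 + y * real a ^ 2)))" by (intro sum_norm_le D)
      also have "\<dots> \<le> K * (y + sqrt y * (pi / 2))"
        unfolding sum_distrib_left[symmetric] by (intro mult_left_mono sum_lorentzian_bound y K)
      also have "\<dots> \<le> K * (sqrt y * 3)"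
      proof (intro mult_left_mono K(1))
        \<comment> \<open>Here \<open>y \<le> 1\<close> and \<open>pi / 2 \<le> 2\<close> account for the factor \<open>3 = 1 + 2\<close>.\<close>
        have "y \<le> sqrt y" using r mult_left_mono[of r 1 r] by (simp add: r_def[symmetric] power2_eq_square)
        moreover have "sqrt y * (pi / 2) \<le> sqrt y * 2" using pi_less_4 y by (intro mult_left_mono) auto
        ultimately show "y + sqrt y * (pi / 2) \<le> sqrt y * 3" by linarith
      qed
      finally show ?thesis by simp
    qed
    have s1: "(\<lambda>a. f (of_nat (Suc a))) sums psi y"
    proof -
      have "summable (\<lambda>n. if Suc n \<in> {1..} then exp (- c * of_nat (Suc n) ^ 2 * of_real y) else 0)"
        by (rule summable_norm_cancel[OF theta_over_summable[OF c y(1)]])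
      hence "(\<lambda>n. if Suc n \<in> {1..} then exp (- c * of_nat (Suc n) ^ 2 * of_real y) else 0) sums psi y"
        unfolding psi_def theta_over_def by (rule summable_sums)
      thus ?thesis by (rule back_subst[of "\<lambda>g. g sums psi y"]) (auto simp: f_def mult_ac)
    qed
    have "(\<lambda>a. f (of_nat (Suc a))) \<longlonglongrightarrow> 0" by (rule summable_LIMSEQ_zero) (use s1 in \<open>simp add: sums_iff\<close>)
    hence s2: "(\<lambda>a. f (of_nat a)) \<longlonglongrightarrow> 0" by (rule LIMSEQ_imp_Suc)
    have s3: "(\<lambda>M. F (of_nat M)) \<longlonglongrightarrow> g0 / of_real r"
    proof -
      have "filterlim (\<lambda>M. r * real M) at_top sequentially"
        using r by (intro filterlim_tendsto_pos_mult_at_top[OF tendsto_const]) (auto simp: filterlim_real_sequentially)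
      from filterlim_compose[OF E(3) this] show ?thesis
        unfolding F_def using r by (intro tendsto_divide) auto
    qed
    have "(\<lambda>M. \<Sum>a<M. D a) \<longlonglongrightarrow> psi y + f 0 / 2 - 0 / 2 - g0 / of_real r"
      unfolding tel by (intro tendsto_intros s2 s3) (use s1 in \<open>simp_all add: sums_def\<close>)
    hence "norm (psi y + f 0 / 2 - 0 / 2 - g0 / of_real r) \<le> (3 * K) * sqrt y"
      by (intro Lim_norm_ubound[OF _ _ always_eventually]) (use bound in auto)
    thus ?thesis by (simp add: r_def f_def algebra_simps)
  qed
  have large: "norm (psi y - (g0 / of_real (sqrt y) - 1 / 2)) \<le> (C + norm g0 + 1) * sqrt y" if y: "1 < y" for y
  proof -
    have ry: "sqrt y \<ge> 1" using y by simp
    have "norm (psi y) \<le> C * y powr (- 1)" unfolding psi_def by (rule C(2)) (use y in auto)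
    also have "\<dots> \<le> C * sqrt y"
    proof (intro mult_left_mono C(1))
      have "y powr (- 1) \<le> y powr 0" using y by (intro powr_mono) auto
      moreover have "y powr 0 = 1" using y by simp
      ultimately show "y powr (- 1) \<le> sqrt y" using ry by linarith
    qed
    finally have 1: "norm (psi y) \<le> C * sqrt y" .
    have 2: "norm (g0 / of_real (sqrt y)) \<le> norm g0 * sqrt y"
    proof -
      have "norm g0 / sqrt y \<le> norm g0 / 1" using ry by (intro divide_left_mono) auto
      also have "\<dots> \<le> norm g0 * sqrt y" using ry mult_left_mono[OF ry norm_ge_zero[of g0]] by simp
      finally show ?thesis using y by (simp add: norm_divide)
    qed
    have "norm (psi y - (g0 / of_real (sqrt y) - 1 / 2)) \<le> norm (psi y) + norm (g0 / of_real (sqrt y) - 1 / 2)"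
      by (rule norm_triangle_ineq4)
    also have "\<dots> \<le> norm (psi y) + (norm (g0 / of_real (sqrt y)) + norm (1 / 2 :: complex))"
      by (intro add_left_mono norm_triangle_ineq4)
    also have "\<dots> \<le> C * sqrt y + (norm g0 * sqrt y + sqrt y)" 
    proof (intro add_mono 1 2)
      have "norm (1 / 2 :: complex) = 1 / 2" by (simp add: norm_divide)
      thus "norm (1 / 2 :: complex) \<le> sqrt y" using ry by linarith
    qed
    finally show ?thesis by (simp add: algebra_simps)
  qed
  show ?thesis
  proof (rule that[of "3 * K + (C + norm g0 + 1)" g0])
    fix y :: real assume y: "y > 0"
    show "norm (theta_over {1..} c y - (g0 / of_real (sqrt y) - 1 / 2)) \<le> (3 * K + (C + norm g0 + 1)) * sqrt y"
    proof (cases "y \<le> 1")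
      case True
      have "norm (psi y - (g0 / of_real (sqrt y) - 1 / 2)) \<le> (3 * K) * sqrt y" using small y True by blast
      also have "\<dots> \<le> (3 * K + (C + norm g0 + 1)) * sqrt y" using C(1) y by (intro mult_right_mono) auto
      finally show ?thesis by (simp add: psi_def)
    next
      case False
      hence "norm (psi y - (g0 / of_real (sqrt y) - 1 / 2)) \<le> (C + norm g0 + 1) * sqrt y" by (intro large) auto
      also have "\<dots> \<le> (3 * K + (C + norm g0 + 1)) * sqrt y" using K(1) y by (intro mult_right_mono) auto
      finally show ?thesis by (simp add: psi_def)
    qed
  qed (use K C in auto)
qed


section \<open>Autocorrelations\<close>

definition autocorr :: "(real \<Rightarrow> complex) \<Rightarrow> real \<Rightarrow> complex" where
  "autocorr w x = (LINT u|lborel. w (x + u) * w (x - u)) / 2"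

lemma autocorr_measurable [measurable]:
  assumes [measurable]: "w \<in> borel_measurable borel"
  shows "autocorr w \<in> borel_measurable borel"
  unfolding autocorr_def by measurable

text \<open>
  For fixed \<open>x\<close> the shift \<open>u \<mapsto> u - x\<close> turns the inner integrand into
  \<open>V(u) V(2x - u)\<close>. Integrating over \<open>x\<close> first then separates the two factors; the
  dilation \<open>2x\<close> is the source of the factor one half.
\<close>
lemma integral_autocorrelation:
  fixes V :: "real \<Rightarrow> complex"
  assumes V: "integrable lborel V"
  shows "integrable lborel (\<lambda>x. LINT u|lborel. V (x + u) * V (x - u))"
    and "(LINT x|lborel. LINT u|lborel. V (x + u) * V (x - u)) = (LINT x|lborel. V x) ^ 2 / 2"
proof -
  have [measurable]: "V \<in> borel_measurable borel" using V by auto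
  have inner: "(LINT u|lborel. V (x + u) * V (x - u)) = (LINT u|lborel. V u * V (2 * x - u))" for x
    using lborel_integral_real_affine[of 1 "\<lambda>u. V u * V (2 * x - u)" x] by (simp add: algebra_simps)
  have aff: "integrable lborel (\<lambda>x. g (- u + 2 * x))"
       "(LINT x|lborel. g (- u + 2 * x)) = (LINT x|lborel. g x) / 2"
    if "integrable lborel g" for g :: "real \<Rightarrow> 'b::{real_normed_field, banach, second_countable_topology}" and u
    using lborel_integrable_real_affine[OF that, of 2 "-u"] lborel_integral_real_affine[of 2 g "-u"]
    by (simp_all add: scaleR_conv_of_real)
  have I: "integrable (lborel \<Otimes>\<^sub>M lborel) (\<lambda>(u, x). V u * V (- u + 2 * x))"
  proof (rule lborel_pair.Fubini_integrable)
    have "(\<lambda>u. LINT x|lborel. norm (case (u, x) of (u, x) \<Rightarrow> V u * V (- u + 2 * x))) =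
          (\<lambda>u. norm (V u) * ((LINT x|lborel. norm (V x)) / 2))"
      using aff(2)[of "\<lambda>x. norm (V x)"] V by (auto simp: norm_mult)
    thus "integrable lborel (\<lambda>u. LINT x|lborel. norm (case (u, x) of (u, x) \<Rightarrow> V u * V (- u + 2 * x)))"
      using V by simp
  qed (use aff(1)[OF V] in auto)
  have eq: "(LINT u|lborel. V (x + u) * V (x - u)) = (LINT u|lborel. V u * V (- u + 2 * x))" for x
    unfolding inner by (simp add: algebra_simps)
  show "integrable lborel (\<lambda>x. LINT u|lborel. V (x + u) * V (x - u))"
    unfolding eq by (rule lborel_pair.integrable_snd[OF I])
  have "(LINT x|lborel. LINT u|lborel. V u * V (- u + 2 * x)) =
        (LINT u|lborel. LINT x|lborel. V u * V (- u + 2 * x))"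
    by (rule lborel_pair.Fubini_integral) (use I in auto)
  also have "\<dots> = (LINT u|lborel. V u * ((LINT x|lborel. V x) / 2))"
    by (simp only: integral_mult_right_zero aff(2)[OF V])
  also have "\<dots> = (LINT x|lborel. V x) ^ 2 / 2"
    by (simp add: power2_eq_square)
  finally show "(LINT x|lborel. LINT u|lborel. V (x + u) * V (x - u)) = (LINT x|lborel. V x) ^ 2 / 2"
    unfolding eq .
qed

text \<open>
  The integrand is even in \<open>u\<close>.
\<close>
lemma autocorr_half_line:
  assumes "integrable lborel (\<lambda>u. w (x + u) * w (x - u))"
  shows "autocorr w x = (LINT u:{0..}|lborel. w (x + u) * w (x - u))"
  unfolding autocorr_def integral_split_at_0[OF assms] by (simp add: mult.commute)

text \<open>
  A decay rate above \<open>k/2\<close> is used for the larger and one below it for the smaller of the two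
  arguments: their sum gives \<open>exp (-kx)\<close>, and their difference makes the integral over
  \<open>u\<close> converge.
\<close>
lemma autocorr_decay:
  assumes [measurable]: "w \<in> borel_measurable borel"
    and dec: "\<And>k. k > 0 \<Longrightarrow> \<exists>C. \<forall>v. norm (w v) \<le> C * exp (- k * v)" and k: "k > 0"
  shows "integrable lborel (\<lambda>u. w (x + u) * w (x - u))"
    and "\<exists>C. \<forall>x. norm (autocorr w x) \<le> C * exp (- k * x)"
proof -
  obtain C1 where C1: "\<And>v. norm (w v) \<le> C1 * exp (- (3 * k / 4) * v)" using dec[of "3 * k / 4"] k by auto
  obtain C2 where C2: "\<And>v. norm (w v) \<le> C2 * exp (- (k / 4) * v)" using dec[of "k / 4"] k by auto
  have nn: "C1 \<ge> 0" "C2 \<ge> 0" using order.trans[OF norm_ge_zero C1[of 0]] order.trans[OF norm_ge_zero C2[of 0]] by simp_all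
  have b0: "norm (w (x + u) * w (x - u)) \<le> (C1 * C2 * exp (- k * x)) * exp (- (k / 2) * u)" for x u
  proof -
    have "norm (w (x + u) * w (x - u)) \<le> (C1 * exp (- (3 * k / 4) * (x + u))) * (C2 * exp (- (k / 4) * (x - u)))"
      unfolding norm_mult by (intro mult_mono C1 C2) (use nn in auto)
    also have "\<dots> = C1 * C2 * exp (- (3 * k / 4) * (x + u) + - (k / 4) * (x - u))"
      unfolding exp_add by (simp add: mult_ac)
    also have "- (3 * k / 4) * (x + u) + - (k / 4) * (x - u) = - k * x + - (k / 2) * u" by (simp add: field_simps)
    finally show ?thesis unfolding exp_add by (simp add: mult_ac)
  qed
  have b: "norm (w (x + u) * w (x - u)) \<le> (C1 * C2 * exp (- k * x)) * exp (- (k / 2) * \<bar>u\<bar>)" for x u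
    using b0[of x u] b0[of x "- u"] by (cases "u \<ge> 0") (simp_all add: mult.commute)
  show I: "integrable lborel (\<lambda>u. w (x + u) * w (x - u))" for x
    by (rule integrable_exp_abs_bound[OF _ _ b]) (use k in auto)
  show "\<exists>C. \<forall>x. norm (autocorr w x) \<le> C * exp (- k * x)"
  proof (intro exI allI)
    fix x
    have "autocorr w x = (LINT u:{0..}|lborel. w (x + u) * w (x - u))" by (rule autocorr_half_line[OF I])
    also have "norm \<dots> \<le> (C1 * C2 * exp (- k * x)) / (k / 2)"
      by (rule norm_set_integral_exp_bound) (use b0 k in auto)
    finally show "norm (autocorr w x) \<le> (C1 * C2 / (k / 2)) * exp (- k * x)" by (simp add: mult_ac)
  qed
qed

text \<open>
  On the half-line \<open>u \<ge> 0\<close> the factor \<open>w(x - u)\<close> is close to its limit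
  \<open>\<alpha>\<close>. Replacing it by \<open>\<alpha>\<close> leaves \<open>\<alpha>\<close> times the
  integral of \<open>w\<close> over \<open>[x, \<infinity>)\<close>, which grows linearly as
  \<open>x \<rightarrow> -\<infinity>\<close> since \<open>w\<close> itself tends to \<open>\<alpha>\<close>.
  The error \<open>w(x + u) (w(x - u) - \<alpha>)\<close> is integrable because \<open>w(x + u)\<close>
  is at most \<open>C exp (-\<epsilon>(x+u))\<close> and the deviation at most \<open>K exp (x-u)\<close>.
\<close>
lemma autocorr_asymptotic:
  assumes [measurable]: "w \<in> borel_measurable borel"
    and dec: "\<And>k. k > 0 \<Longrightarrow> \<exists>C. \<forall>v. norm (w v) \<le> C * exp (- k * v)"
    and lim: "\<And>v. norm (w v - \<alpha>) \<le> K * exp v"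
  obtains B0 B1 where "\<And>\<epsilon>. 0 < \<epsilon> \<Longrightarrow> \<epsilon> < 1 \<Longrightarrow>
      \<exists>C. \<forall>x\<le>0. norm (autocorr w x - (B0 + B1 * of_real x)) \<le> C * exp ((1 - \<epsilon>) * x)"
proof -
  define q where "q = (\<lambda>v. w v - \<alpha>)"
  have [measurable]: "q \<in> borel_measurable borel" unfolding q_def by measurable
  have K: "K \<ge> 0" using order.trans[OF norm_ge_zero lim[of 0]] by simp
  have qb: "norm (q (x - u)) \<le> (K * exp x) * exp (- 1 * u)" for x u
    using lim[of "x - u"] by (simp add: q_def exp_diff exp_minus field_simps)
  obtain C1 where C1: "\<And>v. norm (w v) \<le> C1 * exp (- 1 * v)" using dec[of 1] by auto
  have w0: "set_integrable lborel {0..} w" by (rule set_integrable_exp_bound[OF _ _ C1]) auto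
  have affine: "(LINT v:{..x}|lborel. q v) = (LINT u:{0..}|lborel. q (x - u))"
       "set_integrable lborel {..x} q" for x
  proof -
    have eq: "(\<lambda>u. indicator {..x} (x + - 1 * u) *\<^sub>R q (x + - 1 * u)) = (\<lambda>u. indicator {0..} u *\<^sub>R q (x - u))"
      by (auto simp: indicator_def fun_eq_iff)
    show "(LINT v:{..x}|lborel. q v) = (LINT u:{0..}|lborel. q (x - u))"
      using lborel_integral_real_affine[of "-1" "\<lambda>v. indicator {..x} v *\<^sub>R q v" x]
      unfolding eq by (simp add: set_lebesgue_integral_def)
    have "set_integrable lborel {0..} (\<lambda>u. q (x - u))" by (rule set_integrable_exp_bound[OF _ _ qb]) auto
    thus "set_integrable lborel {..x} q"
      using lborel_integrable_real_affine_iff[of "-1" "\<lambda>v. indicator {..x} v *\<^sub>R q v" x]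
      unfolding eq by (simp add: set_integrable_def)
  qed
  define B0 where "B0 = \<alpha> * ((LINT v:{0..}|lborel. w v) + (LINT v:{..0}|lborel. q v))"
  define B1 where "B1 = - (\<alpha> * \<alpha>)"
  define T where "T = (\<lambda>x. LINT u:{0..}|lborel. w (x + u) * q (x - u))"
  have wx: "set_integrable lborel {0..} (\<lambda>u. w (x + u))" for x
  proof (rule set_integrable_exp_bound)
    show "norm (w (x + u)) \<le> (C1 * exp (- x)) * exp (- 1 * u)" for u
      using C1[of "x + u"] by (simp add: exp_add exp_diff exp_minus field_simps)
  qed auto
  \<comment> \<open>Split the integral of \<open>w\<close> over \<open>[x, \<infinity>)\<close> at 0 and write \<open>w = \<alpha> + q\<close> on the part below 0.\<close>
  have main: "(LINT u:{0..}|lborel. w (x + u)) = (LINT v:{0..}|lborel. w v) + (LINT v:{..0}|lborel. q v) - \<alpha> * of_real x - (LINT v:{..x}|lborel. q v)"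
    if x: "x \<le> 0" for x
  proof -
    have eq: "(\<lambda>u. indicator {x..} (x + 1 * u) *\<^sub>R w (x + 1 * u)) = (\<lambda>u. indicator {0..} u *\<^sub>R w (x + u))"
      by (auto simp: indicator_def fun_eq_iff)
    have e1: "(LINT u:{0..}|lborel. w (x + u)) = (LINT v:{x..}|lborel. w v)"
      using lborel_integral_real_affine[of 1 "\<lambda>v. indicator {x..} v *\<^sub>R w v" x]
      unfolding eq by (simp add: set_lebesgue_integral_def)
    have i1: "set_integrable lborel {x..} w"
      using wx[of x] lborel_integrable_real_affine_iff[of 1 "\<lambda>v. indicator {x..} v *\<^sub>R w v" x]
      unfolding eq by (simp add: set_integrable_def)
    have e2: "(LINT v:{x..}|lborel. w v) = (LINT v:{x..<0}|lborel. w v) + (LINT v:{0..}|lborel. w v)"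
    proof -
      have "{x..} = {x..<0} \<union> {0..}" "{x..<0} \<inter> {0..} = {}" using x by auto
      thus ?thesis using set_integral_Un[of "{x..<0}" "{0..}" lborel w] w0 set_integrable_subset[OF i1, of "{x..<0}"] by auto
    qed
    have iq: "set_integrable lborel {x..<0} q" by (rule set_integrable_subset[OF affine(2)[of 0]]) auto
    have ic: "set_integrable lborel {x..<0} (\<lambda>_. \<alpha>)"
      unfolding set_integrable_def using x by (auto intro!: integrable_real_indicator integrable_scaleR_left)
    have e3: "(LINT v:{x..<0}|lborel. w v) = (LINT v:{x..<0}|lborel. \<alpha>) + (LINT v:{x..<0}|lborel. q v)"
      using set_integral_add(2)[OF ic iq] by (simp add: q_def)
    have e4: "(LINT v:{x..<0}|lborel. \<alpha>) = - \<alpha> * of_real x"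
      using x by (simp add: set_lebesgue_integral_def scaleR_conv_of_real)
    have ix: "set_integrable lborel {..<x} q" by (rule set_integrable_subset[OF affine(2)[of x]]) auto
    have e5: "(LINT v:{..<0}|lborel. q v) = (LINT v:{..<x}|lborel. q v) + (LINT v:{x..<0}|lborel. q v)"
    proof -
      have "{..<0} = {..<x} \<union> {x..<0}" "{..<x} \<inter> {x..<0} = {}" using x by auto
      thus ?thesis using set_integral_Un[of "{..<x}" "{x..<0}" lborel q] iq ix by auto
    qed
    have e6: "(LINT v:{..<y}|lborel. q v) = (LINT v:{..y}|lborel. q v)" for y
      unfolding set_lebesgue_integral_def
      by (rule integral_cong_AE)
         (use AE_lborel_singleton[of y] in \<open>auto simp: indicator_def elim!: eventually_mono\<close>)
    show ?thesis using e1 e2 e3 e4 e5 e6[of 0] e6[of x] by (simp add: algebra_simps)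
  qed
  show ?thesis
  proof (rule that[of B0 B1])
    fix \<epsilon> :: real assume \<epsilon>: "0 < \<epsilon>" "\<epsilon> < 1"
    obtain C where C: "\<And>v. norm (w v) \<le> C * exp (- \<epsilon> * v)" using dec[OF \<epsilon>(1)] by auto
    have Cn: "C \<ge> 0" using order.trans[OF norm_ge_zero C[of 0]] by simp
    have Tb: "norm (w (x + u) * q (x - u)) \<le> (C * K * exp ((1 - \<epsilon>) * x)) * exp (- (1 + \<epsilon>) * u)" for x u
    proof -
      have "norm (w (x + u) * q (x - u)) \<le> (C * exp (- \<epsilon> * (x + u))) * ((K * exp x) * exp (- 1 * u))"
        unfolding norm_mult by (intro mult_mono C qb) (use Cn in auto)
      also have "\<dots> = C * K * exp (- \<epsilon> * (x + u) + x + - 1 * u)" unfolding exp_add by (simp add: mult_ac)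
      also have "- \<epsilon> * (x + u) + x + - 1 * u = (1 - \<epsilon>) * x + - (1 + \<epsilon>) * u" by (simp add: algebra_simps)
      finally show ?thesis unfolding exp_add by (simp add: mult_ac)
    qed
    have "norm (autocorr w x - (B0 + B1 * of_real x)) \<le> (norm \<alpha> * K + C * K / (1 + \<epsilon>)) * exp ((1 - \<epsilon>) * x)"
      if x: "x \<le> 0" for x
    proof -
      have Ti: "set_integrable lborel {0..} (\<lambda>u. w (x + u) * q (x - u))"
        by (rule set_integrable_exp_bound[OF _ _ Tb]) (use \<epsilon> in auto)
      have "autocorr w x = (LINT u:{0..}|lborel. w (x + u) * w (x - u))"
        by (rule autocorr_half_line, rule autocorr_decay(1)[OF assms(1) dec zero_less_one])
      also have "\<dots> = (LINT u:{0..}|lborel. \<alpha> * w (x + u) + w (x + u) * q (x - u))"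
        by (simp add: q_def algebra_simps)
      also have "\<dots> = \<alpha> * (LINT u:{0..}|lborel. w (x + u)) + T x"
        unfolding T_def using wx[of x] Ti by (subst set_integral_add) auto
      finally have "autocorr w x - (B0 + B1 * of_real x) = - (\<alpha> * (LINT u:{0..}|lborel. q (x - u))) + T x"
        unfolding main[OF x] B0_def B1_def affine(1)[of x] by (simp add: algebra_simps)
      also have "norm \<dots> \<le> norm \<alpha> * norm (LINT u:{0..}|lborel. q (x - u)) + norm (T x)"
        using norm_triangle_ineq[of "- (\<alpha> * (LINT u:{0..}|lborel. q (x - u)))" "T x"] by (simp add: norm_mult)
      also have "\<dots> \<le> norm \<alpha> * (K * exp x / 1) + C * K * exp ((1 - \<epsilon>) * x) / (1 + \<epsilon>)"
        unfolding T_def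
        by (intro add_mono mult_left_mono norm_set_integral_exp_bound qb Tb) (use \<epsilon> in auto)
      also have "exp x \<le> exp ((1 - \<epsilon>) * x)" using x \<epsilon> by (simp add: algebra_simps mult_nonneg_nonpos)
      hence "norm \<alpha> * (K * exp x / 1) \<le> norm \<alpha> * (K * exp ((1 - \<epsilon>) * x) / 1)"
        using K by (intro mult_left_mono divide_right_mono) auto
      finally show ?thesis by (simp add: algebra_simps)
    qed
    thus "\<exists>C. \<forall>x\<le>0. norm (autocorr w x - (B0 + B1 * of_real x)) \<le> C * exp ((1 - \<epsilon>) * x)" by blast
  qed
qed


section \<open>Mellin transforms folded at the origin\<close>

text \<open>
  The integral of \<open>exp ((s-1)x) R(x)\<close> over the line, folded at 0, with the leading behaviour of
  \<open>R\<close> at \<open>-\<infinity>\<close> removed. In the variable \<open>t = exp (2x)\<close> it is,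
  up to a factor 2, the integral over \<open>t \<ge> 1\<close> of the final formula.
\<close>
definition folded_mellin :: "(real \<Rightarrow> complex) \<Rightarrow> complex \<Rightarrow> complex \<Rightarrow> complex \<Rightarrow> complex" where
  "folded_mellin R B0 B1 s =
     (LINT x:{0..}|lborel. exp (- (1 - s) * of_real x) * R x)
     + (LINT x:{0..}|lborel. exp (- (s - 1) * of_real x) * (R (- x) - (B0 - B1 * of_real x)))"

text \<open>
  Rapid decay at \<open>\<infinity>\<close> together with the expansion \<open>B0 + B1 x\<close> at
  \<open>-\<infinity>\<close>, up to an error that is \<open>exp ((1-\<epsilon>)x)\<close> for every
  \<open>\<epsilon>\<close>. The linear expansion is what produces a double pole at \<open>s = 1\<close>; the
  error term is what moves the boundary of convergence from \<open>Re s = 1\<close> to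
  \<open>Re s = 0\<close>.
\<close>
locale log_pole_decay =
  fixes R :: "real \<Rightarrow> complex" and B0 B1 :: complex
  assumes measurable [measurable]: "R \<in> borel_measurable borel"
    and decay: "\<And>k. k > 0 \<Longrightarrow> \<exists>C. \<forall>x. norm (R x) \<le> C * exp (- k * x)"
    and asymptotic: "\<And>\<epsilon>. 0 < \<epsilon> \<Longrightarrow> \<epsilon> < 1 \<Longrightarrow> \<exists>C. \<forall>x\<le>0. norm (R x - (B0 + B1 * of_real x)) \<le> C * exp ((1 - \<epsilon>) * x)"

begin

lemma asymptotic':
  assumes "0 < \<epsilon>" "\<epsilon> < 1"
  shows "\<exists>C. \<forall>x\<ge>0. norm (R (- x) - (B0 - B1 * of_real x)) \<le> C * exp ((\<epsilon> - 1) * x)"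
proof -
  obtain C where C: "\<And>x. x \<le> 0 \<Longrightarrow> norm (R x - (B0 + B1 * of_real x)) \<le> C * exp ((1 - \<epsilon>) * x)"
    using asymptotic[OF assms] by blast
  have "norm (R (- x) - (B0 - B1 * of_real x)) \<le> C * exp ((\<epsilon> - 1) * x)" if "x \<ge> 0" for x
    using C[of "- x"] that by (simp add: algebra_simps)
  thus ?thesis by blast
qed

lemma folded_mellin_integrable:
  assumes s: "Re s > 0"
  shows "set_integrable lborel {0..} (\<lambda>x. exp (- (1 - s) * of_real x) * R x)"
    and "set_integrable lborel {0..} (\<lambda>x. exp (- (s - 1) * of_real x) * (R (- x) - (B0 - B1 * of_real x)))"
proof -
  obtain C where C: "\<And>x. norm (R x) \<le> C * exp (- Re s * x)" using decay[OF s] by blast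
  show "set_integrable lborel {0..} (\<lambda>x. exp (- (1 - s) * of_real x) * R x)"
  proof (rule set_integrable_exp_bound[of _ 1 C])
    fix x :: real
    have "norm (exp (- (1 - s) * of_real x) * R x) = exp (- (1 - Re s) * x) * norm (R x)" by (simp add: norm_mult)
    also have "\<dots> \<le> exp (- (1 - Re s) * x) * (C * exp (- Re s * x))" by (intro mult_left_mono C) auto
    also have "\<dots> = C * exp (- (1 - Re s) * x + - Re s * x)" unfolding exp_add by simp
    finally show "norm (exp (- (1 - s) * of_real x) * R x) \<le> C * exp (- 1 * x)" by (simp add: algebra_simps)
  qed auto
  \<comment> \<open>Small enough to lie below both \<open>Re s\<close> and 1.\<close>
  define \<epsilon> where "\<epsilon> = min (Re s / 2) (1 / 2)"
  have e: "0 < \<epsilon>" "\<epsilon> < 1" "\<epsilon> < Re s" using s by (auto simp: \<epsilon>_def)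
  obtain C' where C': "\<And>x. x \<ge> 0 \<Longrightarrow> norm (R (- x) - (B0 - B1 * of_real x)) \<le> C' * exp ((\<epsilon> - 1) * x)"
    using asymptotic'[OF e(1,2)] by blast
  show "set_integrable lborel {0..} (\<lambda>x. exp (- (s - 1) * of_real x) * (R (- x) - (B0 - B1 * of_real x)))"
  proof (rule set_integrable_exp_bound[of _ "Re s - \<epsilon>" C'])
    fix x :: real assume x: "x \<ge> 0"
    have "norm (exp (- (s - 1) * of_real x) * (R (- x) - (B0 - B1 * of_real x))) = exp (- (Re s - 1) * x) * norm (R (- x) - (B0 - B1 * of_real x))"
      by (simp add: norm_mult)
    also have "\<dots> \<le> exp (- (Re s - 1) * x) * (C' * exp ((\<epsilon> - 1) * x))" by (intro mult_left_mono C' x) auto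
    also have "\<dots> = C' * exp (- (Re s - 1) * x + (\<epsilon> - 1) * x)" unfolding exp_add by simp
    finally show "norm (exp (- (s - 1) * of_real x) * (R (- x) - (B0 - B1 * of_real x))) \<le> C' * exp (- (Re s - \<epsilon>) * x)"
      by (simp add: algebra_simps)
  qed (use e in auto)
qed

text \<open>
  Both halves are Laplace transforms, at \<open>1 - s\<close> and at \<open>s - 1\<close>. Given
  \<open>\<epsilon>\<close>, the decay hypotheses cover the strip
  \<open>\<epsilon> < Re s < 1/\<epsilon>\<close>, and these strips exhaust the half-plane.
\<close>
lemma folded_mellin_holomorphic: "folded_mellin R B0 B1 holomorphic_on {s. Re s > 0}"
proof -
  have "folded_mellin R B0 B1 holomorphic_on {s. \<epsilon> < Re s \<and> Re s < 1 / \<epsilon>}" if e: "0 < \<epsilon>" "\<epsilon> < 1" for \<epsilon>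
  proof -
    obtain C where C: "\<And>x. norm (R x) \<le> C * exp (- (1 / \<epsilon>) * x)" using decay[of "1 / \<epsilon>"] e by auto
    obtain C' where C': "\<And>x. x \<ge> 0 \<Longrightarrow> norm (R (- x) - (B0 - B1 * of_real x)) \<le> C' * exp ((\<epsilon> - 1) * x)"
      using asymptotic'[OF e] by blast
    have h1: "(\<lambda>s. LINT x:{0..}|lborel. exp (- s * of_real x) * R x) holomorphic_on {s. Re s > - (1 / \<epsilon>)}"
      by (rule laplace_holomorphic[OF _ C]) auto
    have h2: "(\<lambda>s. LINT x:{0..}|lborel. exp (- s * of_real x) * (R (- x) - (B0 - B1 * of_real x))) holomorphic_on {s. Re s > \<epsilon> - 1}"
      by (rule laplace_holomorphic[OF _ C']) auto
    show ?thesis unfolding folded_mellin_def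
    proof (intro holomorphic_on_add)
      show "(\<lambda>s. LINT x:{0..}|lborel. exp (- (1 - s) * of_real x) * R x) holomorphic_on {s. \<epsilon> < Re s \<and> Re s < 1 / \<epsilon>}"
        by (rule holomorphic_on_compose_gen[OF _ h1, of "\<lambda>s. 1 - s", unfolded o_def])
           (auto intro!: holomorphic_intros)
      show "(\<lambda>s. LINT x:{0..}|lborel. exp (- (s - 1) * of_real x) * (R (- x) - (B0 - B1 * of_real x))) holomorphic_on {s. \<epsilon> < Re s \<and> Re s < 1 / \<epsilon>}"
        by (rule holomorphic_on_compose_gen[OF _ h2, of "\<lambda>s. s - 1", unfolded o_def])
           (auto intro!: holomorphic_intros)
    qed
  qed
  hence "folded_mellin R B0 B1 holomorphic_on (\<Union>\<epsilon>\<in>{0<..<1}. {s. \<epsilon> < Re s \<and> Re s < 1 / \<epsilon>})"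
    by (intro holomorphic_on_UN_open)
       (auto intro: open_Int[OF open_halfspace_Re_gt open_halfspace_Re_lt, unfolded Int_def, simplified])
  also have "(\<Union>\<epsilon>\<in>{0<..<1}. {s. \<epsilon> < Re s \<and> Re s < 1 / \<epsilon>}) = {s. Re s > 0}"
  proof (intro set_eqI iffI)
    fix s :: complex assume "s \<in> {s. Re s > 0}"
    hence s: "Re s > 0" by simp
    define \<epsilon> where "\<epsilon> = min (Re s / 2) (1 / (Re s + 1))"
    have e: "\<epsilon> > 0" "\<epsilon> < Re s" "\<epsilon> \<le> 1 / (Re s + 1)" using s by (auto simp: \<epsilon>_def)
    have "1 / (Re s + 1) < 1" using s by (simp add: field_simps)
    hence "\<epsilon> < 1" using e by linarith
    have "\<epsilon> * (Re s + 1) \<le> 1" using e s by (simp add: field_simps)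
    hence "Re s * \<epsilon> < 1" using e by (simp add: algebra_simps)
    hence "Re s < 1 / \<epsilon>" using e by (simp add: field_simps)
    with e \<open>\<epsilon> < 1\<close> show "s \<in> (\<Union>\<epsilon>\<in>{0<..<1}. {s. \<epsilon> < Re s \<and> Re s < 1 / \<epsilon>})" by auto
  qed auto
  finally show ?thesis .
qed

text \<open>
  For \<open>\<sigma> > 1\<close> the subtracted part \<open>B0 - B1 x\<close> may be integrated separately
  against \<open>exp (-(\<sigma>-1)x)\<close>.
\<close>
lemma mellin_eq_folded:
  assumes \<sigma>: "\<sigma> > 1" and I: "integrable lborel (\<lambda>x. of_real (exp ((\<sigma> - 1) * x)) * R x)"
  shows "(LINT x|lborel. of_real (exp ((\<sigma> - 1) * x)) * R x) =
           folded_mellin R B0 B1 (of_real \<sigma>) + B0 / (of_real \<sigma> - 1) - B1 / (of_real \<sigma> - 1) ^ 2"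
proof -
  define a where "a = \<sigma> - 1"
  have a: "a > 0" using \<sigma> by (simp add: a_def)
  have e: "exp (- (1 - of_real \<sigma>) * complex_of_real x) = of_real (exp ((\<sigma> - 1) * x))"
       "exp (- (of_real \<sigma> - 1) * complex_of_real x) = of_real (exp (- a * x))" for x
    by (simp_all add: a_def flip: exp_of_real)
  have s: "Re (complex_of_real \<sigma>) > 0" using \<sigma> by simp
  note FI = folded_mellin_integrable[OF s, unfolded e]
  have i0: "set_integrable lborel {0..} (\<lambda>x. complex_of_real (exp (- a * x)))"
    using integrable_exp_decay(1)[OF a] unfolding set_integrable_def by (simp add: scaleR_conv_of_real flip: of_real_mult)
  have l0: "(LINT x:{0..}|lborel. complex_of_real (exp (- a * x))) = 1 / of_real a"
    using integrable_exp_decay(2)[OF a] set_integral_complex_of_real[of lborel "{0..}" "\<lambda>x. exp (- a * x)"] by simp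
  have "(LINT x:{0..}|lborel. of_real (exp ((\<sigma> - 1) * (- x))) * R (- x)) =
        (LINT x:{0..}|lborel. of_real (exp (- a * x)) * (R (- x) - (B0 - B1 * of_real x)) + (B0 * of_real (exp (- a * x)) - B1 * (of_real x * of_real (exp (- a * x)))))"
    by (simp add: a_def algebra_simps)
  also have "\<dots> = (LINT x:{0..}|lborel. of_real (exp (- a * x)) * (R (- x) - (B0 - B1 * of_real x))) +
       (B0 * (1 / of_real a) - B1 * (1 / of_real a ^ 2))"
    using FI(2) i0 integral_x_exp_decay(1)[OF a]
    by (subst set_integral_add(2)) (auto simp: set_integral_diff(2) l0[simplified] integral_x_exp_decay(2)[OF a, simplified] intro!: set_integral_diff(1))
  finally have "(LINT x|lborel. of_real (exp ((\<sigma> - 1) * x)) * R x) = (LINT x:{0..}|lborel. of_real (exp ((\<sigma> - 1) * x)) * R x)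
     + ((LINT x:{0..}|lborel. of_real (exp (- a * x)) * (R (- x) - (B0 - B1 * of_real x))) + (B0 * (1 / of_real a) - B1 * (1 / of_real a ^ 2)))"
    using integral_split_at_0[OF I] by simp
  thus ?thesis unfolding folded_mellin_def e by (simp add: a_def)
qed

end


section \<open>The zeta function and the Euler factor near 1\<close>

text \<open>
  This is \<open>(s - 1) \<zeta>(s)\<close> without the singularity at 1. The series collects the remainders in
  the first-order expansions of the powers \<open>(n + 2)^(1-s)\<close> about \<open>n + 1\<close>.
\<close>
definition zeta_reg :: "complex \<Rightarrow> complex" where
  "zeta_reg s = 1 + (\<Sum>n. zeta_rem 1 s n)"

lemma zeta_reg_holomorphic: "zeta_reg holomorphic_on {s. Re s > 0}"
proof -
  have "(\<lambda>s. 1 + (\<Sum>n. zeta_rem 1 s n)) holomorphic_on {s. Re s + real 1 > 1}"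
    by (intro holomorphic_intros holomorphic_suminf_zeta_rem)
  thus ?thesis unfolding zeta_reg_def[abs_def] by (rule holomorphic_on_subset) auto
qed

lemma zeta_eq_suminf:
  assumes "Re s > 1"
  shows "zeta s = zeta_series s"
proof -
  have "(\<lambda>n. 1 / of_nat (Suc n) powr s) sums zeta s"
    using is_zeta_zeta assms by (simp add: is_zeta_def)
  thus ?thesis unfolding zeta_series_def by (simp add: sums_iff powr_minus divide_inverse)
qed

lemma zeta_reg_eq:
  assumes s: "Re s > 0" "s \<noteq> 1"
  shows "zeta_reg s = (s - 1) * zeta s"
proof (rule analytic_continuation_open[of "{s. Re s > 1}" "{s. Re s > 0} - {1}" zeta_reg "\<lambda>s. (s - 1) * zeta s"])
  show "connected ({s. Re s > 0} - {1 :: complex})"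
    by (intro connected_open_delete convex_connected convex_halfspace_Re_gt open_halfspace_Re_gt) simp
  show "{s. Re s > 1} \<noteq> {}" by (auto intro!: exI[of _ 2])
  show "zeta_reg holomorphic_on {s. Re s > 0} - {1}"
    by (rule holomorphic_on_subset[OF zeta_reg_holomorphic]) auto
  have "zeta holomorphic_on {s. Re s > 0} - {1}"
    by (rule holomorphic_on_subset[of _ "- {1}"]) (use is_zeta_zeta in \<open>auto simp: is_zeta_def\<close>)
  thus "(\<lambda>s. (s - 1) * zeta s) holomorphic_on {s. Re s > 0} - {1}" by (intro holomorphic_intros)
  show "zeta_reg z = (z - 1) * zeta z" if "z \<in> {s. Re s > 1}" for z
    using that zeta_series_recurrence[of z 0] zeta_eq_suminf[of z] by (simp add: zeta_reg_def algebra_simps)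
qed (use s in \<open>auto intro: open_halfspace_Re_gt open_delete\<close>)

text \<open>
  Differentiating the series termwise at 1 gives \<open>1/(n+1) + ln (n+1) - ln (n+2)\<close>, the series
  that defines Euler's constant.
\<close>
lemma zeta_reg_at_1:
  shows "zeta_reg 1 = 1" and "(zeta_reg has_field_derivative of_real euler_mascheroni) (at 1)"
proof -
  have "zeta_rem 1 1 n = 0" for n
    by (simp add: zeta_rem_def falling_def del: of_nat_Suc of_nat_add)
  thus "zeta_reg 1 = 1" by (simp add: zeta_reg_def)
  define f' where "f' = (\<lambda>n s. - of_real (ln (real (n + 2))) * of_nat (n + 2) powr (1 - s)
     + of_real (ln (real (n + 1))) * of_nat (n + 1) powr (1 - s)
     + of_nat (n + 1) powr (- s) + (1 - s) * of_real (ln (real (n + 1))) * of_nat (n + 1) powr (- s) :: complex)"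
  have zr: "zeta_rem 1 s n = of_nat (n + 2) powr (1 - s) - of_nat (n + 1) powr (1 - s) - (1 - s) * of_nat (n + 1) powr (- s)" for s n
  proof -
    have "(\<Sum>j\<le>1. falling j s / fact j * X powr (1 - s - of_nat j)) = X powr (1 - s) + (1 - s) * X powr (- s)"
      for X :: complex by (simp add: falling_def)
    thus ?thesis unfolding zeta_rem_def by (simp only: diff_diff_eq)
  qed
  have dp: "((\<lambda>s. of_nat (Suc m) powr (g s)) has_field_derivative g' * of_real (ln (real (Suc m))) * of_nat (Suc m) powr (g s)) (at s)"
    if "(g has_field_derivative g') (at s)" for m g g' and s :: complex
  proof -
    have "((\<lambda>s. exp (g s * of_real (ln (real (Suc m))))) has_field_derivative exp (g s * of_real (ln (real (Suc m)))) * (g' * of_real (ln (real (Suc m))))) (at s)"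
      by (rule derivative_eq_intros that refl)+ simp
    moreover have "of_nat (Suc m) powr z = exp (z * of_real (ln (real (Suc m))))" for z :: complex
      by (simp add: powr_def Ln_of_nat del: of_nat_Suc)
    ultimately show ?thesis by (simp add: mult_ac del: of_nat_Suc)
  qed
  have d: "((\<lambda>s. zeta_rem 1 s n) has_field_derivative f' n s) (at s)" for n s
  proof -
    have a: "((\<lambda>s::complex. 1 - s) has_field_derivative -1) (at s)" "((\<lambda>s::complex. - s) has_field_derivative -1) (at s)"
      by (auto intro!: derivative_eq_intros)
    have e: "n + 2 = Suc (Suc n)" "n + 1 = Suc n" by simp_all
    show ?thesis unfolding zr f'_def e
      by (rule derivative_eq_intros dp a refl)+ (simp add: algebra_simps del: of_nat_Suc)
  qed
  have maj: "\<exists>d h. 0 < d \<and> summable h \<and> (\<forall>\<^sub>F n in sequentially. \<forall>y\<in>ball x d \<inter> {s. Re s > 0}. norm (zeta_rem 1 y n) \<le> h n)"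
    if "x \<in> {s. Re s > 0}" for x
  proof -
    have "Re x + real 1 > 1" using that by simp
    from zeta_rem_majorant[OF this] obtain d M where dM: "d > 0" "summable M"
      "\<And>n s. s \<in> cball x d \<Longrightarrow> Re s + real 1 > 1 \<and> norm (zeta_rem 1 s n) \<le> M n" by metis
    thus ?thesis by (intro exI[of _ d] exI[of _ M]) auto
  qed
  obtain g g' where g: "\<And>x. Re x > 0 \<Longrightarrow> (\<lambda>n. zeta_rem 1 x n) sums g x" "\<And>x. Re x > 0 \<Longrightarrow> (\<lambda>n. f' n x) sums g' x"
       "\<And>x. Re x > 0 \<Longrightarrow> (g has_field_derivative g' x) (at x)"
    using series_and_derivative_comparison_local[OF open_halfspace_Re_gt[of 0] d maj] by auto
  have "f' n 1 = inverse (of_nat (n+1)) + of_real (ln (of_nat (n+1))) - of_real (ln (of_nat (n+2)))" for n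
    by (simp add: f'_def powr_minus del: of_nat_Suc of_nat_add)
  hence "(\<lambda>n. f' n 1) sums of_real euler_mascheroni" using euler_mascheroni_sum[where 'a = complex] by (simp del: of_nat_add of_nat_Suc)
  hence "g' 1 = of_real euler_mascheroni" using g(2)[of 1] by (simp add: sums_iff)
  hence D: "((\<lambda>s. 1 + g s) has_field_derivative of_real euler_mascheroni) (at 1)"
    using DERIV_add[OF DERIV_const g(3)[of 1]] by simp
  show "(zeta_reg has_field_derivative of_real euler_mascheroni) (at 1)"
  proof (rule has_field_derivative_transform_within_open[OF D open_halfspace_Re_gt[of 0]])
    show "1 + g s = zeta_reg s" if "s \<in> {s. 0 < Re s}" for s
      using g(1)[of s] that by (simp add: zeta_reg_def sums_iff)
  qed auto
qed

definition euler_factor :: "nat set \<Rightarrow> complex \<Rightarrow> complex" where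
  "euler_factor P s = (\<Prod>p\<in>P. 1 - 1 / of_nat p powr s)"

context
  fixes P :: "nat set"
  assumes P: "finite P" "\<And>p. p \<in> P \<Longrightarrow> prime p"

begin

lemma prod_primes_pos: "\<Prod>P > 0"
  using P by (intro prod_pos) (auto simp: prime_gt_0_nat)

text \<open>
  Expanding the product into a finite Dirichlet polynomial makes its derivative at 1 a sum over divisors, the form
  in which it occurs in the formula.
\<close>
lemma euler_factor_moebius: "euler_factor P s = moebius_sum (\<Prod>P) (\<lambda>n. of_nat n powr (- s))"
proof -
  have "moebius_sum (\<Prod>P) (\<lambda>n. of_nat n powr (- s)) = (\<Prod>p\<in>P. 1 - of_nat p powr (- s))"
    by (rule moebius_sum_multiplicative[OF P]) (auto intro: of_nat_powr_mult simp del: of_nat_mult)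
  thus ?thesis by (simp add: euler_factor_def powr_minus divide_inverse)
qed

lemma euler_factor_derivative:
  "(euler_factor P has_field_derivative - moebius_sum (\<Prod>P) (\<lambda>n. of_real (ln (real n)) * of_nat n powr (- s))) (at s)"
proof -
  have "((\<lambda>s. moebius_sum (\<Prod>P) (\<lambda>n. of_nat n powr (- s))) has_field_derivative
          (\<Sum>n | n dvd \<Prod>P. of_int (moebius_mu n) * (- of_real (ln (real n)) * of_nat n powr (- s)))) (at s)"
    unfolding moebius_sum_def
  proof (intro DERIV_sum DERIV_cmult)
    fix n assume "n \<in> {n. n dvd \<Prod>P}"
    hence n: "n > 0" using prod_primes_pos by (auto dest: dvd_pos_nat)
    have e: "of_nat n powr (- z) = exp (- z * of_real (ln (real n)))" for z :: complex
      using n by (simp add: powr_def Ln_of_nat)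
    show "((\<lambda>s. of_nat n powr (- s)) has_field_derivative - of_real (ln (real n)) * of_nat n powr (- s)) (at s)"
      unfolding e by (auto intro!: derivative_eq_intros)
  qed
  thus ?thesis unfolding euler_factor_moebius[abs_def] by (simp add: moebius_sum_def sum_negf)
qed

lemma euler_factor_holomorphic: "euler_factor P holomorphic_on S"
  using euler_factor_derivative unfolding holomorphic_on_def field_differentiable_def
  by (blast intro: has_field_derivative_at_within)

text \<open>
  The sieve turns the restricted series into the Moebius sum of \<open>n^(-s) \<zeta>(s)\<close>.
\<close>
lemma coprime_dirichlet_series:
  assumes s: "Re s > 1"
  shows "infsum (\<lambda>a. of_nat a powr (- s)) {a. a \<ge> 1 \<and> coprime a (\<Prod>P)} = zeta s * euler_factor P s"
proof -
  define e where "e = (\<lambda>a::nat. of_nat a powr (- s) :: complex)"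
  have "summable (\<lambda>n. real (n + 1) powr - Re s)" by (rule summable_real_Suc_powr) fact
  hence S: "summable (\<lambda>n. norm (if Suc n \<in> {1..} then e (Suc n) else 0))"
    by (rule back_subst[of summable]) (auto simp: e_def norm_powr_real_powr simp del: of_nat_Suc)
  have z: "0 \<notin> {1::nat..}" by simp
  have "infsum e {1..} = zeta s"
    using infsum_positive_nat(2)[OF z S] zeta_eq_suminf[OF s] by (simp add: e_def zeta_series_def)
  have "infsum e {a. a \<ge> 1 \<and> coprime a (\<Prod>P)} = moebius_sum (\<Prod>P) (\<lambda>n. infsum (\<lambda>k. e (n * k)) {1..})"
    by (rule infsum_coprime[OF P]) (use infsum_positive_nat(1)[OF z S] in simp_all)
  also have "\<dots> = moebius_sum (\<Prod>P) (\<lambda>n. zeta s * of_nat n powr (- s))"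
  proof (rule moebius_sum_cong)
    fix n assume "n dvd \<Prod>P"
    hence n: "n > 0" using prod_primes_pos by (auto dest: dvd_pos_nat)
    have "infsum (\<lambda>k. e (n * k)) {1..} = infsum (\<lambda>k. of_nat n powr (- s) * e k) {1..}"
      by (rule infsum_cong) (use n in \<open>auto simp: e_def of_nat_powr_mult simp del: of_nat_mult\<close>)
    also have "\<dots> = of_nat n powr (- s) * infsum e {1..}" by (rule infsum_cmult_right')
    finally show "infsum (\<lambda>k. e (n * k)) {1..} = zeta s * of_nat n powr (- s)"
      using \<open>infsum e {1..} = zeta s\<close> by simp
  qed
  also have "\<dots> = zeta s * euler_factor P s"
    by (simp add: euler_factor_moebius moebius_sum_def sum_distrib_left mult_ac)
  finally show "infsum (\<lambda>a. of_nat a powr (- s)) {a. a \<ge> 1 \<and> coprime a (\<Prod>P)} = zeta s * euler_factor P s"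
    by (simp add: e_def)
qed

end


section \<open>The Bessel sum over integers coprime to the primes\<close>

text \<open>
  The weight \<open>exp (v/2)\<close> compensates the growth \<open>y^(-1/2)\<close> of the theta sum at the
  origin, so that the function has a finite limit at \<open>-\<infinity>\<close>.
\<close>
definition weighted_theta :: "nat set \<Rightarrow> complex \<Rightarrow> real \<Rightarrow> complex" where
  "weighted_theta X c v = of_real (exp (v / 2)) * theta_over X c (exp v)"

lemma weighted_theta_measurable [measurable]: "weighted_theta X c \<in> borel_measurable borel"
  unfolding weighted_theta_def by measurable

lemma weighted_theta_decay:
  assumes c: "Re c > 0" and k: "k > 0"
  shows "\<exists>C. \<forall>v. norm (weighted_theta X c v) \<le> C * exp (- k * v)"
proof -
  have "k + 1/2 > 1/2" using k by simp
  then show ?thesis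
  proof (rule theta_over_bound[OF c])
    fix C assume C: "\<And>X y. y > 0 \<Longrightarrow> norm (theta_over X c y) \<le> C * y powr (- (k + 1/2))"
    have "norm (weighted_theta X c v) \<le> C * exp (- k * v)" for v
    proof -
      have "norm (weighted_theta X c v) = exp (v / 2) * norm (theta_over X c (exp v))"
        by (simp add: weighted_theta_def norm_mult)
      also have "\<dots> \<le> exp (v / 2) * (C * exp v powr (- (k + 1/2)))" by (intro mult_left_mono C) auto
      also have "\<dots> = C * exp (v / 2 + - (k + 1/2) * v)" unfolding exp_add by (simp add: powr_def)
      also have "v / 2 + - (k + 1/2) * v = - k * v" by (simp add: field_simps)
      finally show ?thesis .
    qed
    thus ?thesis by blast
  qed
qed

lemma autocorr_weighted_theta:
  "autocorr (weighted_theta X c) x =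
     of_real (exp x) * (LINT u|lborel. theta_over X c (exp x * exp u) * theta_over X c (exp x * exp (- u))) / 2"
proof -
  have "weighted_theta X c (x + u) * weighted_theta X c (x - u) =
      of_real (exp x) * (theta_over X c (exp x * exp u) * theta_over X c (exp x * exp (- u)))" for u
  proof -
    have "exp ((x + u) / 2) * exp ((x - u) / 2) = exp x" unfolding exp_add[symmetric] by (simp add: field_simps)
    hence "complex_of_real (exp ((x + u) / 2)) * of_real (exp ((x - u) / 2)) = of_real (exp x)"
      by (simp only: of_real_mult[symmetric])
    moreover have "exp (x + u) = exp x * exp u" "exp (x - u) = exp x * exp (- u)"
      by (simp_all add: exp_add exp_diff exp_minus field_simps)
    ultimately show ?thesis unfolding weighted_theta_def by (metis (no_types) mult.assoc mult.left_commute)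
  qed
  thus ?thesis by (simp add: autocorr_def)
qed

text \<open>
  The exponential weight factors along with the autocorrelation, because \<open>(\<sigma> - 1) x\<close> is the
  mean of its values at \<open>x + u\<close> and \<open>x - u\<close>; the two-sided Laplace transform is
  therefore a square.
\<close>
lemma autocorr_weighted_theta_mellin:
  fixes X :: "nat set" and c :: complex and \<sigma> :: real
  assumes c: "Re c > 0" and \<sigma>: "\<sigma> > 2"
  defines "M \<equiv> Gamma (of_real \<sigma> / 2) * c powr (- (of_real \<sigma> / 2)) * (\<Sum>n. if Suc n \<in> X then of_nat (Suc n) powr (- of_real \<sigma>) else 0)"
  shows "integrable lborel (\<lambda>x. of_real (exp ((\<sigma> - 1) * x)) * autocorr (weighted_theta X c) x)"
    and "(LINT x|lborel. of_real (exp ((\<sigma> - 1) * x)) * autocorr (weighted_theta X c) x) = M ^ 2 / 4"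
proof -
  define p where "p = \<sigma> / 2"
  have p: "p > 1" using \<sigma> by (simp add: p_def)
  define V where "V = (\<lambda>v. complex_of_real (exp (p * v)) * theta_over X c (exp v))"
  note mel = theta_over_mellin[OF c p, of X, folded V_def]
  have VV: "V (x + u) * V (x - u) = of_real (exp ((\<sigma> - 1) * x)) * (weighted_theta X c (x + u) * weighted_theta X c (x - u))" for x u
  proof -
    have 1: "V v = of_real (exp ((\<sigma> - 1) / 2 * v)) * weighted_theta X c v" for v
      unfolding V_def weighted_theta_def p_def mult.assoc[symmetric] of_real_mult[symmetric] exp_add[symmetric]
      by (simp add: field_simps)
    have "exp ((\<sigma> - 1) / 2 * (x + u)) * exp ((\<sigma> - 1) / 2 * (x - u)) = exp ((\<sigma> - 1) * x)"
      unfolding exp_add[symmetric] by (simp add: field_simps)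
    hence 2: "complex_of_real (exp ((\<sigma> - 1) / 2 * (x + u))) * of_real (exp ((\<sigma> - 1) / 2 * (x - u))) = of_real (exp ((\<sigma> - 1) * x))"
      by (simp only: of_real_mult[symmetric])
    show ?thesis unfolding 1 2[symmetric] by (simp only: mult_ac)
  qed
  have eq: "of_real (exp ((\<sigma> - 1) * x)) * autocorr (weighted_theta X c) x = (LINT u|lborel. V (x + u) * V (x - u)) / 2" for x
    unfolding VV autocorr_def by simp
  show "integrable lborel (\<lambda>x. of_real (exp ((\<sigma> - 1) * x)) * autocorr (weighted_theta X c) x)"
    unfolding eq using integral_autocorrelation(1)[OF mel(1)] by simp
  have e: "2 * complex_of_real p = of_real \<sigma>" "complex_of_real p = of_real \<sigma> / 2" by (simp_all add: p_def)
  have "integral\<^sup>L lborel V = M" unfolding mel(2) M_def e(1) unfolding e(2) ..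
  thus "(LINT x|lborel. of_real (exp ((\<sigma> - 1) * x)) * autocorr (weighted_theta X c) x) = M ^ 2 / 4"
    unfolding eq integral_divide_zero integral_autocorrelation(2)[OF mel(1)] by simp
qed

text \<open>
  The sieve writes the theta sum as a Moebius sum of full theta sums at \<open>n\<^sup>2 y\<close>. Their
  constant terms \<open>-1/2\<close> cancel since
  \<open>\<Sum> \<mu>(n) = (\<Prod>p\<in>P. 1 - 1) = 0\<close> for nonempty \<open>P\<close>; their
  leading terms combine to \<open>\<alpha>\<close> times \<open>y^(-1/2)\<close>.
\<close>
lemma weighted_theta_coprime_limit:
  assumes P: "finite P" "\<And>p. p \<in> P \<Longrightarrow> prime p" "P \<noteq> {}" and c: "Re c > 0"
  obtains \<alpha> K where "\<And>v. norm (weighted_theta {a. a \<ge> 1 \<and> coprime a (\<Prod>P)} c v - \<alpha>) \<le> K * exp v"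
proof -
  define N where "N = \<Prod>P"
  define X where "X = {a. a \<ge> 1 \<and> coprime a N}"
  have N: "N > 0" unfolding N_def using P(1,2) by (rule prod_primes_pos)
  obtain g0 K where K: "K \<ge> 0"
    "\<And>y. y > 0 \<Longrightarrow> norm (theta_over {1..} c y - (g0 / of_real (sqrt y) - 1 / 2)) \<le> K * sqrt y"
    by (rule theta_trapezoid[OF c]) blast
  have mu0: "moebius_sum N (\<lambda>n. - 1 / 2) = 0"
  proof -
    have "moebius_sum N (\<lambda>n. 1) = (\<Prod>p\<in>P. 1 - 1)" unfolding N_def
      by (rule moebius_sum_multiplicative[OF P(1,2)]) auto
    also have "\<dots> = 0" using P(1,3) by (simp add: card_gt_0_iff)
    finally show ?thesis unfolding moebius_sum_def sum_distrib_right[symmetric] by simp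
  qed
  define \<alpha> where "\<alpha> = moebius_sum N (\<lambda>n. g0 / of_nat n)"
  define K' where "K' = (\<Sum>n | n dvd N. norm (of_int (moebius_mu n) :: complex) * (K * real n))"
  have th: "theta_over X c y = moebius_sum N (\<lambda>n. theta_over {1..} c (real n ^ 2 * y))" if y: "y > 0" for y
  proof -
    have z: "0 \<notin> {1::nat..}" "0 \<notin> X" by (simp_all add: X_def)
    have "theta_over X c y = infsum (\<lambda>a. exp (- c * of_nat a ^ 2 * of_real y)) X"
      using theta_over_infsum(2)[OF c y z(2)] by simp
    also have "\<dots> = moebius_sum N (\<lambda>n. infsum (\<lambda>k. exp (- c * of_nat (n * k) ^ 2 * of_real y)) {1..})"
      unfolding X_def N_def by (rule infsum_coprime[OF P(1,2)]) (use theta_over_infsum(1)[OF c y z(1)] in auto)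
    also have "\<dots> = moebius_sum N (\<lambda>n. theta_over {1..} c (real n ^ 2 * y))"
    proof (rule moebius_sum_cong)
      fix n assume "n dvd N"
      hence n: "n > 0" using N by (auto dest: dvd_pos_nat)
      have e: "- c * of_nat (n * k) ^ 2 * of_real y = - c * of_nat k ^ 2 * of_real (real n ^ 2 * y)" for k
        by (simp add: power_mult_distrib mult_ac)
      show "infsum (\<lambda>k. exp (- c * of_nat (n * k) ^ 2 * of_real y)) {1..} = theta_over {1..} c (real n ^ 2 * y)"
        unfolding e by (rule theta_over_infsum(2)[OF c _ z(1)]) (use n y in simp)
    qed
    finally show ?thesis .
  qed
  have "norm (weighted_theta X c v - \<alpha>) \<le> K' * exp v" for v
  proof -
    define y where "y = exp v"
    define r where "r = exp (v / 2)"
    have r: "r > 0" "r * r = y" "sqrt y = r" "y > 0"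
      by (simp_all add: r_def y_def exp_add[symmetric] real_sqrt_unique power2_eq_square)
    have wt: "weighted_theta X c v = of_real r * moebius_sum N (\<lambda>n. theta_over {1..} c (real n ^ 2 * y))"
      unfolding weighted_theta_def r_def[symmetric] y_def[symmetric] using th[OF r(4)] by simp
    have "weighted_theta X c v - \<alpha> = of_real r * moebius_sum N (\<lambda>n. theta_over {1..} c (real n ^ 2 * y)) - \<alpha> - of_real r * moebius_sum N (\<lambda>n. - 1 / 2)"
      unfolding wt mu0 by simp
    also have "\<dots> = (\<Sum>n | n dvd N. of_int (moebius_mu n) * (of_real r * (theta_over {1..} c (real n ^ 2 * y) - (g0 / of_real (real n * r) - 1 / 2))))"
      unfolding \<alpha>_def moebius_sum_def sum_distrib_left sum_subtractf[symmetric]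
    proof (intro sum.cong refl)
      fix n assume "n \<in> {n. n dvd N}"
      hence "n > 0" using N by (auto dest: dvd_pos_nat)
      thus "of_real r * (of_int (moebius_mu n) * theta_over {1..} c (real n ^ 2 * y)) - of_int (moebius_mu n) * (g0 / of_nat n) - of_real r * (of_int (moebius_mu n) * (- 1 / 2)) =
         of_int (moebius_mu n) * (of_real r * (theta_over {1..} c (real n ^ 2 * y) - (g0 / of_real (real n * r) - 1 / 2)))"
        using r(1) by (simp add: field_simps)
    qed
    also have "norm \<dots> \<le> (\<Sum>n | n dvd N. norm (of_int (moebius_mu n) :: complex) * (K * real n) * y)"
    proof (rule sum_norm_le)
      fix n assume "n \<in> {n. n dvd N}"
      hence n: "n > 0" using N by (auto dest: dvd_pos_nat)
      have sq: "sqrt (real n ^ 2 * y) = real n * r" using r by (simp add: real_sqrt_mult)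
      have "norm (of_real r * (theta_over {1..} c (real n ^ 2 * y) - (g0 / of_real (real n * r) - 1 / 2))) \<le> r * (K * (real n * r))"
        using K(2)[of "real n ^ 2 * y"] n r unfolding norm_mult sq by (intro mult_mono) auto
      also have "\<dots> = K * real n * y" using r(2) by (simp add: mult_ac)
      finally show "norm (of_int (moebius_mu n) * (of_real r * (theta_over {1..} c (real n ^ 2 * y) - (g0 / of_real (real n * r) - 1 / 2))))
          \<le> norm (of_int (moebius_mu n) :: complex) * (K * real n) * y"
        unfolding norm_mult[of "of_int (moebius_mu n)"] mult.assoc by (intro mult_left_mono) (auto simp: mult.assoc)
    qed
    also have "\<dots> = K' * exp v" unfolding K'_def y_def sum_distrib_right ..
    finally show ?thesis .
  qed
  thus ?thesis unfolding X_def N_def by (rule that)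
qed

definition bessel_coprime_term :: "complex \<Rightarrow> real \<Rightarrow> nat \<Rightarrow> complex" where
  "bessel_coprime_term c x n = of_nat (divisor_count n) * Bessel_K 0 (2 * (c * of_real (exp x) * of_nat n))"

text \<open>
  If \<open>n\<close> is coprime to \<open>N\<close> then so are all its divisors, and otherwise \<open>n\<close>
  has no factorisation into two numbers coprime to \<open>N\<close>; hence the number of factorisations is
  \<open>d(n)\<close> or 0. The set \<open>{1}\<close> has the single term \<open>n = 1\<close>, and subtracting
  it leaves the sum over \<open>n \<ge> 2\<close>.
\<close>
lemma coprime_Bessel_sum:
  fixes N :: nat
  assumes c: "Re c > 0"
  defines "X \<equiv> {a. a \<ge> 1 \<and> coprime a N}" and "D \<equiv> {n. n \<ge> 2 \<and> coprime n N}"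
  shows "bessel_coprime_term c x summable_on D"
    and "infsum (bessel_coprime_term c x) D =
           of_real (exp (- x)) * (autocorr (weighted_theta X c) x - autocorr (weighted_theta {1} c) x)"
    and "autocorr (weighted_theta {1} c) x = of_real (exp x) * Bessel_K 0 (2 * (c * of_real (exp x)))"
proof -
  have z: "0 \<notin> X" "0 \<notin> {1::nat}" by (simp_all add: X_def)
  have dX: "card (divisor_pairs X n) = (if n \<in> X then divisor_count n else 0)" for n
  proof (cases "n \<in> X")
    case True
    have "a \<in> X" if "a dvd n" for a
      using True that unfolding X_def by (auto intro: Suc_leI gr0I coprime_divisors[of a n N N])
    moreover have "n div a dvd n" if "a dvd n" for a using that by (metis dvd_div_mult_self dvd_triv_left)
    ultimately have "divisor_pairs X n = {k. k dvd n}" unfolding divisor_pairs_def by blast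
    thus ?thesis using True by (simp add: divisor_count_def)
  next
    case False
    have "divisor_pairs X n = {}"
    proof (rule equals0I)
      fix a assume a: "a \<in> divisor_pairs X n"
      then obtain b where b: "n = a * b" by (auto simp: divisor_pairs_def elim!: dvdE)
      have "a \<in> X" using a by (simp add: divisor_pairs_def)
      moreover from this have "n div a = b" using b by (simp add: X_def)
      hence "b \<in> X" using a by (simp add: divisor_pairs_def)
      ultimately have "coprime n N" "n \<noteq> 0" unfolding b by (auto simp: X_def)
      thus False using False by (simp add: X_def)
    qed
    thus ?thesis using False by simp
  qed
  have d1: "card (divisor_pairs {1} n) = (if n = 1 then 1 else 0)" for n
  proof -
    have "divisor_pairs {1} n = (if n = 1 then {1} else {})" by (auto simp: divisor_pairs_def)
    thus ?thesis by simp
  qed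
  note B = theta_autocorrelation_eq_Bessel_sum[OF c exp_gt_zero, of _ x]
  define S where "S = (\<lambda>X. LINT u|lborel. theta_over X c (exp x * exp u) * theta_over X c (exp x * exp (- u)))"
  have W: "autocorr (weighted_theta X c) x = of_real (exp x) * S X / 2" for X
    unfolding S_def by (rule autocorr_weighted_theta)
  define k where "k = (\<lambda>n::nat. Bessel_K 0 (2 * (c * of_real (exp x) * of_nat n)))"
  have s1: "(\<lambda>n. of_nat (card (divisor_pairs {1} n)) * (2 * k n)) sums S {1}"
    unfolding k_def S_def by (rule B(2)[OF z(2)])
  have "(\<lambda>n. of_nat (card (divisor_pairs {1} n)) * (2 * k n)) = (\<lambda>n. if n = 1 then 2 * k 1 else 0)"
    unfolding d1 by auto
  hence S1: "S {1} = 2 * k 1" using s1 sums_single[of 1 "\<lambda>_. 2 * k 1"] by (metis sums_unique2)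
  show "autocorr (weighted_theta {1} c) x = of_real (exp x) * Bessel_K 0 (2 * (c * of_real (exp x)))"
    unfolding W S1 k_def by simp
  define f where "f = (\<lambda>n. if n \<in> X then bessel_coprime_term c x n else 0)"
  have fd: "of_nat (card (divisor_pairs X n)) * k n = f n" for n
    by (simp add: f_def dX k_def bessel_coprime_term_def)
  have kB: "Bessel_K 0 (2 * (c * of_real (exp x) * of_nat n)) = k n" for n by (simp add: k_def)
  have nf: "summable (\<lambda>n. norm (f n))" using B(1)[OF z(1)] unfolding kB fd .
  have "(\<lambda>n. 2 * f n) sums S X"
    using B(2)[OF z(1)] unfolding kB fd[symmetric] by (simp add: S_def mult_ac)
  from sums_mult[OF this, of "1/2"] have "f sums (S X / 2)" by simp
  hence "(f has_sum (S X / 2)) UNIV" using nf by (intro norm_summable_imp_has_sum)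
  also have "?this \<longleftrightarrow> (bessel_coprime_term c x has_sum (S X / 2)) X"
    by (rule has_sum_cong_neutral) (auto simp: f_def)
  finally have hX: "(bessel_coprime_term c x has_sum (S X / 2)) X" .
  have XD: "X = insert 1 D" by (auto simp: X_def D_def)
  have hs: "(bessel_coprime_term c x has_sum (S X / 2)) (insert 1 D)" by (subst XD[symmetric]) (rule hX)
  have D1: "1 \<notin> D" by (simp add: D_def)
  show sm: "bessel_coprime_term c x summable_on D"
    by (rule summable_on_subset_banach[of _ "insert 1 D"]) (use hs in \<open>auto simp: summable_on_def\<close>)
  have "infsum (bessel_coprime_term c x) (insert 1 D) = bessel_coprime_term c x 1 + infsum (bessel_coprime_term c x) D"
    by (rule infsum_insert[OF sm D1])
  moreover have "bessel_coprime_term c x 1 = S {1} / 2"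
    unfolding S1 by (simp add: bessel_coprime_term_def k_def divisor_count_def)
  ultimately have "infsum (bessel_coprime_term c x) D = S X / 2 - S {1} / 2" using infsumI[OF hs] by (simp add: algebra_simps)
  moreover have "of_real (exp (- x)) * complex_of_real (exp x) = 1"
    by (simp only: of_real_mult[symmetric] exp_add[symmetric]) simp
  ultimately show "infsum (bessel_coprime_term c x) D =
           of_real (exp (- x)) * (autocorr (weighted_theta X c) x - autocorr (weighted_theta {1} c) x)"
    unfolding W by (simp only: times_divide_eq_right[symmetric] right_diff_distrib mult.assoc[symmetric]) simp
qed


section \<open>The functional identity and its polar constants\<close>

lemma Re_pos_not_nonpos_Ints: "Re z > 0 \<Longrightarrow> z \<notin> \<int>\<^sub>\<le>\<^sub>0"
  by (auto elim!: nonpos_Ints_cases)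

definition coprimes :: "nat set \<Rightarrow> nat set" where
  "coprimes P = {a. a \<ge> 1 \<and> coprime a (\<Prod>P)}"

text \<open>
  By \<open>coprime_Bessel_sum\<close> this is \<open>exp x\<close> times the sum over \<open>n \<ge> 2\<close>
  in the formula, with \<open>\<surd>\<tau> exp x\<close> in place of \<open>\<surd>(\<tau>t)\<close>.
\<close>
definition coprime_remainder :: "nat set \<Rightarrow> complex \<Rightarrow> real \<Rightarrow> complex" where
  "coprime_remainder P c x = autocorr (weighted_theta (coprimes P) c) x - autocorr (weighted_theta {1} c) x"

context
  fixes P :: "nat set" and c :: complex
  assumes P: "finite P" "\<And>p. p \<in> P \<Longrightarrow> prime p" "P \<noteq> {}" and c: "Re c > 0"

begin

text \<open>
  The autocorrelation for the coprime integers has the expansion; the one for \<open>{1}\<close> is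
  \<open>exp x K\<^sub>0\<close> and only contributes to the error, as \<open>K\<^sub>0\<close> grows more
  slowly at the origin than any negative power.
\<close>
lemma coprime_remainder_log_pole_decay:
  obtains B0 B1 where "log_pole_decay (coprime_remainder P c) B0 B1"
proof -
  obtain \<alpha> K where lim: "\<And>v. norm (weighted_theta (coprimes P) c v - \<alpha>) \<le> K * exp v"
  proof (rule weighted_theta_coprime_limit[OF P c])
    fix \<alpha> K
    assume "\<And>v. norm (weighted_theta {a. a \<ge> 1 \<and> coprime a (\<Prod>P)} c v - \<alpha>) \<le> K * exp v"
    thus ?thesis by (intro that[of \<alpha> K]) (simp add: coprimes_def)
  qed
  obtain B0 B1 where B: "\<And>\<epsilon>. 0 < \<epsilon> \<Longrightarrow> \<epsilon> < 1 \<Longrightarrow>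
      \<exists>C. \<forall>x\<le>0. norm (autocorr (weighted_theta (coprimes P) c) x - (B0 + B1 * of_real x)) \<le> C * exp ((1 - \<epsilon>) * x)"
    by (rule autocorr_asymptotic[OF weighted_theta_measurable weighted_theta_decay[OF c] lim]) blast+
  have "log_pole_decay (coprime_remainder P c) B0 B1"
  proof
    show "coprime_remainder P c \<in> borel_measurable borel" unfolding coprime_remainder_def by measurable
  next
    fix k :: real assume k: "k > 0"
    have "\<exists>C. \<forall>x. norm (autocorr (weighted_theta X c) x) \<le> C * exp (- k * x)" for X
      by (rule autocorr_decay(2)[OF weighted_theta_measurable weighted_theta_decay[OF c] k])
    then obtain C1 C2 where "\<And>x. norm (autocorr (weighted_theta (coprimes P) c) x) \<le> C1 * exp (- k * x)"
      "\<And>x. norm (autocorr (weighted_theta {1} c) x) \<le> C2 * exp (- k * x)" by metis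
    hence "norm (coprime_remainder P c x) \<le> (C1 + C2) * exp (- k * x)" for x
      unfolding coprime_remainder_def distrib_right by (intro order.trans[OF norm_triangle_ineq4] add_mono)
    thus "\<exists>C. \<forall>x. norm (coprime_remainder P c x) \<le> C * exp (- k * x)" by blast
  next
    fix \<epsilon> :: real assume e: "0 < \<epsilon>" "\<epsilon> < 1"
    obtain C1 where C1: "\<And>x. x \<le> 0 \<Longrightarrow> norm (autocorr (weighted_theta (coprimes P) c) x - (B0 + B1 * of_real x)) \<le> C1 * exp ((1 - \<epsilon>) * x)"
      using B[OF e] by blast
    obtain C2 where C2: "C2 \<ge> 0" "\<And>z. Re z > 0 \<Longrightarrow> norm (Bessel_K 0 (2 * z)) \<le> C2 * Re z powr (- \<epsilon>)"
      by (rule Bessel_K_0_bound[OF e(1)]) blast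
    have "norm (autocorr (weighted_theta {1} c) x) \<le> C2 * Re c powr (- \<epsilon>) * exp ((1 - \<epsilon>) * x)" for x
    proof -
      have "norm (autocorr (weighted_theta {1} c) x) = exp x * norm (Bessel_K 0 (2 * (c * of_real (exp x))))"
        unfolding coprime_Bessel_sum(3)[OF c] by (simp add: norm_mult)
      also have "\<dots> \<le> exp x * (C2 * (Re c * exp x) powr (- \<epsilon>))"
        using C2(2)[of "c * of_real (exp x)"] c by (intro mult_left_mono) auto
      also have "\<dots> = C2 * Re c powr (- \<epsilon>) * exp (x + - \<epsilon> * x)"
        unfolding exp_add using c by (simp add: powr_mult) (simp add: powr_def)
      also have "x + - \<epsilon> * x = (1 - \<epsilon>) * x" by (simp add: algebra_simps)
      finally show ?thesis .
    qed
    note C3 = this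
    have "norm (coprime_remainder P c x - (B0 + B1 * of_real x)) \<le> (C1 + C2 * Re c powr (- \<epsilon>)) * exp ((1 - \<epsilon>) * x)" if "x \<le> 0" for x
    proof -
      have "coprime_remainder P c x - (B0 + B1 * of_real x) = (autocorr (weighted_theta (coprimes P) c) x - (B0 + B1 * of_real x)) - autocorr (weighted_theta {1} c) x"
        by (simp add: coprime_remainder_def)
      thus ?thesis unfolding distrib_right
        using order.trans[OF norm_triangle_ineq4 add_mono[OF C1[OF that] C3[of x]]] by (simp only:)
    qed
    thus "\<exists>C. \<forall>x\<le>0. norm (coprime_remainder P c x - (B0 + B1 * of_real x)) \<le> C * exp ((1 - \<epsilon>) * x)" by blast
  qed
  thus ?thesis by (rule that)
qed

lemma coprime_remainder_mellin:
  assumes \<sigma>: "\<sigma> > 2"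
  defines "u \<equiv> Gamma (of_real \<sigma> / 2) * c powr (- (of_real \<sigma> / 2))"
  shows "integrable lborel (\<lambda>x. of_real (exp ((\<sigma> - 1) * x)) * coprime_remainder P c x)"
    and "(LINT x|lborel. of_real (exp ((\<sigma> - 1) * x)) * coprime_remainder P c x) =
           u ^ 2 * ((zeta (of_real \<sigma>) * euler_factor P (of_real \<sigma>)) ^ 2 - 1) / 4"
proof -
  have Re: "Re (complex_of_real \<sigma>) > 1" using \<sigma> by simp
  have ser: "(\<Sum>n. if Suc n \<in> X then of_nat (Suc n) powr (- of_real \<sigma>) else 0) = infsum (\<lambda>a. of_nat a powr (- complex_of_real \<sigma>)) X"
    if "0 \<notin> X" for X
  proof (rule infsum_positive_nat(2)[OF that, symmetric])
    have "summable (\<lambda>n. real (n + 1) powr - \<sigma>)" by (rule summable_real_Suc_powr) (use \<sigma> in simp)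
    thus "summable (\<lambda>n. norm (if Suc n \<in> X then of_nat (Suc n) powr (- complex_of_real \<sigma>) else 0))"
      by (rule summable_comparison_test'[of _ 0]) (auto simp: norm_powr_real_powr simp del: of_nat_Suc)
  qed
  have S1: "(\<Sum>n. if Suc n \<in> (coprimes P) then of_nat (Suc n) powr (- of_real \<sigma>) else 0) = zeta (of_real \<sigma>) * euler_factor P (of_real \<sigma>)"
    using coprime_dirichlet_series[OF P(1,2) Re] by (subst ser) (simp_all add: coprimes_def)
  have S2: "(\<Sum>n. if Suc n \<in> {1} then of_nat (Suc n) powr (- of_real \<sigma>) else 0) = (1 :: complex)"
    by (subst ser) simp_all
  note m1 = autocorr_weighted_theta_mellin[OF c \<sigma>, of "coprimes P", unfolded S1]
  note m2 = autocorr_weighted_theta_mellin[OF c \<sigma>, of "{1}", unfolded S2]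
  show "integrable lborel (\<lambda>x. of_real (exp ((\<sigma> - 1) * x)) * coprime_remainder P c x)"
    unfolding coprime_remainder_def right_diff_distrib using m1(1) m2(1) by (rule Bochner_Integration.integrable_diff)
  show "(LINT x|lborel. of_real (exp ((\<sigma> - 1) * x)) * coprime_remainder P c x) =
           u ^ 2 * ((zeta (of_real \<sigma>) * euler_factor P (of_real \<sigma>)) ^ 2 - 1) / 4"
    unfolding coprime_remainder_def right_diff_distrib Bochner_Integration.integral_diff[OF m1(1) m2(1)] m1(2) m2(2) u_def
    by (simp add: field_simps power2_eq_square)
qed

text \<open>
  For real \<open>s > 2\<close> both sides are \<open>(s - 1)\<^sup>2\<close> times the two evaluations of the
  same Laplace transform: as a difference of squares on the left, folded at the origin on the right. Both sides
  are holomorphic on the half-plane.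
\<close>
lemma regularised_identity:
  assumes "log_pole_decay (coprime_remainder P c) B0 B1" and s: "Re s > 0"
  defines "u \<equiv> (\<lambda>s. Gamma (s / 2) * c powr (- (s / 2)))"
  shows "u s ^ 2 * ((zeta_reg s * euler_factor P s) ^ 2 - (s - 1) ^ 2) / 4 =
           (s - 1) ^ 2 * folded_mellin (coprime_remainder P c) B0 B1 s + B0 * (s - 1) - B1"
proof (rule holomorphic_eq_halfplane[OF _ _ _ s, of _ _ 2])
  interpret log_pole_decay "coprime_remainder P c" B0 B1 by fact
  have c0: "c \<noteq> 0" using c by auto
  have G: "(\<lambda>s. Gamma (s / 2)) holomorphic_on {s. Re s > 0}"
    by (intro holomorphic_intros) (auto intro!: Re_pos_not_nonpos_Ints)
  show "(\<lambda>s. u s ^ 2 * ((zeta_reg s * euler_factor P s) ^ 2 - (s - 1) ^ 2) / 4) holomorphic_on {s. Re s > 0}"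
    unfolding u_def by (intro holomorphic_intros G zeta_reg_holomorphic euler_factor_holomorphic[OF P(1,2)]) (use c0 in auto)
  show "(\<lambda>s. (s - 1) ^ 2 * folded_mellin (coprime_remainder P c) B0 B1 s + B0 * (s - 1) - B1) holomorphic_on {s. Re s > 0}"
    by (intro holomorphic_intros folded_mellin_holomorphic)
  fix \<sigma> :: real assume \<sigma>: "\<sigma> > 2"
  define S where "S = complex_of_real \<sigma>"
  have ne: "S - 1 \<noteq> 0" using \<sigma> unfolding S_def by simp
  have "S \<noteq> 1" using ne by auto
  have z: "zeta_reg S = (S - 1) * zeta S" by (rule zeta_reg_eq) (use \<sigma> \<open>S \<noteq> 1\<close> in \<open>auto simp: S_def\<close>)
  have "\<sigma> > 1" using \<sigma> by simp
  from mellin_eq_folded[OF this coprime_remainder_mellin(1)[OF \<sigma>]]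
  have "u S ^ 2 * ((zeta S * euler_factor P S) ^ 2 - 1) / 4 = folded_mellin (coprime_remainder P c) B0 B1 S + B0 / (S - 1) - B1 / (S - 1) ^ 2"
    unfolding coprime_remainder_mellin(2)[OF \<sigma>] u_def S_def .
  hence "(S - 1) ^ 2 * (u S ^ 2 * ((zeta S * euler_factor P S) ^ 2 - 1) / 4) = (S - 1) ^ 2 * (folded_mellin (coprime_remainder P c) B0 B1 S + B0 / (S - 1) - B1 / (S - 1) ^ 2)"
    by simp
  also have "\<dots> = (S - 1) ^ 2 * folded_mellin (coprime_remainder P c) B0 B1 S + B0 * (S - 1) - B1"
  proof -
    have "d ^ 2 * (F + a / d - b / d ^ 2) = d ^ 2 * F + a * d - b" if "d \<noteq> 0" for d F a b :: complex
      using that by (simp add: distrib_left right_diff_distrib power2_eq_square)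
    from this[OF ne] show ?thesis .
  qed
  finally have eq: "(S - 1) ^ 2 * (u S ^ 2 * ((zeta S * euler_factor P S) ^ 2 - 1) / 4) =
           (S - 1) ^ 2 * folded_mellin (coprime_remainder P c) B0 B1 S + B0 * (S - 1) - B1" .
  show "u S ^ 2 * ((zeta_reg S * euler_factor P S) ^ 2 - (S - 1) ^ 2) / 4 =
           (S - 1) ^ 2 * folded_mellin (coprime_remainder P c) B0 B1 S + B0 * (S - 1) - B1"
  proof -
    have "d ^ 2 * (U * (Z ^ 2 - 1) / 4) = U * ((d * Z) ^ 2 - d ^ 2) / 4" for d U Z :: complex
      by (simp add: power_mult_distrib algebra_simps)
    from this[of "S - 1" "u S ^ 2" "zeta S * euler_factor P S"] show ?thesis
      unfolding z using eq by (simp only: mult.assoc)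
  qed
qed

text \<open>
  At \<open>s = 1\<close> the right-hand side of the regularised identity has value \<open>-B1\<close> and
  derivative \<open>B0\<close>. On the left the value is \<open>h(1)\<^sup>2 / 4\<close> and the derivative
  \<open>h(1) h'(1) / 2\<close>, where \<open>h(s) = \<Gamma>(s/2) c^(-s/2) (s - 1) \<zeta>(s)\<close>
  times the Euler factor; its derivative involves \<open>\<psi>(1/2) = -\<gamma> - 2 ln 2\<close>, Euler's
  constant from the zeta function, and the derivative of the Euler factor.
\<close>
lemma log_pole_constants:
  assumes lp: "log_pole_decay (coprime_remainder P c) B0 B1"
  defines "A \<equiv> euler_factor P 1" and "A' \<equiv> - moebius_sum (\<Prod>P) (\<lambda>n. of_real (ln (real n)) * of_nat n powr (- 1))"
  shows "B1 = - (of_real pi * A ^ 2 / (4 * c))"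
    and "B0 = of_real pi / (4 * c) * A * (2 * A' + (of_real euler_mascheroni - of_real (2 * ln 2) - ln c) * A)"
proof -
  interpret log_pole_decay "coprime_remainder P c" B0 B1 by fact
  define u where "u = (\<lambda>s. Gamma (s / 2) * c powr (- (s / 2)))"
  have c0: "c \<noteq> 0" using c by auto
  have u1: "u 1 ^ 2 = of_real pi / c"
  proof -
    have "(c powr (- (1 / 2))) ^ 2 = c powr (- (1 / 2) + - (1 / 2))" unfolding powr_add power2_eq_square ..
    also have "\<dots> = inverse c" using c0 by (simp add: powr_minus)
    finally have "(c powr (- (1 / 2))) ^ 2 = inverse c" .
    moreover have "Gamma (1 / 2 :: complex) ^ 2 = of_real pi"
    proof -
      have "Gamma (1 / 2 :: complex) = of_real (sqrt pi)" by (simp add: Gamma_one_half_complex)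
      hence "Gamma (1 / 2 :: complex) ^ 2 = of_real (sqrt pi ^ 2)" by (simp only: of_real_power)
      thus ?thesis by simp
    qed
    ultimately show ?thesis by (simp only: u_def power_mult_distrib divide_inverse[of "of_real pi"])
  qed
  have one: "Re (1 :: complex) > 0" by simp
  have id: "u s ^ 2 * ((zeta_reg s * euler_factor P s) ^ 2 - (s - 1) ^ 2) / 4 =
           (s - 1) ^ 2 * folded_mellin (coprime_remainder P c) B0 B1 s + B0 * (s - 1) - B1" if "Re s > 0" for s
    unfolding u_def by (rule regularised_identity[OF lp that])
  have "u 1 ^ 2 * A ^ 2 / 4 = - B1" using id[OF one] zeta_reg_at_1(1) by (simp add: A_def)
  thus "B1 = - (of_real pi * A ^ 2 / (4 * c))" unfolding u1 using c0 by (simp add: field_simps)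
  have du: "(u has_field_derivative u 1 * ((Digamma (1 / 2) - ln c) / 2)) (at 1)"
  proof -
    have g: "((\<lambda>s::complex. s / 2) has_field_derivative 1 / 2) (at 1)" by (auto intro!: derivative_eq_intros)
    have G0: "(Gamma has_field_derivative Gamma (1 / 2) * Digamma (1 / 2)) (at ((1 :: complex) / 2))"
      by (rule has_field_derivative_Gamma) (simp add: Re_pos_not_nonpos_Ints)
    note G = DERIV_chain2[OF G0 g]
    have Q: "((\<lambda>s. c powr (- (s / 2))) has_field_derivative c powr (- (1 / 2)) * (- (1 / 2) * ln c)) (at 1)"
    proof -
      have "((\<lambda>s. exp (- (s / 2) * ln c)) has_field_derivative exp (- (1 / 2) * ln c) * (- (1 / 2) * ln c)) (at 1)"
        by (auto intro!: derivative_eq_intros)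
      thus ?thesis using c0 by (simp add: powr_def)
    qed
    define a where "a = Gamma (1 / 2 :: complex)"
    define q where "q = c powr (- (1 / 2))"
    have "Gamma (1 / 2) * Digamma (1 / 2) * (1 / 2) * c powr (- (1 / 2)) + c powr (- (1 / 2)) * (- (1 / 2) * ln c) * Gamma (1 / 2)
        = u 1 * ((Digamma (1 / 2) - ln c) / 2)"
      unfolding u_def a_def[symmetric] q_def[symmetric] by (simp add: field_simps)
    with DERIV_mult[OF G Q] show ?thesis unfolding u_def by (simp only:)
  qed
  have dA: "(euler_factor P has_field_derivative A') (at 1)"
    unfolding A'_def using euler_factor_derivative[OF P(1,2), of 1] by simp
  define h where "h = (\<lambda>s. u s * zeta_reg s * euler_factor P s)"
  define h' where "h' = (u 1 * ((Digamma (1 / 2) - ln c) / 2) + u 1 * of_real euler_mascheroni) * A + u 1 * A'"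
  have dh: "(h has_field_derivative h') (at 1)"
    unfolding h_def h'_def
    using DERIV_mult[OF DERIV_mult[OF du zeta_reg_at_1(2)] dA] by (simp add: zeta_reg_at_1(1) A_def algebra_simps)
  have h1: "h 1 = u 1 * A" by (simp add: h_def zeta_reg_at_1(1) A_def)
  define L where "L = (\<lambda>s. (h s * h s - u s ^ 2 * (s - 1) ^ 2) / 4)"
  have dL: "(L has_field_derivative (h' * h 1 / 2)) (at 1)"
  proof -
    have 1: "((\<lambda>s. h s * h s) has_field_derivative h' * h 1 + h' * h 1) (at 1)" by (rule DERIV_mult[OF dh dh])
    have 2: "((\<lambda>s. u s ^ 2 * (s - 1) ^ 2) has_field_derivative 0) (at 1)"
      by (rule derivative_eq_intros du refl)+ simp
    from DERIV_cdivide[OF DERIV_diff[OF 1 2], of 4] show ?thesis unfolding L_def by simp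
  qed
  have "folded_mellin (coprime_remainder P c) B0 B1 field_differentiable (at 1)"
    by (rule holomorphic_on_imp_differentiable_at[OF folded_mellin_holomorphic open_halfspace_Re_gt]) simp
  then obtain F' where F': "(folded_mellin (coprime_remainder P c) B0 B1 has_field_derivative F') (at 1)"
    unfolding field_differentiable_def by blast
  have "((\<lambda>s. (s - 1) ^ 2 * folded_mellin (coprime_remainder P c) B0 B1 s + B0 * (s - 1) - B1) has_field_derivative B0) (at 1)"
    by (rule derivative_eq_intros F' refl)+ simp
  note D = this
  have "(L has_field_derivative B0) (at 1)"
  proof (rule has_field_derivative_transform_within_open[OF D open_halfspace_Re_gt[of 0]])
    fix s assume "s \<in> {s. 0 < Re s}"
    thus "(s - 1) ^ 2 * folded_mellin (coprime_remainder P c) B0 B1 s + B0 * (s - 1) - B1 = L s"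
      using id[of s, symmetric] by (simp only: L_def h_def mem_Collect_eq) (simp add: power2_eq_square algebra_simps)
  qed simp
  from DERIV_unique[OF this dL] have "B0 = h' * h 1 / 2" .
  also have "\<dots> = u 1 ^ 2 / 4 * A * ((Digamma (1 / 2) - ln c + 2 * of_real euler_mascheroni) * A + 2 * A')"
    unfolding h'_def h1 by (simp add: field_simps power2_eq_square)
  also have "Digamma (1 / 2 :: complex) = - of_real euler_mascheroni - of_real (2 * ln 2)"
    using Digamma_one_half[where 'a = complex] by simp
  also have "(- of_real euler_mascheroni - of_real (2 * ln 2) - ln c + 2 * of_real euler_mascheroni) * A + 2 * A'
      = 2 * A' + (of_real euler_mascheroni - of_real (2 * ln 2) - ln c) * A"
    by (simp only: algebra_simps) simp
  also have "u 1 ^ 2 / 4 = of_real pi / (4 * c)" unfolding u1 by (simp add: mult.commute)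
  finally show "B0 = of_real pi / (4 * c) * A * (2 * A' + (of_real euler_mascheroni - of_real (2 * ln 2) - ln c) * A)" .
qed

end


section \<open>The formula\<close>

lemma Re_csqrt_pos:
  assumes "Re \<tau> > 0"
  shows "Re (csqrt \<tau>) > 0"
proof (rule ccontr)
  assume "\<not> Re (csqrt \<tau>) > 0"
  hence "Re (csqrt \<tau>) = 0" using Re_csqrt[of \<tau>] by linarith
  moreover have "Re (w ^ 2) = - (Im w ^ 2)" if "Re w = 0" for w using that by (simp add: Re_power2)
  ultimately have "Re (csqrt \<tau> ^ 2) = - (Im (csqrt \<tau>) ^ 2)" by blast
  hence "Re \<tau> = - (Im (csqrt \<tau>) ^ 2)" by (simp only: power2_csqrt)
  thus False using assms zero_le_power2[of "Im (csqrt \<tau>)"] by linarith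
qed

lemma csqrt_scale:
  assumes \<tau>: "Re \<tau> > 0" and r: "r > 0"
  shows "csqrt (\<tau> * of_real (r ^ 2)) = csqrt \<tau> * of_real r"
    and "csqrt (\<tau> / of_real (r ^ 2)) = csqrt \<tau> / of_real r"
    and "csqrt (of_real (r ^ 2) / \<tau>) = of_real r / csqrt \<tau>"
proof -
  note z = Re_csqrt_pos[OF \<tau>]
  have nz: "csqrt \<tau> \<noteq> 0" using z by auto
  have "Re (1 / w) > 0" if "Re w > 0" for w :: complex
    using that by (simp add: Re_divide) (auto intro!: divide_pos_pos add_pos_nonneg)
  from this[OF z] have iz: "Re (1 / csqrt \<tau>) > 0" .
  show "csqrt (\<tau> * of_real (r ^ 2)) = csqrt \<tau> * of_real r"
    by (rule csqrt_unique) (use z r in \<open>auto simp: power_mult_distrib\<close>)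
  show "csqrt (\<tau> / of_real (r ^ 2)) = csqrt \<tau> / of_real r"
    by (rule csqrt_unique) (use z r in \<open>auto simp: power_divide\<close>)
  have "Re (of_real r * (1 / csqrt \<tau>)) > 0" using iz r by (simp only: Re_complex_of_real Im_complex_of_real times_complex.sel) simp
  thus "csqrt (of_real (r ^ 2) / \<tau>) = of_real r / csqrt \<tau>"
    by (intro csqrt_unique) (simp_all add: power_divide)
qed

lemma ln_csqrt:
  assumes "Re \<tau> > 0"
  shows "ln (csqrt \<tau>) = ln \<tau> / 2"
proof -
  have "\<tau> \<noteq> 0" using assms by auto
  hence "csqrt \<tau> = exp (ln \<tau> / 2)" by (rule csqrt_exp_Ln)
  thus ?thesis using mpi_less_Im_Ln[OF \<open>\<tau> \<noteq> 0\<close>] Im_Ln_le_pi[OF \<open>\<tau> \<noteq> 0\<close>] by (simp add: Ln_exp)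
qed

lemma ln_of_real_mult: "r > 0 \<Longrightarrow> z \<noteq> 0 \<Longrightarrow> ln (complex_of_real r * z) = of_real (ln r) + ln z"
  using Ln_times_of_real[of r z] Ln_of_real[of r] by simp

theorem theorem1p2:
  fixes P :: "nat set" and \<tau> s :: complex
  assumes "finite P" and "P \<noteq> {}" and "\<And>p. p \<in> P \<Longrightarrow> prime p"
    and "Re \<tau> > 0" and "Re s > 0" and "s \<noteq> 1"
  shows
    "let N = \<Prod>P;
         A = (\<Prod>p\<in>P. 1 - 1 / of_nat p) :: complex;
         L = (\<Sum>n | n dvd N. of_int (moebius_mu n) / of_nat n * of_real (ln (real n))) :: complex;
         D = {n. n \<ge> 2 \<and> coprime n N};
         a = (\<lambda>(z::complex) n. of_nat (divisor_count n) * Bessel_K 0 (2 * of_nat n * of_real pi * z));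
         F = (\<lambda>t::real. of_real t powr (s / 2 - 1) *
               ((\<Sum>\<^sub>\<infinity>n\<in>D. a (csqrt (\<tau> * of_real t)) n)
                + of_real t powr (- s) *
                  ((\<Sum>\<^sub>\<infinity>n\<in>D. a (csqrt (\<tau> / of_real t)) n)
                   - 1 / 4 * csqrt (of_real t / \<tau>) * A *
                     (- 2 * L
                      + (of_real euler_mascheroni - ln (4 * of_real pi * csqrt (\<tau> / of_real t))) * A))))
     in (\<forall>t\<ge>1. a (csqrt (\<tau> * of_real t)) summable_on D \<and> a (csqrt (\<tau> / of_real t)) summable_on D)
        \<and> set_integrable lborel {1..} F
        \<and> zeta s ^ 2 * (\<Prod>p\<in>P. 1 - 1 / of_nat p powr s) ^ 2 =
            1 + of_real pi powr s * \<tau> powr (s / 2) / Gamma (s / 2) ^ 2 *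
              (1 / ((s - 1) * csqrt \<tau>) * A *
                 (- 2 * L
                  + (1 / (s - 1) + of_real euler_mascheroni - ln (4 * of_real pi * csqrt \<tau>)) * A)
               + 2 * (LINT t:{1..}|lborel. F t))"
proof -
  define N where "N = \<Prod>P"
  define A where "A = ((\<Prod>p\<in>P. 1 - 1 / of_nat p) :: complex)"
  define L where "L = ((\<Sum>n | n dvd N. of_int (moebius_mu n) / of_nat n * of_real (ln (real n))) :: complex)"
  define D where "D = {n. n \<ge> 2 \<and> coprime n N}"
  define a where "a = (\<lambda>(z::complex) n. of_nat (divisor_count n) * Bessel_K 0 (2 * of_nat n * of_real pi * z))"
  define F where "F = (\<lambda>t::real. of_real t powr (s / 2 - 1) *
               ((\<Sum>\<^sub>\<infinity>n\<in>D. a (csqrt (\<tau> * of_real t)) n)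
                + of_real t powr (- s) *
                  ((\<Sum>\<^sub>\<infinity>n\<in>D. a (csqrt (\<tau> / of_real t)) n)
                   - 1 / 4 * csqrt (of_real t / \<tau>) * A *
                     (- 2 * L
                      + (of_real euler_mascheroni - ln (4 * of_real pi * csqrt (\<tau> / of_real t))) * A))))"
  define z0 where "z0 = csqrt \<tau>"
  define c where "c = of_real pi * z0"
  have z0: "Re z0 > 0" unfolding z0_def by (rule Re_csqrt_pos) fact
  have z0n: "z0 \<noteq> 0" using z0 by auto
  have c: "Re c > 0" using z0 by (simp add: c_def)
  have c0: "c \<noteq> 0" using c by auto
  note P = assms(1) assms(3) assms(2)
  obtain B0 B1 where lp: "log_pole_decay (coprime_remainder P c) B0 B1"
    by (rule coprime_remainder_log_pole_decay[OF P c])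
  interpret log_pole_decay "coprime_remainder P c" B0 B1 by fact
  define g where "g = (of_real euler_mascheroni - ln (4 * of_real pi * z0) :: complex)"
  have A1: "euler_factor P 1 = A" by (simp add: euler_factor_def A_def)
  have L1: "moebius_sum (\<Prod>P) (\<lambda>n. of_real (ln (real n)) * of_nat n powr (- 1)) = L"
    unfolding moebius_sum_def L_def N_def by (intro sum.cong refl) (simp add: powr_minus divide_inverse)
  have ln4: "ln (4 * of_real pi * (z0 * of_real r)) = of_real (ln (4 * pi)) + of_real (ln r) + ln z0" if "r > 0" for r
  proof -
    have e: "4 * of_real pi * (z0 * of_real r) = of_real (4 * pi * r) * z0" by simp
    have "ln (4 * pi * r) = ln (4 * pi) + ln r" using that by (simp add: ln_mult)
    thus ?thesis unfolding e using that z0n by (subst ln_of_real_mult) (auto simp only: of_real_add pi_gt_zero mult_pos_pos zero_less_numeral)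
  qed
  have pc: "of_real pi / (4 * c) = 1 / (4 * z0)" using z0n by (simp add: c_def)
  have B1: "B1 = - (A ^ 2 / (4 * z0))"
    using log_pole_constants(1)[OF P c lp] unfolding A1 using z0n by (simp add: c_def)
  have B0: "B0 = 1 / (4 * z0) * A * (- 2 * L + g * A)"
  proof -
    have "ln c = of_real (ln pi) + ln z0" unfolding c_def using z0n by (intro ln_of_real_mult) auto
    moreover have "ln (4 * of_real pi * z0) = of_real (ln (4 * pi)) + ln z0" using ln4[of 1] by simp
    moreover have "ln (4 * pi) = 2 * ln 2 + ln pi" using ln_realpow[of 2 2] by (simp add: ln_mult)
    ultimately have "of_real euler_mascheroni - of_real (2 * ln 2) - ln c = g" unfolding g_def by simp
    thus ?thesis using log_pole_constants(2)[OF P c lp] unfolding A1 L1 pc by simp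
  qed
  have sums: "(\<lambda>n. a (z0 * of_real (exp x)) n) summable_on D"
      "(\<Sum>\<^sub>\<infinity>n\<in>D. a (z0 * of_real (exp x)) n) = of_real (exp (- x)) * coprime_remainder P c x" for x
  proof -
    have e: "(\<lambda>n. a (z0 * of_real (exp x)) n) = bessel_coprime_term c x"
      by (simp add: a_def bessel_coprime_term_def c_def mult_ac fun_eq_iff)
    show "(\<lambda>n. a (z0 * of_real (exp x)) n) summable_on D" unfolding e D_def by (rule coprime_Bessel_sum(1)[OF c])
    show "(\<Sum>\<^sub>\<infinity>n\<in>D. a (z0 * of_real (exp x)) n) = of_real (exp (- x)) * coprime_remainder P c x"
      unfolding e D_def N_def coprime_remainder_def coprimes_def by (rule coprime_Bessel_sum(2)[OF c])
  qed
  have cs: "csqrt (\<tau> * of_real (exp (2 * x))) = z0 * of_real (exp x)"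
      "csqrt (\<tau> / of_real (exp (2 * x))) = z0 * of_real (exp (- x))"
      "csqrt (of_real (exp (2 * x)) / \<tau>) = of_real (exp x) / z0" for x
    using csqrt_scale[OF assms(4), of "exp x"]
    by (simp_all only: exp_double z0_def exp_gt_zero exp_minus of_real_inverse divide_inverse simp_thms)
  define H where "H = (\<lambda>x::real. exp (- (1 - s) * of_real x) * coprime_remainder P c x
      + exp (- (s - 1) * of_real x) * (coprime_remainder P c (- x) - (B0 - B1 * of_real x)))"
  have [measurable]: "H \<in> borel_measurable borel" unfolding H_def by measurable
  \<comment> \<open>In the variable \<open>x\<close> the integrand is twice that of the folded transform: up to
    powers of \<open>exp x\<close>, the sum at \<open>t\<close> is \<open>R(x)\<close>, the one at \<open>1/t\<close> is \<open>R(-x)\<close>, and the logarithmic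
    term is \<open>B0 - B1 x\<close>.\<close>
  have FH: "(2 * exp (2 * x)) *\<^sub>R F (exp (2 * x)) = 2 * H x" for x
  proof -
    define E where "E = complex_of_real (exp x)"
    have main: "1 / 4 * (E / z0) * A * (- 2 * L + (of_real euler_mascheroni - ln (4 * of_real pi * (z0 * of_real (exp (- x))))) * A)
        = E * (B0 - B1 * of_real x)"
    proof -
      have e: "of_real euler_mascheroni - ln (4 * of_real pi * (z0 * of_real (exp (- x)))) = g + of_real x"
        unfolding g_def using ln4[of "exp (- x)"] ln4[of 1] by simp
      show ?thesis unfolding e B0 B1 using z0n by (simp add: field_simps power2_eq_square)
    qed
    have pw: "complex_of_real (exp (2 * x)) powr w = exp (w * of_real (2 * x))" for w
      by (simp add: powr_def flip: exp_of_real)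
    have E1: "of_real (exp (- x)) = 1 / E" "of_real (exp (- (- x))) = E" by (simp_all add: E_def exp_minus divide_inverse)
    have En: "E \<noteq> 0" by (simp add: E_def)
    have Ee: "E = exp (of_real x)" "complex_of_real (exp (2 * x)) = exp (of_real (2 * x))" unfolding E_def by (simp_all only: exp_of_real)
    have "F (exp (2 * x)) = exp ((s / 2 - 1) * of_real (2 * x)) *
        (1 / E * coprime_remainder P c x + exp (- s * of_real (2 * x)) * (E * coprime_remainder P c (- x) - E * (B0 - B1 * of_real x)))"
      unfolding F_def cs sums(2) pw unfolding E_def[symmetric] unfolding main unfolding E1 ..
    also have "2 * complex_of_real (exp (2 * x)) * \<dots> =
       2 * ((exp (of_real (2 * x)) * exp ((s / 2 - 1) * of_real (2 * x)) / E) * coprime_remainder P c x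
         + (exp (of_real (2 * x)) * exp ((s / 2 - 1) * of_real (2 * x)) * exp (- s * of_real (2 * x)) * E) * (coprime_remainder P c (- x) - (B0 - B1 * of_real x)))"
      unfolding Ee(2) by (simp add: algebra_simps)
    also have "exp (of_real (2 * x)) * exp ((s / 2 - 1) * of_real (2 * x)) / E = exp (- (1 - s) * of_real x)"
      unfolding Ee(1) exp_add[symmetric] exp_diff[symmetric] by (simp add: algebra_simps)
    also have "exp (of_real (2 * x)) * exp ((s / 2 - 1) * of_real (2 * x)) * exp (- s * of_real (2 * x)) * E = exp (- (s - 1) * of_real x)"
      unfolding Ee(1) exp_add[symmetric] by (simp add: algebra_simps)
    finally show ?thesis unfolding H_def by (simp add: scaleR_conv_of_real)
  qed
  \<comment> \<open>\<open>F2\<close> agrees with \<open>F\<close> on \<open>[1, \<infinity>)\<close> and is visibly measurable on the whole line.\<close>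
  define F2 where "F2 = (\<lambda>t::real. (2 / (2 * t)) *\<^sub>R H (ln t / 2))"
  have [measurable]: "F2 \<in> borel_measurable borel" unfolding F2_def by measurable
  have FF2: "F t = F2 t" if t: "t \<ge> 1" for t
  proof -
    have e: "exp (2 * (ln t / 2)) = t" using t by simp
    have "(2 * t) *\<^sub>R F t = 2 * H (ln t / 2)" using FH[of "ln t / 2"] unfolding e .
    hence "(1 / (2 * t)) *\<^sub>R ((2 * t) *\<^sub>R F t) = (1 / (2 * t)) *\<^sub>R (2 * H (ln t / 2))" by simp
    thus ?thesis using t by (simp add: F2_def scaleR_conv_of_real)
  qed
  have img: "{1..} = (\<lambda>x. exp (2 * x)) ` {0::real..}"
  proof (intro set_eqI iffI)
    fix t :: real assume "t \<in> {1..}"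
    thus "t \<in> (\<lambda>x. exp (2 * x)) ` {0..}" by (intro image_eqI[of _ _ "ln t / 2"]) auto
  qed auto
  have F2H: "(2 * exp (2 * x)) *\<^sub>R F2 (exp (2 * x)) = 2 * H x" for x
    by (simp add: F2_def scaleR_conv_of_real)
  note fmi = folded_mellin_integrable[OF assms(5)]
  have HI: "set_integrable lborel {0..} (\<lambda>x. 2 * H x)"
    unfolding H_def by (intro set_integrable_mult_right set_integral_add(1) fmi)
  have HL: "(LINT x:{0..}|lborel. 2 * H x) = 2 * folded_mellin (coprime_remainder P c) B0 B1 s"
    unfolding H_def folded_mellin_def set_integral_add(2)[OF fmi, symmetric] by (rule set_integral_mult_right)
  have F2I: "set_integrable lborel {1..} F2"
    using set_integral_exp_substitution(1)[OF _ _ _ _ img, of F2] HI unfolding F2H by simp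
  have F2L: "(LINT t:{1..}|lborel. F2 t) = 2 * folded_mellin (coprime_remainder P c) B0 B1 s"
    using set_integral_exp_substitution(2)[OF _ _ _ _ img, of F2] HL unfolding F2H by simp
  have FI: "set_integrable lborel {1..} F"
    using F2I by (rule iffD1[OF set_integrable_cong, rotated -1]) (auto simp: FF2)
  have FL: "(LINT t:{1..}|lborel. F t) = 2 * folded_mellin (coprime_remainder P c) B0 B1 s"
    unfolding F2L[symmetric] by (rule set_lebesgue_integral_cong) (auto simp: FF2)
  have summ: "\<forall>t\<ge>1. a (csqrt (\<tau> * of_real t)) summable_on D \<and> a (csqrt (\<tau> / of_real t)) summable_on D"
  proof (intro allI impI)
    fix t :: real assume t: "t \<ge> 1"
    have e: "exp (2 * (ln t / 2)) = t" using t by simp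
    show "a (csqrt (\<tau> * of_real t)) summable_on D \<and> a (csqrt (\<tau> / of_real t)) summable_on D"
      using sums(1)[of "ln t / 2"] sums(1)[of "- (ln t / 2)"] cs(1,2)[of "ln t / 2"] unfolding e by simp
  qed
  define Y where "Y = folded_mellin (coprime_remainder P c) B0 B1 s"
  define Z where "Z = zeta s * euler_factor P s"
  define G where "G = Gamma (s / 2)"
  define d where "d = s - 1"
  have d: "d \<noteq> 0" using assms(6) by (simp add: d_def)
  have G: "G \<noteq> 0" using Re_pos_not_nonpos_Ints[of "s / 2"] assms(5) by (simp add: G_def Gamma_eq_zero_iff)
  have U: "(G * c powr (- (s / 2))) ^ 2 = G ^ 2 / c powr s"
  proof -
    have "(c powr (- (s / 2))) ^ 2 = c powr (- (s / 2) + - (s / 2))" unfolding powr_add power2_eq_square ..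
    also have "- (s / 2) + - (s / 2) = - s" by simp
    finally have e: "(c powr (- (s / 2))) ^ 2 = c powr (- s)" .
    show ?thesis unfolding power_mult_distrib e by (simp only: powr_minus divide_inverse)
  qed
  have cpow: "c powr s = of_real pi powr s * \<tau> powr (s / 2)"
  proof -
    have "ln c = of_real (ln pi) + ln \<tau> / 2"
      unfolding c_def using z0n ln_csqrt[OF assms(4)] by (subst ln_of_real_mult) (auto simp: z0_def)
    moreover have "\<tau> \<noteq> 0" using assms(4) by auto
    ultimately show ?thesis using c0 by (simp add: powr_def exp_add[symmetric] Ln_of_real algebra_simps)
  qed
  have reg: "(G * c powr (- (s / 2))) ^ 2 * ((d * Z) ^ 2 - d ^ 2) / 4 = d ^ 2 * Y + B0 * d - B1"
    using regularised_identity[OF P c lp assms(5)] zeta_reg_eq[OF assms(5,6)]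
    by (simp add: G_def Y_def Z_def d_def mult.assoc)
  have key: "G ^ 2 / c powr s * (d ^ 2 * (Z ^ 2 - 1)) = 4 * (d ^ 2 * Y + B0 * d - B1)"
  proof -
    have "d ^ 2 * (Z ^ 2 - 1) = (d * Z) ^ 2 - d ^ 2" by (simp add: power_mult_distrib algebra_simps)
    thus ?thesis unfolding reg[symmetric] U by simp
  qed
  have cs0: "c powr s \<noteq> 0" using c0 by simp
  have "Z ^ 2 = 1 + c powr s / G ^ 2 * (4 * (Y + B0 / d - B1 / d ^ 2))"
  proof -
    have "4 * (Y + B0 / d - B1 / d ^ 2) = 4 * (d ^ 2 * Y + B0 * d - B1) / d ^ 2"
      using d by (simp add: power2_eq_square add_divide_distrib diff_divide_distrib)
    also have "\<dots> = G ^ 2 / c powr s * (Z ^ 2 - 1)" unfolding key[symmetric] using d by simp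
    finally show ?thesis using G cs0 by simp
  qed
  also have "4 * (Y + B0 / d - B1 / d ^ 2) = 1 / (d * z0) * A * (- 2 * L + (1 / d + g) * A) + 2 * (2 * Y)"
  proof -
    have "4 * (Y + (1 / 4 * i * A * (- 2 * L + g * A)) * j - (- (A ^ 2 * i / 4)) * j ^ 2)
        = j * i * A * (- 2 * L + (j + g) * A) + 2 * (2 * Y)" for i j
      by (simp add: algebra_simps power2_eq_square)
    from this[of "1 / z0" "1 / d"] show ?thesis unfolding B0 B1 by (simp add: power_divide mult_ac)
  qed
  finally have fin: "zeta s ^ 2 * (\<Prod>p\<in>P. 1 - 1 / of_nat p powr s) ^ 2 =
            1 + of_real pi powr s * \<tau> powr (s / 2) / Gamma (s / 2) ^ 2 *
              (1 / ((s - 1) * csqrt \<tau>) * A *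
                 (- 2 * L
                  + (1 / (s - 1) + of_real euler_mascheroni - ln (4 * of_real pi * csqrt \<tau>)) * A)
               + 2 * (LINT t:{1..}|lborel. F t))"
    unfolding FL Z_def euler_factor_def power_mult_distrib cpow G_def d_def Y_def g_def z0_def
    by (simp only: add_diff_eq)
  from summ FI fin show ?thesis
    unfolding Let_def F_def a_def D_def A_def L_def N_def by (intro conjI)
qed

end
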